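(* Let $\alpha\in(0,1)$, $n\ge2$, $J\ge J_0$ with $2^J\le n$, and consider the Gaussian white noise model with $f_0\in B^s_{\infty,\infty}$, a sieve prior $\Pi_\beta$ on $\mathbb R^{2^J}$, the weight sequence $w$, and the Castillo–Nickl band $\mathcal C_w(\hat f_J,\hat R_\alpha)$ described in the context. Assume that for some $C_1>0$ $$\pi(\beta_0)\ge n^{2^J/2}\,n^{-C_12^J}\quad\text{and}\quad\phi_{\Pi_\beta}(1/\sqrt n)\le1/2 .$$ Then there exist positive constants $c_1,c_2,c_3$ depending only on $C_1$ and $\alpha$ such that the following hold. For every $B>0$ with $\|f_0\|_{B^s_{\infty,\infty}}\le B$, $$|\mathbb P(f_0\in\mathcal C_w(\hat f_J,\hat R_\alpha))-(1-\alpha)|\le\phi_{\Pi_\beta}\big(c_1\sqrt{2^J\log n}\big)+c_1n^{-c_22^J}+\mathbb P(Y\notin\tilde H_2).$$ In addition, assume that $\phi_{\Pi_\beta}(c_1\sqrt{2^J\log n})+c_1n^{-c_22^J}<\min\{\alpha/2,(1-\alpha)/2\}$. Then the $L^\infty$-diameter of $\mathcal C_w^B(\hat f_J,\hat R_\alpha):=\mathcal C_w(\hat f_J,\hat R_\alpha)\cap\{f:\|f\|_{B^s_{\infty,\infty}}\le B\}$ satisfies $$\sup_{f,g\in\mathcal C_w^B(\hat f_J,\hat R_\alpha)}\|f-g\|_\infty\le c_3\Big(v_J\sqrt{\frac{2^JJ}{n}}+2^{-Js}B\Big)$$ with probability at least $1-c_1n^{-c_22^J}$. If in addition $n=n_J$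 is such that $$\frac{\sqrt n\,\overline w_JB}{u_JJ2^{J(s+1/2)}}\downarrow0\quad\text{as }J\to\infty,$$ then $\mathbb P(Y\notin\tilde H_2)\le c_1n^{-c_22^J}$ for all sufficiently large $J$ (for the given sequence $(n_J)$, depending only on $\alpha$, $\{w_l\}$ and $B$).
   Context: Model: $dY(t)=f_0(t)dt+n^{-1/2}dW(t)$, $t\in[0,1]$, with $dW$ canonical white noise. Wavelets and function space (fixed throughout): $s>0$, $S>s$ an integer, $J_0=J_0(S)$ sufficiently large, $\{\phi_{J_0,k}:0\le k\le2^{J_0}-1\}\cup\{\psi_{l,k}:l\ge J_0,0\le k\le2^l-1\}$ an $S$-regular Cohen–Daubechies–Vial wavelet basis of $L^2[0,1]$, with the convention $\psi_{J_0-1,k}:=\phi_{J_0,k}$ for $0\le k\le2^{J_0}-1$. $\langle\cdot,\cdot\rangle$ is the $L^2[0,1]$ inner product. $\|f\|_{B^s_{\infty,\infty}}=\max_{0\le k\le 2^{J_0}-1}|\langle\phi_{J_0,k},f\rangle|+\sup_{l\ge J_0,0\le k\le2^l-1}2^{l(s+1/2)}|\langle\psi_{l,k},f\rangle|$ and $B^s_{\infty,\infty}=\{f:\|f\|_{B^s_{\infty,\infty}}<\infty\}$. At level $l=J_0-1$ the index $k$ ranges over $0\le k\le2^{J_0}-1$. $\mathcal I(J)=\{(l,k):J_0\le l\le J-1,0\le k\le2^l-1\}\cup\{(J_0-1,k):0\le k\le2^{J_0}-1\}$ (so $|\mathcal I(J)|=2^J$) and $\mathcal I_\infty=\bigcup_J\mathcal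 I(J)$. Sieve prior: $\Pi_\beta(d\beta)=\pi(\beta)d\beta$ on $\mathbb R^{2^J}$ induces a prior on $f$ via $\beta\mapsto\sum_{(l,k)\in\mathcal I(J)}\beta_{l,k}\psi_{l,k}$. Let $Y_{l,k}=\int\psi_{l,k}dY$. The posterior $\Pi_\beta(\cdot\mid Y)$ has density proportional to $\pi(\beta)\exp\{-\tfrac n2\sum_{(l,k)\in\mathcal I(J)}(Y_{l,k}-\beta_{l,k})^2\}$. Let $\beta_0=(\langle f_0,\psi_{l,k}\rangle)_{(l,k)\in\mathcal I(J)}$, $B(R)=\{\beta\in\mathbb R^{2^J}:\|\beta-\beta_0\|\le R/\sqrt n\}$ and $\phi_{\Pi_\beta}(R)=1-\inf_{\beta,\tilde\beta\in B(R)}\{\pi(\tilde\beta)/\pi(\beta)\}$. Weights: $w=(w_1,w_2,\dots)$ is positive with $w_l/\sqrt l\uparrow\infty$ as $l\to\infty$ (admissible). $u_J=\inf_{J\le l<\infty}w_l/\sqrt l$, $v_J=\max_{J_0-1\le l\le J-1}w_l/\sqrt l$, $\overline w_J=\max_{J_0-1\le l\le J-1}w_l$. It is assumed that $\sqrt l\le w_l$ for all $l\ge J_0-1$. Band: the centering estimator is $\hat f_J=\sum_{(l,k)\in\mathcal I(J)}\psi_{l,k}\int\psi_{l,k}dY$. For $R>0$, $\mathcal C_w(\hat f_J,R)=\{f:\sup_{(l,k)\in\mathcal I_\infty}|\langle f-\hat f_J,\psi_{l,k}\rangle|/w_l\le R\}$, and $\hat R_\alpha$ is such that $\Pi_\beta\{\mathcal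 C_w(\hat f_J,\hat R_\alpha)\mid Y\}=1-\alpha$. Finally $\tilde H_2=\{Y:\sup_{J\le l<\infty,0\le k\le2^l-1}|\langle f_0,\psi_{l,k}\rangle|/w_l\le\hat R_\alpha\}$. *)

theory Defs
  imports "HOL-Probability.Probability"
begin

section \<open>The space L2[0,1]\<close>

text \<open>Elements are represented by functions on the real line of which only the restriction
  to [0,1] matters; they are not quotiented by almost-everywhere equality.\<close>

definition L2 :: "(real \<Rightarrow> real) set" where
  "L2 = {f. f \<in> borel_measurable (lebesgue_on {0..1}) \<and>
            integrable (lebesgue_on {0..1}) (\<lambda>x. (f x)\<^sup>2)}"

definition l2_inner :: "(real \<Rightarrow> real) \<Rightarrow> (real \<Rightarrow> real) \<Rightarrow> real" where
  "l2_inner f g = (LINT x|lebesgue_on {0..1}. f x * g x)"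

definition linf_norm :: "(real \<Rightarrow> real) \<Rightarrow> ereal" where
  "linf_norm f = esssup (lebesgue_on {0..1}) (\<lambda>x. ereal \<bar>f x\<bar>)"

section \<open>Cohen--Daubechies--Vial wavelet bases\<close>

definition continuously_differentiable_upto :: "nat \<Rightarrow> (real \<Rightarrow> real) \<Rightarrow> bool" where
  "continuously_differentiable_upto S f \<longleftrightarrow>
     (\<exists>D. D 0 = f \<and> (\<forall>i<S. \<forall>x. (D i has_real_derivative D (Suc i) x) (at x)) \<and>
          continuous_on UNIV (D S))"

text \<open>Compactly supported Daubechies scaling function and wavelet of order \<open>N\<close> (filter with
  \<open>2 N\<close> coefficients, \<open>N\<close> vanishing moments), translated so that both are supported in
  \<open>[1 - N, N]\<close>.\<close>

definition daubechies_pair :: "nat \<Rightarrow> (real \<Rightarrow> real) \<Rightarrow> (real \<Rightarrow> real) \<Rightarrow> bool" where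
  "daubechies_pair N \<phi> \<psi> \<longleftrightarrow>
     1 \<le> N \<and>
     (\<forall>x. x \<notin> {1 - real N..real N} \<longrightarrow> \<phi> x = 0) \<and>
     (LINT x|lborel. \<phi> x) = 1 \<and>
     (\<forall>k::int. (LINT x|lborel. \<phi> x * \<phi> (x - of_int k)) = (if k = 0 then 1 else 0)) \<and>
     (\<exists>h :: int \<Rightarrow> real.
        (\<forall>x. \<phi> x = sqrt 2 * (\<Sum>k\<in>{1 - int N..int N}. h k * \<phi> (2 * x - of_int k))) \<and>
        (\<forall>x. \<psi> x = sqrt 2 *
               (\<Sum>k\<in>{1 - int N..int N}. (-1) powi k * h (1 - k) * \<phi> (2 * x - of_int k)))) \<and>
     (\<forall>p<N. (LINT x|lborel. x ^ p * \<psi> x) = 0)"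

text \<open>The \<open>N\<close> edge scaling functions \<open>\<phi>e k\<close> and edge wavelets \<open>\<psi>e k\<close> of the half-line
  \<open>[0,\<infinity>)\<close>. The former are linear combinations of the translates of \<open>\<phi>\<close>, cut off at 0, that
  are not kept as interior functions (the interior ones are \<open>\<phi> (x - m)\<close> with \<open>m \<ge> N\<close>); the
  latter are combinations of scaling functions of the next finer level.\<close>

definition cdv_edge ::
    "nat \<Rightarrow> (real \<Rightarrow> real) \<Rightarrow> (nat \<Rightarrow> real \<Rightarrow> real) \<Rightarrow> (nat \<Rightarrow> real \<Rightarrow> real) \<Rightarrow> bool" where
  "cdv_edge N \<phi> \<phi>e \<psi>e \<longleftrightarrow>
     (\<exists>a :: nat \<Rightarrow> int \<Rightarrow> real. \<forall>k<N. \<forall>x\<ge>0.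
        \<phi>e k x = (\<Sum>m\<in>{1 - int N..int N - 1}. a k m * \<phi> (x - of_int m))) \<and>
     (\<exists>(H :: nat \<Rightarrow> nat \<Rightarrow> real) (h :: nat \<Rightarrow> nat \<Rightarrow> real). \<forall>k<N. \<forall>x\<ge>0.
        \<psi>e k x = sqrt 2 * ((\<Sum>l<N. H k l * \<phi>e l (2 * x)) +
                           (\<Sum>m\<in>{N..3 * N - 2}. h k m * \<phi> (2 * x - real m))))"

text \<open>The level-\<open>l\<close> family on [0,1]: \<open>N\<close> left edge functions, \<open>2\<^sup>l - 2 N\<close> interior functions,
  \<open>N\<close> right edge functions. Right edge functions are given in the reflected coordinate.\<close>

definition cdv_dilate ::
    "nat \<Rightarrow> (real \<Rightarrow> real) \<Rightarrow> (nat \<Rightarrow> real \<Rightarrow> real) \<Rightarrow> (nat \<Rightarrow> real \<Rightarrow> real)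
      \<Rightarrow> nat \<Rightarrow> nat \<Rightarrow> real \<Rightarrow> real" where
  "cdv_dilate N f fL fR l k x =
     2 powr (real l / 2) *
       (if k < N then fL k (2 ^ l * x)
        else if k < 2 ^ l - N then f (2 ^ l * x - real k)
        else fR (2 ^ l - 1 - k) (2 ^ l * (1 - x)))"

definition sieve_index :: "nat \<Rightarrow> nat \<Rightarrow> (nat \<times> nat) set" where
  "sieve_index J0 J = {(l, k). J0 \<le> l \<and> l < J \<and> k < 2 ^ l} \<union> {J0 - 1} \<times> {..<2 ^ J0}"

definition full_index :: "nat \<Rightarrow> (nat \<times> nat) set" where
  "full_index J0 = (\<Union>J. sieve_index J0 J)"

definition orthonormal_basis :: "(nat \<times> nat) set \<Rightarrow> (nat \<Rightarrow> nat \<Rightarrow> real \<Rightarrow> real) \<Rightarrow> bool" where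
  "orthonormal_basis I \<psi> \<longleftrightarrow>
     (\<forall>(l, k)\<in>I. \<psi> l k \<in> L2) \<and>
     (\<forall>(l, k)\<in>I. \<forall>(l', k')\<in>I.
        l2_inner (\<psi> l k) (\<psi> l' k') = (if (l, k) = (l', k') then 1 else 0)) \<and>
     (\<forall>f\<in>L2. (\<forall>(l, k)\<in>I. l2_inner f (\<psi> l k) = 0) \<longrightarrow> (AE x in lebesgue_on {0..1}. f x = 0))"

text \<open>\<open>\<psi> l k\<close> for \<open>l \<ge> J0\<close> are the wavelets and \<open>\<psi> (J0 - 1) k\<close> the scaling functions of level
  \<open>J0\<close>. \<open>S\<close>-regular: the generators are \<open>S\<close> times continuously differentiable and the wavelets
  have vanishing moments up to order \<open>S\<close>, that is, \<open>S < N\<close>. The coarsest level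
  has room for the \<open>2 N\<close> edge functions; as \<open>S \<ge> 1\<close> in all uses, this gives \<open>J0 \<ge> 2\<close>. Together with the edge structure and orthonormality, reproduction of
  polynomials of degree less than \<open>N\<close> on all of [0,1] fixes the spans of the edge functions.
  The edge at 1 is the edge at 0 of the reflected pair, and \<open>x \<mapsto> \<phi> (1 - x)\<close> is again supported in
  \<open>[1 - N, N]\<close>.\<close>

definition cdv_basis :: "nat \<Rightarrow> nat \<Rightarrow> (nat \<Rightarrow> nat \<Rightarrow> real \<Rightarrow> real) \<Rightarrow> bool" where
  "cdv_basis S J0 \<psi> \<longleftrightarrow>
     (\<exists>N father mother \<phi>L \<psi>L \<phi>R \<psi>R.
        S < N \<and> 2 * N \<le> 2 ^ J0 \<and>
        daubechies_pair N father mother \<and>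
        continuously_differentiable_upto S father \<and>
        continuously_differentiable_upto S mother \<and>
        cdv_edge N father \<phi>L \<psi>L \<and>
        cdv_edge N (\<lambda>x. father (1 - x)) \<phi>R \<psi>R \<and>
        (\<forall>k<2 ^ J0. \<forall>x\<in>{0..1}. \<psi> (J0 - 1) k x = cdv_dilate N father \<phi>L \<phi>R J0 k x) \<and>
        (\<forall>l\<ge>J0. \<forall>k<2 ^ l. \<forall>x\<in>{0..1}. \<psi> l k x = cdv_dilate N mother \<psi>L \<psi>R l k x) \<and>
        (\<forall>p<N. \<exists>c. \<forall>x\<in>{0..1}. x ^ p = (\<Sum>k<2 ^ J0. c k * \<psi> (J0 - 1) k x)) \<and>
        orthonormal_basis (full_index J0) \<psi>)"

section \<open>The Besov space\<close>

definition besov_norm ::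
    "nat \<Rightarrow> (nat \<Rightarrow> nat \<Rightarrow> real \<Rightarrow> real) \<Rightarrow> real \<Rightarrow> (real \<Rightarrow> real) \<Rightarrow> ereal" where
  "besov_norm J0 \<psi> s f =
     (MAX k\<in>{..<2 ^ J0}. ereal \<bar>l2_inner (\<psi> (J0 - 1) k) f\<bar>) +
     (SUP (l, k)\<in>{(l, k). J0 \<le> l \<and> k < 2 ^ l}.
        ereal (2 powr (real l * (s + 1/2)) * \<bar>l2_inner (\<psi> l k) f\<bar>))"

definition besov_space ::
    "nat \<Rightarrow> (nat \<Rightarrow> nat \<Rightarrow> real \<Rightarrow> real) \<Rightarrow> real \<Rightarrow> (real \<Rightarrow> real) set" where
  "besov_space J0 \<psi> s = {f \<in> L2. besov_norm J0 \<psi> s f < \<infinity>}"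

section \<open>The Gaussian white noise model\<close>

text \<open>\<open>W g\<close> stands for the integral of \<open>g\<close> against white noise: the isonormal Gaussian process
  indexed by L2[0,1], i.e. it is linear and maps every orthonormal system to independent
  standard normal variables.\<close>

definition white_noise :: "'a measure \<Rightarrow> ((real \<Rightarrow> real) \<Rightarrow> 'a \<Rightarrow> real) \<Rightarrow> bool" where
  "white_noise M W \<longleftrightarrow>
     prob_space M \<and>
     (\<forall>g\<in>L2. W g \<in> borel_measurable M) \<and>
     (\<forall>f\<in>L2. \<forall>g\<in>L2. \<forall>a b.
        AE \<omega> in M. W (\<lambda>x. a * f x + b * g x) \<omega> = a * W f \<omega> + b * W g \<omega>) \<and>
     (\<forall>E\<subseteq>L2. (\<forall>e\<in>E. \<forall>e'\<in>E. l2_inner e e' = (if e = e' then 1 else 0)) \<longrightarrow>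
        prob_space.indep_vars M (\<lambda>_. borel) W E \<and>
        (\<forall>e\<in>E. distributed M lborel (W e) std_normal_density))"

text \<open>The integral of \<open>g\<close> against \<open>dY = f0 dt + n\<^sup>-\<^sup>1\<^sup>/\<^sup>2 dW\<close>.\<close>

definition observation ::
    "(real \<Rightarrow> real) \<Rightarrow> nat \<Rightarrow> ((real \<Rightarrow> real) \<Rightarrow> 'a \<Rightarrow> real) \<Rightarrow> (real \<Rightarrow> real) \<Rightarrow> 'a \<Rightarrow> real" where
  "observation f0 n W g \<omega> = l2_inner f0 g + W g \<omega> / sqrt (real n)"

section \<open>Sieve prior and posterior\<close>

text \<open>Coefficient vectors indexed by a finite set \<open>I\<close> live in \<open>\<Pi>\<^sub>M i\<in>I. lborel\<close>, i.e. they are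
  extensional functions on \<open>I\<close>.\<close>

abbreviation coef_space :: "(nat \<times> nat) set \<Rightarrow> (nat \<times> nat \<Rightarrow> real) measure" where
  "coef_space I \<equiv> Pi\<^sub>M I (\<lambda>_. lborel)"

definition prior_density :: "(nat \<times> nat) set \<Rightarrow> (((nat \<times> nat) \<Rightarrow> real) \<Rightarrow> real) \<Rightarrow> bool" where
  "prior_density I p \<longleftrightarrow>
     p \<in> borel_measurable (coef_space I) \<and>
     (\<forall>\<beta>\<in>space (coef_space I). 0 \<le> p \<beta>) \<and>
     (\<integral>\<^sup>+\<beta>. ennreal (p \<beta>) \<partial>coef_space I) = 1"

definition sieve_fun ::
    "(nat \<times> nat) set \<Rightarrow> (nat \<Rightarrow> nat \<Rightarrow> real \<Rightarrow> real) \<Rightarrow> (nat \<times> nat \<Rightarrow> real) \<Rightarrow> real \<Rightarrow> real" where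
  "sieve_fun I \<psi> \<beta> x = (\<Sum>(l, k)\<in>I. \<beta> (l, k) * \<psi> l k x)"

definition coefs ::
    "(nat \<times> nat) set \<Rightarrow> (nat \<Rightarrow> nat \<Rightarrow> real \<Rightarrow> real) \<Rightarrow> (real \<Rightarrow> real) \<Rightarrow> nat \<times> nat \<Rightarrow> real" where
  "coefs I \<psi> f = (\<lambda>(l, k)\<in>I. l2_inner f (\<psi> l k))"

definition data ::
    "(nat \<times> nat) set \<Rightarrow> (nat \<Rightarrow> nat \<Rightarrow> real \<Rightarrow> real) \<Rightarrow> (real \<Rightarrow> real) \<Rightarrow> nat
      \<Rightarrow> ((real \<Rightarrow> real) \<Rightarrow> 'a \<Rightarrow> real) \<Rightarrow> 'a \<Rightarrow> nat \<times> nat \<Rightarrow> real" where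
  "data I \<psi> f0 n W \<omega> = (\<lambda>(l, k)\<in>I. observation f0 n W (\<psi> l k) \<omega>)"

definition unnormalized_posterior ::
    "(nat \<times> nat) set \<Rightarrow> ((nat \<times> nat \<Rightarrow> real) \<Rightarrow> real) \<Rightarrow> nat
      \<Rightarrow> (nat \<times> nat \<Rightarrow> real) \<Rightarrow> (nat \<times> nat \<Rightarrow> real) \<Rightarrow> real" where
  "unnormalized_posterior I p n y \<beta> = p \<beta> * exp (- (real n / 2) * (\<Sum>i\<in>I. (y i - \<beta> i)\<^sup>2))"

definition posterior ::
    "(nat \<times> nat) set \<Rightarrow> ((nat \<times> nat \<Rightarrow> real) \<Rightarrow> real) \<Rightarrow> nat
      \<Rightarrow> (nat \<times> nat \<Rightarrow> real) \<Rightarrow> (nat \<times> nat \<Rightarrow> real) measure" where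
  "posterior I p n y =
     density (coef_space I)
       (\<lambda>\<beta>. ennreal (unnormalized_posterior I p n y \<beta> /
                       (LINT b|coef_space I. unnormalized_posterior I p n y b)))"

definition coef_ball ::
    "(nat \<times> nat) set \<Rightarrow> (nat \<times> nat \<Rightarrow> real) \<Rightarrow> nat \<Rightarrow> real \<Rightarrow> (nat \<times> nat \<Rightarrow> real) set" where
  "coef_ball I \<beta>0 n R =
     {\<beta> \<in> space (coef_space I). L2_set (\<lambda>i. \<beta> i - \<beta>0 i) I \<le> R / sqrt (real n)}"

text \<open>The local lack of flatness \<open>\<phi>\<close> of the prior. If \<open>p\<close> vanishes somewhere on the ball but not
  identically, the infimum is 0 whatever the value of the quotients with vanishing denominator.\<close>

definition lack_of_flatness ::
    "(nat \<times> nat) set \<Rightarrow> (nat \<times> nat \<Rightarrow> real) \<Rightarrow> nat \<Rightarrow> ((nat \<times> nat \<Rightarrow> real) \<Rightarrow> real)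
      \<Rightarrow> real \<Rightarrow> real" where
  "lack_of_flatness I \<beta>0 n p R =
     1 - (INF (\<beta>, \<beta>')\<in>coef_ball I \<beta>0 n R \<times> coef_ball I \<beta>0 n R. p \<beta>' / p \<beta>)"

section \<open>Weights and the Castillo--Nickl band\<close>

text \<open>The value \<open>w 0\<close> is irrelevant; the weight sequence starts at index 1.\<close>

definition admissible_weights :: "(nat \<Rightarrow> real) \<Rightarrow> bool" where
  "admissible_weights w \<longleftrightarrow>
     (\<forall>l\<ge>1. 0 < w l) \<and> filterlim (\<lambda>l. w l / sqrt (real l)) at_top sequentially"

definition u_weight :: "(nat \<Rightarrow> real) \<Rightarrow> nat \<Rightarrow> real" where
  "u_weight w J = (INF l\<in>{J..}. w l / sqrt (real l))"

definition v_weight :: "nat \<Rightarrow> (nat \<Rightarrow> real) \<Rightarrow> nat \<Rightarrow> real" where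
  "v_weight J0 w J = (MAX l\<in>{J0 - 1..J - 1}. w l / sqrt (real l))"

definition w_max :: "nat \<Rightarrow> (nat \<Rightarrow> real) \<Rightarrow> nat \<Rightarrow> real" where
  "w_max J0 w J = (MAX l\<in>{J0 - 1..J - 1}. w l)"

definition cn_band ::
    "nat \<Rightarrow> (nat \<Rightarrow> nat \<Rightarrow> real \<Rightarrow> real) \<Rightarrow> (nat \<Rightarrow> real) \<Rightarrow> (real \<Rightarrow> real) \<Rightarrow> real
      \<Rightarrow> (real \<Rightarrow> real) set" where
  "cn_band J0 \<psi> w fhat R =
     {f \<in> L2. (SUP (l, k)\<in>full_index J0.
                  ereal (\<bar>l2_inner (\<lambda>x. f x - fhat x) (\<psi> l k)\<bar> / w l)) \<le> ereal R}"

text \<open>The centering estimator \<open>\<Sum>\<^sub>(\<^sub>l\<^sub>,\<^sub>k\<^sub>)\<^sub>\<in>\<^sub>I \<psi>\<^sub>l\<^sub>k \<integral> \<psi>\<^sub>l\<^sub>k dY\<close>.\<close>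

definition center ::
    "(nat \<times> nat) set \<Rightarrow> (nat \<Rightarrow> nat \<Rightarrow> real \<Rightarrow> real) \<Rightarrow> (real \<Rightarrow> real) \<Rightarrow> nat
      \<Rightarrow> ((real \<Rightarrow> real) \<Rightarrow> 'a \<Rightarrow> real) \<Rightarrow> 'a \<Rightarrow> real \<Rightarrow> real" where
  "center I \<psi> f0 n W \<omega> = sieve_fun I \<psi> (data I \<psi> f0 n W \<omega>)"

text \<open>A random variable \<open>Rhat\<close> for which the band always has posterior probability exactly
  \<open>1 - \<alpha>\<close>, the posterior on functions being the image of that on coefficients under
  \<open>sieve_fun\<close>.\<close>

definition credible_radius ::
    "nat \<Rightarrow> (nat \<Rightarrow> nat \<Rightarrow> real \<Rightarrow> real) \<Rightarrow> (nat \<Rightarrow> real) \<Rightarrow> real \<Rightarrow> nat \<Rightarrow> nat \<Rightarrow> (real \<Rightarrow> real)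
      \<Rightarrow> ((nat \<times> nat \<Rightarrow> real) \<Rightarrow> real) \<Rightarrow> 'a measure \<Rightarrow> ((real \<Rightarrow> real) \<Rightarrow> 'a \<Rightarrow> real)
      \<Rightarrow> ('a \<Rightarrow> real) \<Rightarrow> bool" where
  "credible_radius J0 \<psi> w \<alpha> n J f0 p M W Rhat \<longleftrightarrow>
     Rhat \<in> borel_measurable M \<and>
     (\<forall>\<omega>\<in>space M.
        measure (posterior (sieve_index J0 J) p n (data (sieve_index J0 J) \<psi> f0 n W \<omega>))
          {\<beta> \<in> space (coef_space (sieve_index J0 J)).
             sieve_fun (sieve_index J0 J) \<psi> \<beta>
               \<in> cn_band J0 \<psi> w (center (sieve_index J0 J) \<psi> f0 n W \<omega>) (Rhat \<omega>)}
        = 1 - \<alpha>)"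

definition H2_event ::
    "(nat \<Rightarrow> nat \<Rightarrow> real \<Rightarrow> real) \<Rightarrow> (nat \<Rightarrow> real) \<Rightarrow> nat \<Rightarrow> (real \<Rightarrow> real) \<Rightarrow> 'a measure
      \<Rightarrow> ('a \<Rightarrow> real) \<Rightarrow> 'a set" where
  "H2_event \<psi> w J f0 M Rhat =
     {\<omega> \<in> space M. (SUP (l, k)\<in>{(l, k). J \<le> l \<and> k < 2 ^ l}.
                       ereal (\<bar>l2_inner f0 (\<psi> l k)\<bar> / w l)) \<le> ereal (Rhat \<omega>)}"

end

theory Submission
  imports Defs
begin

text \<open>
  Let \<open>d = 2 ^ J\<close> be the number of coefficients of the sieve, \<open>y\<close> the vector of observed
  coefficients and \<open>\<beta>0\<close> the vector of true ones. The proof compares two Gaussian laws that differ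
  only by their centre. The data are distributed as \<open>N(\<beta>0, 1/n)\<close>, and the likelihood, read as a
  function of the parameter, is \<open>N(y, 1/n)\<close>. A weighted sup-norm ball around the centre has the
  same mass \<open>F t\<close> under both (\<open>F\<close> is \<open>band_prob\<close> below), an explicit product of one-dimensional normal probabilities
  (\<open>gauss_prod_box\<close>), continuous and strictly increasing in the radius \<open>t\<close>.

  On the event that \<open>y\<close> is within \<open>3 sqrt (d ln n / n)\<close> of \<open>\<beta>0\<close>, which has probability at least
  \<open>1 - n powr (- d)\<close>, the posterior is close to \<open>N(y, 1/n)\<close> in total variation
  (\<open>posterior_near_gauss\<close>): the two differ by the prior density, which is flat up to the lack of
  flatness on a ball of radius \<open>c1 sqrt (d ln n / n)\<close>, and both measures leave that ball with probability
  at most \<open>n powr (- d)\<close>. For the posterior this uses the lower bound on the prior density, which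
  bounds the normalising constant from below by a power of \<open>n\<close> of order \<open>d\<close>
  (\<open>evidence_lower_bound\<close>). Consequently \<open>F (Rhat)\<close> is within this distance of \<open>1 - \<alpha>\<close>, so that
  \<open>Rhat\<close> lies between two deterministic quantiles of the estimation error, and the coverage follows
  (\<open>coverage_of_random_radius\<close>) up to the event that the coefficients beyond level \<open>J\<close> do not fit
  in the band.

  For the diameter, a union bound over levels shows that the upper quantile is of order
  \<open>n powr (- 1/2)\<close> (\<open>band_prob_lower\<close>; here \<open>w l \<ge> sqrt l\<close> enters). Localisation of the wavelets
  turns coefficient bounds into a sup-norm bound (\<open>cdv_basis_localised\<close>, \<open>sup_norm_le_coefs\<close>), with
  the band controlling levels below \<open>J\<close> and the Besov ball the others. For the last claim, the maximum
  of \<open>d\<close> normal variables is at least of order \<open>sqrt J\<close>, so the radius is at least of order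
  \<open>sqrt J / (sqrt n * w_max J0 w J)\<close> (\<open>radius_lower\<close>), which dominates the weighted coefficients of \<open>f0\<close> beyond
  level \<open>J\<close> once the ratio that is assumed to vanish is at most \<open>1/2\<close>.
\<close>

section \<open>Square-integrable functions on the unit interval\<close>

lemma L2_measurable: "f \<in> L2 \<Longrightarrow> f \<in> borel_measurable (lebesgue_on {0..1})"
  by (simp add: L2_def)

lemma L2_integrable_mult:
  assumes "f \<in> L2" "g \<in> L2"
  shows "integrable (lebesgue_on {0..1}) (\<lambda>x. f x * g x)"
proof (rule Bochner_Integration.integrable_bound)
  show "integrable (lebesgue_on {0..1}) (\<lambda>x. (f x)\<^sup>2 + (g x)\<^sup>2)"
    using assms by (simp add: L2_def)
  show "(\<lambda>x. f x * g x) \<in> borel_measurable (lebesgue_on {0..1})"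
    using assms by (intro borel_measurable_times L2_measurable)
  have "\<bar>a * b\<bar> \<le> a\<^sup>2 + b\<^sup>2" for a b :: real
  proof -
    have "0 \<le> (\<bar>a\<bar> - \<bar>b\<bar>)\<^sup>2" "0 \<le> \<bar>a\<bar> * \<bar>b\<bar>" by auto
    then have "2 * (\<bar>a\<bar> * \<bar>b\<bar>) \<le> a\<^sup>2 + b\<^sup>2" by (simp add: power2_diff)
    then show ?thesis using \<open>0 \<le> \<bar>a\<bar> * \<bar>b\<bar>\<close> unfolding abs_mult by linarith
  qed
  then show "AE x in lebesgue_on {0..1}. norm (f x * g x) \<le> norm ((f x)\<^sup>2 + (g x)\<^sup>2)"
    by (auto intro!: AE_I2 order_trans[OF _ abs_ge_self])
qed

lemma L2_lincomb:
  assumes "f \<in> L2" "g \<in> L2"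
  shows "(\<lambda>x. a * f x + b * g x) \<in> L2"
proof -
  have "integrable (lebesgue_on {0..1}) (\<lambda>x. a\<^sup>2 * (f x)\<^sup>2 + b\<^sup>2 * (g x)\<^sup>2 + 2 * a * b * (f x * g x))"
    using assms L2_integrable_mult[OF assms] by (simp add: L2_def)
  also have "(\<lambda>x. a\<^sup>2 * (f x)\<^sup>2 + b\<^sup>2 * (g x)\<^sup>2 + 2 * a * b * (f x * g x)) = (\<lambda>x. (a * f x + b * g x)\<^sup>2)"
    by (simp add: fun_eq_iff power2_sum power_mult_distrib)
  finally have "integrable (lebesgue_on {0..1}) (\<lambda>x. (a * f x + b * g x)\<^sup>2)" .
  moreover have "(\<lambda>x. a * f x + b * g x) \<in> borel_measurable (lebesgue_on {0..1})"
    using assms by (intro borel_measurable_add borel_measurable_times borel_measurable_const L2_measurable)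
  ultimately show ?thesis by (simp add: L2_def)
qed

lemma L2_diff: "f \<in> L2 \<Longrightarrow> g \<in> L2 \<Longrightarrow> (\<lambda>x. f x - g x) \<in> L2"
  using L2_lincomb[of f g 1 "-1"] by simp

lemma L2_zero: "(\<lambda>x. 0) \<in> L2"
  by (simp add: L2_def)

lemma L2_sum: "finite A \<Longrightarrow> (\<And>i. i \<in> A \<Longrightarrow> f i \<in> L2) \<Longrightarrow> (\<lambda>x. \<Sum>i\<in>A. c i * f i x) \<in> L2"
proof (induction A rule: finite_induct)
  case (insert i A)
  then have "(\<lambda>x. c i * f i x + 1 * (\<Sum>i\<in>A. c i * f i x)) \<in> L2"
    by (intro L2_lincomb) auto
  then show ?case using insert by simp
qed (simp add: L2_zero)

lemma L2_bounded:
  assumes "f \<in> borel_measurable (lebesgue_on {0..1})" "\<And>x. x \<in> {0..1} \<Longrightarrow> \<bar>f x\<bar> \<le> K"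
  shows "f \<in> L2"
proof -
  interpret finite_measure "lebesgue_on {0..1::real}" by (rule finite_measure_lebesgue_on) auto
  have "integrable (lebesgue_on {0..1}) (\<lambda>x. (f x)\<^sup>2)"
    using assms by (intro integrable_const_bound[where B="K\<^sup>2"])
      (auto intro!: AE_I2 simp: abs_le_square_iff[symmetric] intro: order_trans[OF _ abs_ge_self])
  then show ?thesis using assms by (simp add: L2_def)
qed

lemma L2_integrable:
  assumes "f \<in> L2"
  shows "integrable (lebesgue_on {0..1}) f"
proof -
  have "(\<lambda>x. 1) \<in> L2" by (rule L2_bounded[where K=1]) auto
  from L2_integrable_mult[OF assms this] show ?thesis by simp
qed

lemma l2_inner_commute: "l2_inner f g = l2_inner g f"
  by (simp add: l2_inner_def mult.commute)

lemma l2_inner_diff_left: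
  "f \<in> L2 \<Longrightarrow> g \<in> L2 \<Longrightarrow> h \<in> L2 \<Longrightarrow> l2_inner (\<lambda>x. f x - g x) h = l2_inner f h - l2_inner g h"
  by (simp add: l2_inner_def left_diff_distrib L2_integrable_mult)

lemma l2_inner_sum_left:
  assumes "finite A" "\<And>i. i \<in> A \<Longrightarrow> f i \<in> L2" "h \<in> L2"
  shows "l2_inner (\<lambda>x. \<Sum>i\<in>A. c i * f i x) h = (\<Sum>i\<in>A. c i * l2_inner (f i) h)"
  using assms
  by (simp add: l2_inner_def sum_distrib_right mult.assoc L2_integrable_mult)

section \<open>Wavelet indices\<close>

text \<open>The scaling functions of level \<open>J0\<close> are stored at level \<open>J0 - 1\<close>, which
  therefore has \<open>2 ^ J0\<close> rather than \<open>2 ^ (J0 - 1)\<close> members.\<close>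

definition level_size :: "nat \<Rightarrow> nat \<Rightarrow> nat" where
  "level_size J0 l = (if l < J0 then 2 ^ J0 else 2 ^ l)"

lemma sieve_index_eq:
  assumes "1 \<le> J0" "J0 \<le> J"
  shows "sieve_index J0 J = Sigma {J0 - 1..<J} (\<lambda>l. {..<level_size J0 l})"
proof (intro set_eqI)
  fix p :: "nat \<times> nat"
  obtain l k where p: "p = (l, k)" by (cases p)
  show "p \<in> sieve_index J0 J \<longleftrightarrow> p \<in> Sigma {J0 - 1..<J} (\<lambda>l. {..<level_size J0 l})"
  proof (cases "J0 \<le> l")
    case True
    then have "l \<noteq> J0 - 1" "J0 - 1 \<le> l" "\<not> l < J0" using assms by linarith+
    then show ?thesis using True by (simp add: p sieve_index_def level_size_def)
  next
    case False
    then have "l = J0 - 1 \<longleftrightarrow> J0 - 1 \<le> l" "l < J0" "l < J" using assms by linarith+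
    then show ?thesis using False by (simp add: p sieve_index_def level_size_def)
  qed
qed

lemma full_index_eq:
  assumes "1 \<le> J0"
  shows "full_index J0 = {(l, k). J0 - 1 \<le> l \<and> k < level_size J0 l}"
proof (intro set_eqI)
  fix p :: "nat \<times> nat"
  obtain l k where p: "p = (l, k)" by (cases p)
  have "p \<in> full_index J0 \<longleftrightarrow> (\<exists>J. p \<in> sieve_index J0 (max J0 J))"
  proof
    have "sieve_index J0 J \<subseteq> sieve_index J0 (max J0 J)" for J by (auto simp: sieve_index_def)
    then show "p \<in> full_index J0 \<Longrightarrow> \<exists>J. p \<in> sieve_index J0 (max J0 J)"
      unfolding full_index_def by blast
  qed (auto simp: full_index_def)
  also have "\<dots> \<longleftrightarrow> J0 - 1 \<le> l \<and> k < level_size J0 l"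
    by (auto simp: p sieve_index_eq[OF assms] intro: exI[of _ "Suc l"])
  finally show "p \<in> full_index J0 \<longleftrightarrow> p \<in> {(l, k). J0 - 1 \<le> l \<and> k < level_size J0 l}"
    by (simp add: p)
qed

lemma finite_sieve_index: "1 \<le> J0 \<Longrightarrow> J0 \<le> J \<Longrightarrow> finite (sieve_index J0 J)"
  by (simp add: sieve_index_eq)

text \<open>The levels telescope: the scaling functions count \<open>2 ^ J0\<close>, and every wavelet level doubles
  the total.\<close>

lemma card_sieve_index:
  assumes "1 \<le> J0" "J0 \<le> J"
  shows "card (sieve_index J0 J) = 2 ^ J"
proof -
  have "(\<Sum>l\<in>{J0 - 1..<J}. level_size J0 l) = 2 ^ J"
    using assms(2)
  proof (induction J rule: dec_induct)
    case base
    have "{J0 - 1..<J0} = {J0 - 1}" using assms by auto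
    then show ?case using assms by (simp add: level_size_def)
  next
    case (step n)
    then have "(\<Sum>l\<in>{J0 - 1..<Suc n}. level_size J0 l) = (\<Sum>l\<in>{J0 - 1..<n}. level_size J0 l) + level_size J0 n"
      by simp
    with step show ?case by (simp add: level_size_def)
  qed
  then show ?thesis by (simp add: sieve_index_eq[OF assms])
qed

lemma sieve_index_subset_full: "sieve_index J0 J \<subseteq> full_index J0"
  by (auto simp: full_index_def)

lemma full_minus_sieve:
  assumes "1 \<le> J0" "J0 \<le> J"
  shows "full_index J0 - sieve_index J0 J = {(l, k). J \<le> l \<and> k < 2 ^ l}"
  using assms by (auto simp: full_index_eq sieve_index_eq level_size_def)

section \<open>Localisation of boundary-corrected wavelets\<close>

text \<open>At any point only boundedly many functions of a level are nonzero: the \<open>2 N\<close> edge functions,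
  and those interior translates whose support of length \<open>2 N - 1\<close> reaches the point. Each
  contributes at most the amplitude \<open>2 powr (l / 2)\<close>.\<close>

lemma cdv_dilate_sum_bound:
  assumes f: "\<And>y. \<bar>f y\<bar> \<le> K" "\<And>y. y \<notin> {1 - real N..real N} \<Longrightarrow> f y = 0"
    and L: "\<And>k y. k < N \<Longrightarrow> 0 \<le> y \<Longrightarrow> \<bar>fL k y\<bar> \<le> K"
    and R: "\<And>k y. k < N \<Longrightarrow> 0 \<le> y \<Longrightarrow> \<bar>fR k y\<bar> \<le> K"
    and l: "2 * N \<le> 2 ^ l" and x: "x \<in> {0..1}"
  shows "(\<Sum>k<2 ^ l. \<bar>cdv_dilate N f fL fR l k x\<bar>) \<le> (4 * real N + 1) * K * 2 powr (real l / 2)"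
proof -
  have K0: "0 \<le> K" using f(1)[of 0] by simp
  define m where "m = nat \<lfloor>2 ^ l * x\<rfloor>"
  have m: "real m \<le> 2 ^ l * x" "2 ^ l * x < real m + 1"
    using x by (auto simp: m_def of_nat_nat)
  \<comment> \<open>Indices of the functions that may be nonzero at \<open>x\<close>.\<close>
  define A where "A = {..<N} \<union> {2 ^ l - N..<2 ^ l} \<union> {m - N..m + N}"
  have A: "finite A" "card A \<le> 4 * N + 1"
  proof -
    have "card A \<le> card {..<N} + card {2 ^ l - N..<(2::nat) ^ l} + card {m - N..m + N}"
      unfolding A_def by (intro order_trans[OF card_Un_le] add_mono card_Un_le) auto
    also have "\<dots> \<le> N + N + (2 * N + 1)" by simp
    finally show "card A \<le> 4 * N + 1" by simp
  qed (simp add: A_def)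
  have t: "\<bar>cdv_dilate N f fL fR l k x\<bar> \<le> (if k \<in> A then K * 2 powr (real l / 2) else 0)" if k: "k < 2 ^ l" for k
  proof -
    have fk: "f (2 ^ l * x - real k) = 0" if "k \<notin> {m - N..m + N}"
    proof (rule f(2))
      show "2 ^ l * x - real k \<notin> {1 - real N..real N}"
      proof
        assume "2 ^ l * x - real k \<in> {1 - real N..real N}"
        then have "real k \<le> real m + real N" "real m \<le> real k + real N" using m by auto
        then have "k \<in> {m - N..m + N}" by auto
        then show False using that by blast
      qed
    qed
    show ?thesis
    proof (cases "k < N")
      case True
      then show ?thesis using x L[of k "2 ^ l * x"] by (auto simp: cdv_dilate_def A_def abs_mult mult.commute)
    next
      case n1: False
      show ?thesis
      proof (cases "k < 2 ^ l - N")
        case True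
        then show ?thesis using n1 f(1)[of "2 ^ l * x - real k"] fk K0
          by (auto simp: cdv_dilate_def A_def abs_mult mult.commute)
      next
        case False
        then have "2 ^ l - 1 - k < N" using k by linarith
        then have "\<bar>fR (2 ^ l - 1 - k) (2 ^ l * (1 - x))\<bar> \<le> K" using x by (intro R) auto
        then show ?thesis using n1 False k by (auto simp: cdv_dilate_def A_def abs_mult mult.commute)
      qed
    qed
  qed
  have "(\<Sum>k<2 ^ l. \<bar>cdv_dilate N f fL fR l k x\<bar>) \<le> (\<Sum>k<2 ^ l. if k \<in> A then K * 2 powr (real l / 2) else 0)"
    by (intro sum_mono t) auto
  also have "\<dots> = real (card ({..<2 ^ l} \<inter> A)) * (K * 2 powr (real l / 2))"
    by (simp add: sum.inter_restrict[symmetric])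
  also have "\<dots> \<le> real (4 * N + 1) * (K * 2 powr (real l / 2))"
    using A K0 card_mono[OF A(1), of "{..<2 ^ l} \<inter> A"] by (intro mult_right_mono) (auto simp del: of_nat_add)
  finally show ?thesis by (simp add: mult.assoc add.commute)
qed

lemma abs_sum_mult_le:
  fixes a f :: "'a \<Rightarrow> real"
  assumes "\<And>i. i \<in> A \<Longrightarrow> \<bar>f i\<bar> \<le> K"
  shows "\<bar>\<Sum>i\<in>A. a i * f i\<bar> \<le> (\<Sum>i\<in>A. \<bar>a i\<bar>) * K"
proof -
  have "\<bar>\<Sum>i\<in>A. a i * f i\<bar> \<le> (\<Sum>i\<in>A. \<bar>a i * f i\<bar>)" by (rule sum_abs)
  also have "\<dots> \<le> (\<Sum>i\<in>A. \<bar>a i\<bar> * K)"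
    using assms by (intro sum_mono) (auto simp: abs_mult intro!: mult_left_mono)
  finally show ?thesis by (simp add: sum_distrib_right)
qed

lemma uniform_bound_finite_family:
  fixes f :: "nat \<Rightarrow> 'a \<Rightarrow> real"
  assumes "\<And>k. k < N \<Longrightarrow> \<exists>K. \<forall>x\<in>X. \<bar>f k x\<bar> \<le> K"
  shows "\<exists>K. \<forall>k<N. \<forall>x\<in>X. \<bar>f k x\<bar> \<le> K"
proof -
  from assms obtain K where K: "\<And>k x. k < N \<Longrightarrow> x \<in> X \<Longrightarrow> \<bar>f k x\<bar> \<le> K k" by metis
  have "\<bar>f k x\<bar> \<le> (\<Sum>k<N. \<bar>K k\<bar>)" if "k < N" "x \<in> X" for k x
  proof -
    have "\<bar>f k x\<bar> \<le> \<bar>K k\<bar>" using K[OF that] by simp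
    also have "\<dots> \<le> (\<Sum>k<N. \<bar>K k\<bar>)" using that by (intro member_le_sum) auto
    finally show ?thesis .
  qed
  then show ?thesis by blast
qed

text \<open>Edge functions are finite combinations of bounded functions, with coefficients that do not depend
  on the level, so that one constant serves all levels.\<close>

lemma cdv_edge_bounded:
  assumes e: "cdv_edge N \<phi> \<phi>e \<psi>e" and K: "\<And>x. \<bar>\<phi> x\<bar> \<le> K"
  shows "\<exists>K'. \<forall>k<N. \<forall>x\<in>{0..}. \<bar>\<phi>e k x\<bar> \<le> K'" and "\<exists>K'. \<forall>k<N. \<forall>x\<in>{0..}. \<bar>\<psi>e k x\<bar> \<le> K'"
proof -
  from e obtain a where a: "\<And>k x. k < N \<Longrightarrow> 0 \<le> x \<Longrightarrow>
      \<phi>e k x = (\<Sum>m\<in>{1 - int N..int N - 1}. a k m * \<phi> (x - of_int m))"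
    unfolding cdv_edge_def by blast
  from e obtain H h where h: "\<And>k x. k < N \<Longrightarrow> 0 \<le> x \<Longrightarrow>
      \<psi>e k x = sqrt 2 * ((\<Sum>l<N. H k l * \<phi>e l (2 * x)) + (\<Sum>m\<in>{N..3 * N - 2}. h k m * \<phi> (2 * x - real m)))"
    unfolding cdv_edge_def by blast
  show 1: "\<exists>K'. \<forall>k<N. \<forall>x\<in>{0..}. \<bar>\<phi>e k x\<bar> \<le> K'"
  proof (rule uniform_bound_finite_family)
    fix k assume "k < N"
    then show "\<exists>K. \<forall>x\<in>{0..}. \<bar>\<phi>e k x\<bar> \<le> K"
      using K by (intro exI[of _ "(\<Sum>m\<in>{1 - int N..int N - 1}. \<bar>a k m\<bar>) * K"]) (auto simp: a intro!: abs_sum_mult_le)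
  qed
  then obtain K' where K': "\<And>k x. k < N \<Longrightarrow> 0 \<le> x \<Longrightarrow> \<bar>\<phi>e k x\<bar> \<le> K'" by auto
  show "\<exists>K'. \<forall>k<N. \<forall>x\<in>{0..}. \<bar>\<psi>e k x\<bar> \<le> K'"
  proof (rule uniform_bound_finite_family, intro exI ballI)
    fix k and x :: real assume k: "k < N" and "x \<in> {0..}"
    then have x: "0 \<le> x" by simp
    have "\<bar>\<psi>e k x\<bar> = sqrt 2 * \<bar>(\<Sum>l<N. H k l * \<phi>e l (2 * x)) + (\<Sum>m\<in>{N..3 * N - 2}. h k m * \<phi> (2 * x - real m))\<bar>"
      by (simp add: h[OF k x] abs_mult)
    also have "\<dots> \<le> sqrt 2 * ((\<Sum>l<N. \<bar>H k l\<bar>) * K' + (\<Sum>m\<in>{N..3 * N - 2}. \<bar>h k m\<bar>) * K)"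
      using x K K' by (intro mult_left_mono order_trans[OF abs_triangle_ineq] add_mono abs_sum_mult_le) auto
    finally show "\<bar>\<psi>e k x\<bar> \<le> sqrt 2 * ((\<Sum>l<N. \<bar>H k l\<bar>) * K' + (\<Sum>m\<in>{N..3 * N - 2}. \<bar>h k m\<bar>) * K)" .
  qed
qed

lemma compact_support_bounded:
  assumes c: "continuously_differentiable_upto S f" and z: "\<And>x. x \<notin> {a..b} \<Longrightarrow> f x = 0"
  shows "\<exists>K. \<forall>x. \<bar>f x\<bar> \<le> (K::real)"
proof -
  from c obtain D where D: "D 0 = f" "\<And>i x. i < S \<Longrightarrow> (D i has_real_derivative D (Suc i) x) (at x)"
    "continuous_on UNIV (D S)" unfolding continuously_differentiable_upto_def by auto
  have "continuous_on UNIV f"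
  proof (cases "S = 0")
    case True then show ?thesis using D by simp
  next
    case False
    then have "isCont f x" for x using D(1) D(2)[of 0 x] by (auto intro: DERIV_isCont)
    then show ?thesis by (simp add: continuous_at_imp_continuous_on)
  qed
  then have "compact (f ` {a..b})"
    by (intro compact_continuous_image) (auto intro: continuous_on_subset)
  then have "bounded (f ` {a..b})" by (rule compact_imp_bounded)
  then obtain K where K: "\<forall>x\<in>{a..b}. \<bar>f x\<bar> \<le> K" by (auto simp: bounded_iff)
  have "\<bar>f x\<bar> \<le> max K 0" for x using bspec[OF K, of x] z[of x] by (cases "x \<in> {a..b}") auto
  then show ?thesis by blast
qed

text \<open>The supports of the \<open>\<phi> (2 x - k)\<close> in the two-scale relation lie in \<open>[1 - N, N]\<close>, because
  \<open>k\<close> itself ranges over that interval.\<close>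

lemma daubechies_wavelet_support:
  assumes d: "daubechies_pair N \<phi> \<psi>" and x: "x \<notin> {1 - real N..real N}"
  shows "\<psi> x = 0"
proof -
  from d obtain h :: "int \<Rightarrow> real" where h: "\<psi> x = sqrt 2 *
       (\<Sum>k\<in>{1 - int N..int N}. (-1) powi k * h (1 - k) * \<phi> (2 * x - of_int k))"
    unfolding daubechies_pair_def by blast
  have "\<phi> (2 * x - of_int k) = 0" if "k \<in> {1 - int N..int N}" for k
  proof -
    have "real_of_int (1 - int N) \<le> of_int k" "of_int k \<le> real_of_int (int N)"
      using that by (auto simp del: of_int_diff of_int_of_nat_eq)
    then have "2 * x - of_int k \<notin> {1 - real N..real N}" using x by auto
    then show ?thesis using d by (auto simp: daubechies_pair_def)
  qed
  then show ?thesis unfolding h by simp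
qed

text \<open>Localisation is what turns coefficient bounds into sup-norm bounds: up to a constant, a level-\<open>l\<close>
  expansion has sup norm at most \<open>2 powr (l / 2)\<close> times its largest coefficient.\<close>

lemma cdv_basis_localised:
  assumes "cdv_basis S J0 \<psi>"
  shows "\<exists>C>0. \<forall>l\<ge>J0 - 1. \<forall>x\<in>{0..1}. (\<Sum>k<level_size J0 l. \<bar>\<psi> l k x\<bar>) \<le> C * 2 powr (real l / 2)"
proof -
  obtain N father mother \<phi>L \<psi>L \<phi>R \<psi>R where
    N: "S < N" "2 * N \<le> 2 ^ J0" and d: "daubechies_pair N father mother"
    and c: "continuously_differentiable_upto S father" "continuously_differentiable_upto S mother"
    and eL: "cdv_edge N father \<phi>L \<psi>L" and eR: "cdv_edge N (\<lambda>x. father (1 - x)) \<phi>R \<psi>R"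
    and f: "\<forall>k<2 ^ J0. \<forall>x\<in>{0..1}. \<psi> (J0 - 1) k x = cdv_dilate N father \<phi>L \<phi>R J0 k x"
    and m: "\<forall>l\<ge>J0. \<forall>k<2 ^ l. \<forall>x\<in>{0..1}. \<psi> l k x = cdv_dilate N mother \<psi>L \<psi>R l k x"
    using assms unfolding cdv_basis_def by (elim exE conjE) (rule that; assumption)
  have fs: "father x = 0" if "x \<notin> {1 - real N..real N}" for x
    using d that unfolding daubechies_pair_def by blast
  obtain K1 where K1: "\<And>x. \<bar>father x\<bar> \<le> K1" using compact_support_bounded[OF c(1) fs] by blast
  obtain K2 where K2: "\<And>x. \<bar>mother x\<bar> \<le> K2"
    using compact_support_bounded[OF c(2) daubechies_wavelet_support[OF d]] by blast
  obtain K3 where K3: "\<And>k x. k < N \<Longrightarrow> 0 \<le> x \<Longrightarrow> \<bar>\<phi>L k x\<bar> \<le> K3"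
    using cdv_edge_bounded(1)[OF eL K1] by auto
  obtain K4 where K4: "\<And>k x. k < N \<Longrightarrow> 0 \<le> x \<Longrightarrow> \<bar>\<psi>L k x\<bar> \<le> K4"
    using cdv_edge_bounded(2)[OF eL K1] by auto
  obtain K5 where K5: "\<And>k x. k < N \<Longrightarrow> 0 \<le> x \<Longrightarrow> \<bar>\<phi>R k x\<bar> \<le> K5"
    using cdv_edge_bounded(1)[OF eR K1] by auto
  obtain K6 where K6: "\<And>k x. k < N \<Longrightarrow> 0 \<le> x \<Longrightarrow> \<bar>\<psi>R k x\<bar> \<le> K6"
    using cdv_edge_bounded(2)[OF eR K1] by auto
  define K where "K = Max {K1, K2, K3, K4, K5, K6}"
  have K: "K1 \<le> K" "K2 \<le> K" "K3 \<le> K" "K4 \<le> K" "K5 \<le> K" "K6 \<le> K" by (auto simp: K_def)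
  have "0 \<le> K" using K1[of 0] K(1) by linarith
  have bnd: "\<bar>father y\<bar> \<le> K" "\<bar>mother y\<bar> \<le> K" for y
    using K1[of y] K2[of y] K by linarith+
  have bndL: "\<bar>\<phi>L k y\<bar> \<le> K" "\<bar>\<psi>L k y\<bar> \<le> K" if "k < N" "0 \<le> y" for k y
    using K3[OF that] K4[OF that] K by linarith+
  have bndR: "\<bar>\<phi>R k y\<bar> \<le> K" "\<bar>\<psi>R k y\<bar> \<le> K" if "k < N" "0 \<le> y" for k y
    using K5[OF that] K6[OF that] K by linarith+
  define C where "C = (4 * real N + 1) * K * 2 + 1"
  have "0 < C" using \<open>0 \<le> K\<close> by (simp add: C_def add_nonneg_pos)
  moreover have "(\<Sum>k<level_size J0 l. \<bar>\<psi> l k x\<bar>) \<le> C * 2 powr (real l / 2)" if l: "J0 - 1 \<le> l" and x: "x \<in> {0..1}" for l x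
  proof (cases "J0 \<le> l")
    case True
    have "2 * N \<le> 2 ^ l" using N(2) power_increasing[OF True, of "2::nat"] by linarith
    have "(\<Sum>k<level_size J0 l. \<bar>\<psi> l k x\<bar>) = (\<Sum>k<2 ^ l. \<bar>cdv_dilate N mother \<psi>L \<psi>R l k x\<bar>)"
      using True x m by (intro sum.cong) (auto simp: level_size_def)
    also have "\<dots> \<le> (4 * real N + 1) * K * 2 powr (real l / 2)"
      by (rule cdv_dilate_sum_bound[OF bnd(2) daubechies_wavelet_support[OF d] bndL(2) bndR(2) \<open>2 * N \<le> 2 ^ l\<close> x])
    also have "\<dots> \<le> C * 2 powr (real l / 2)"
      using \<open>0 \<le> K\<close> by (intro mult_right_mono) (auto simp: C_def)
    finally show ?thesis .
  next
    case False
    then have l': "l = J0 - 1" "real J0 = real l + 1" using l by auto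
    have "(\<Sum>k<level_size J0 l. \<bar>\<psi> l k x\<bar>) = (\<Sum>k<2 ^ J0. \<bar>cdv_dilate N father \<phi>L \<phi>R J0 k x\<bar>)"
      using False x f unfolding l' by (intro sum.cong) (auto simp: level_size_def)
    also have "\<dots> \<le> (4 * real N + 1) * K * 2 powr (real J0 / 2)"
      by (rule cdv_dilate_sum_bound[OF bnd(1) fs bndL(1) bndR(1) N(2) x])
    also have "2 powr (real J0 / 2) = 2 powr (1/2) * 2 powr (real l / 2)"
      by (simp add: l'(2) add_divide_distrib powr_add)
    also have "(4 * real N + 1) * K * (2 powr (1/2) * 2 powr (real l / 2)) \<le> (4 * real N + 1) * K * (2 * 2 powr (real l / 2))"
      using \<open>0 \<le> K\<close> powr_mono[of "1/2" 1 "2::real"] by (intro mult_left_mono mult_right_mono) auto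
    also have "\<dots> \<le> C * 2 powr (real l / 2)"
      by (simp add: C_def algebra_simps)
    finally show ?thesis .
  qed
  ultimately show ?thesis by blast
qed

section \<open>Sup norms from wavelet coefficients\<close>

text \<open>By localisation the wavelet series converges uniformly, to a bounded function \<open>H\<close>; integrating
  term by term, \<open>H\<close> has the same coefficients as \<open>h\<close>, and completeness of the basis gives
  \<open>h = H\<close> almost everywhere.\<close>

lemma sup_norm_le_coefs:
  assumes ob: "orthonormal_basis (full_index J0) \<psi>" and J0: "1 \<le> J0"
    and loc: "\<And>l x. J0 - 1 \<le> l \<Longrightarrow> x \<in> {0..1} \<Longrightarrow> (\<Sum>k<level_size J0 l. \<bar>\<psi> l k x\<bar>) \<le> C * 2 powr (real l / 2)"
    and h: "h \<in> L2"
    and b: "\<And>l k. J0 - 1 \<le> l \<Longrightarrow> k < level_size J0 l \<Longrightarrow> \<bar>l2_inner h (\<psi> l k)\<bar> \<le> b l"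
    and b0: "\<And>l. 0 \<le> b l"
    and sb: "summable (\<lambda>l. C * 2 powr (real l / 2) * b l)"
  shows "linf_norm h \<le> ereal (\<Sum>l. C * 2 powr (real l / 2) * b l)"
proof -
  let ?\<nu> = "lebesgue_on {0..1::real}"
  define a where "a l = C * 2 powr (real l / 2) * b l" for l
  have C0: "0 \<le> C"
  proof -
    have "0 \<le> (\<Sum>k<level_size J0 (J0 - 1). \<bar>\<psi> (J0 - 1) k 0\<bar>)" by (intro sum_nonneg) auto
    also have "\<dots> \<le> C * 2 powr (real (J0 - 1) / 2)" by (rule loc) auto
    finally show ?thesis by (simp add: zero_le_mult_iff)
  qed
  have a0: "0 \<le> a l" for l using C0 b0 by (simp add: a_def)
  have sa: "summable a" using sb by (simp add: a_def[abs_def])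
  define c where "c l k = l2_inner h (\<psi> l k)" for l k
  define t where "t l x = (if J0 - 1 \<le> l then \<Sum>k<level_size J0 l. c l k * \<psi> l k x else 0)" for l x
  define H where "H x = (\<Sum>l. t l x)" for x
  have \<psi>L2: "\<psi> l k \<in> L2" if "J0 - 1 \<le> l" "k < level_size J0 l" for l k
    using ob that by (auto simp: orthonormal_basis_def full_index_eq[OF J0])
  have tL2: "t l \<in> L2" for l
    unfolding t_def by (cases "J0 - 1 \<le> l") (auto intro!: L2_sum L2_zero \<psi>L2)
  have ta: "\<bar>t l x\<bar> \<le> a l" if x: "x \<in> {0..1}" for l x
  proof (cases "J0 - 1 \<le> l")
    case True
    have "\<bar>t l x\<bar> \<le> (\<Sum>k<level_size J0 l. \<bar>c l k * \<psi> l k x\<bar>)"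
      using True by (simp add: t_def sum_abs)
    also have "\<dots> \<le> (\<Sum>k<level_size J0 l. b l * \<bar>\<psi> l k x\<bar>)"
      using b[OF True] by (intro sum_mono) (auto simp: abs_mult c_def intro!: mult_right_mono)
    also have "\<dots> = b l * (\<Sum>k<level_size J0 l. \<bar>\<psi> l k x\<bar>)" by (simp add: sum_distrib_left)
    also have "\<dots> \<le> b l * (C * 2 powr (real l / 2))"
      by (intro mult_left_mono loc True x b0)
    finally show ?thesis by (simp add: a_def mult_ac)
  qed (use a0 in \<open>simp add: t_def\<close>)
  have st: "summable (\<lambda>l. \<bar>t l x\<bar>)" if "x \<in> {0..1}" for x
    using ta[OF that] by (intro summable_comparison_test'[OF sa, of 0]) auto
  have Hb: "\<bar>H x\<bar> \<le> (\<Sum>l. a l)" if x: "x \<in> {0..1}" for x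
  proof -
    have "\<bar>H x\<bar> \<le> (\<Sum>l. \<bar>t l x\<bar>)" unfolding H_def by (rule summable_rabs[OF st[OF x]])
    also have "\<dots> \<le> (\<Sum>l. a l)" by (rule suminf_le[OF ta[OF x] st[OF x] sa])
    finally show ?thesis .
  qed
  have Hm: "H \<in> borel_measurable ?\<nu>"
    unfolding H_def using L2_measurable[OF tL2] by (intro borel_measurable_suminf) auto
  have HL2: "H \<in> L2" by (rule L2_bounded[OF Hm Hb])
  have tc: "l2_inner (t l) (\<psi> l' k') = (if l = l' then c l' k' else 0)"
    if "J0 - 1 \<le> l'" "k' < level_size J0 l'" for l l' k'
  proof (cases "J0 - 1 \<le> l")
    case True
    have on: "l2_inner (\<psi> l k) (\<psi> l' k') = (if (l, k) = (l', k') then 1 else 0)"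
      if "k < level_size J0 l" for k
    proof -
      have "(l, k) \<in> full_index J0" "(l', k') \<in> full_index J0"
        using True that \<open>J0 - 1 \<le> l'\<close> \<open>k' < level_size J0 l'\<close> by (auto simp: full_index_eq[OF J0])
      then show ?thesis using ob unfolding orthonormal_basis_def by fast
    qed
    have "l2_inner (t l) (\<psi> l' k') = (\<Sum>k<level_size J0 l. c l k * l2_inner (\<psi> l k) (\<psi> l' k'))"
    proof -
      have "l2_inner (\<lambda>x. \<Sum>k<level_size J0 l. c l k * \<psi> l k x) (\<psi> l' k') = (\<Sum>k<level_size J0 l. c l k * l2_inner (\<psi> l k) (\<psi> l' k'))"
        by (rule l2_inner_sum_left[OF _ \<psi>L2[OF True] \<psi>L2[OF that]]) auto
      then show ?thesis unfolding t_def using True by simp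
    qed
    also have "\<dots> = (\<Sum>k<level_size J0 l. if (l, k) = (l', k') then c l' k' else 0)"
      by (intro sum.cong refl) (auto simp: on)
    also have "\<dots> = (if l = l' then c l' k' else 0)"
      using that by (auto simp: sum.delta)
    finally show ?thesis .
  next
    case False
    then show ?thesis using that by (auto simp: t_def l2_inner_def)
  qed
  have Hc: "l2_inner H (\<psi> l' k') = c l' k'" if lk: "J0 - 1 \<le> l'" "k' < level_size J0 l'" for l' k'
  proof -
    note p = \<psi>L2[OF lk]
    have i\<psi>: "integrable ?\<nu> (\<lambda>x. \<bar>\<psi> l' k' x\<bar>)" using L2_integrable[OF p] by simp
    have "l2_inner H (\<psi> l' k') = (\<integral>x. (\<Sum>l. t l x * \<psi> l' k' x) \<partial>?\<nu>)"
      unfolding l2_inner_def H_def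
      by (intro Bochner_Integration.integral_cong refl suminf_mult2)
         (auto intro: summable_rabs_cancel[OF st])
    also have "\<dots> = (\<Sum>l. \<integral>x. t l x * \<psi> l' k' x \<partial>?\<nu>)"
    proof (rule integral_suminf)
      show "integrable ?\<nu> (\<lambda>x. t l x * \<psi> l' k' x)" for l by (rule L2_integrable_mult[OF tL2 p])
      show "AE x in ?\<nu>. summable (\<lambda>l. norm (t l x * \<psi> l' k' x))"
        by (intro AE_I2) (auto simp: abs_mult intro!: summable_mult2 st)
      show "summable (\<lambda>l. \<integral>x. norm (t l x * \<psi> l' k' x) \<partial>?\<nu>)"
      proof (rule summable_comparison_test'[where N=0])
        show "summable (\<lambda>l. a l * (\<integral>x. \<bar>\<psi> l' k' x\<bar> \<partial>?\<nu>))" by (rule summable_mult2[OF sa])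
        fix l
        have "(\<integral>x. norm (t l x * \<psi> l' k' x) \<partial>?\<nu>) \<le> (\<integral>x. a l * \<bar>\<psi> l' k' x\<bar> \<partial>?\<nu>)"
          using ta by (intro integral_mono integrable_norm L2_integrable_mult[OF tL2 p] integrable_mult_right i\<psi>)
            (auto simp: abs_mult intro!: mult_right_mono)
        then show "norm (\<integral>x. norm (t l x * \<psi> l' k' x) \<partial>?\<nu>) \<le> a l * (\<integral>x. \<bar>\<psi> l' k' x\<bar> \<partial>?\<nu>)"
          by (simp add: Bochner_Integration.integral_nonneg)
      qed
    qed
    also have "\<dots> = (\<Sum>l. if l = l' then c l' k' else 0)"
      using tc[OF lk] by (simp add: l2_inner_def)
    also have "\<dots> = c l' k'" using suminf_finite[of "{l'}" "\<lambda>l. if l = l' then c l' k' else 0"] by simp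
    finally show ?thesis .
  qed
  have "AE x in ?\<nu>. h x - H x = 0"
  proof -
    have "l2_inner (\<lambda>x. h x - H x) (\<psi> l k) = 0" if "(l, k) \<in> full_index J0" for l k
      using that Hc h HL2 \<psi>L2 by (auto simp: full_index_eq[OF J0] l2_inner_diff_left c_def)
    then show ?thesis using ob L2_diff[OF h HL2] unfolding orthonormal_basis_def by blast
  qed
  then have "AE x in ?\<nu>. ereal \<bar>h x\<bar> \<le> ereal (\<Sum>l. a l)"
    using AE_space by eventually_elim (use Hb in auto)
  then show ?thesis
    unfolding linf_norm_def a_def using L2_measurable[OF h] by (intro esssup_I) auto
qed

text \<open>Both summands of the Besov norm are nonnegative, so the norm dominates each wavelet coefficient
  separately.\<close>

lemma besov_norm_coef:
  assumes B: "besov_norm J0 \<psi> s f \<le> ereal B" and l: "J0 \<le> l" "k < 2 ^ l"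
  shows "\<bar>l2_inner f (\<psi> l k)\<bar> \<le> B * 2 powr (- real l * (s + 1/2))"
proof -
  let ?a = "\<lambda>k. ereal \<bar>l2_inner (\<psi> (J0 - 1) k) f\<bar>"
  let ?b = "\<lambda>(l, k). ereal (2 powr (real l * (s + 1/2)) * \<bar>l2_inner (\<psi> l k) f\<bar>)"
  have "?a 0 \<le> Max (?a ` {..<2 ^ J0})" by (intro Max_ge) auto
  then have 0: "0 \<le> Max (?a ` {..<2 ^ J0})" using order_trans[of 0 "?a 0"] by simp
  have "?b (l, k) \<le> (SUP p\<in>{(l, k). J0 \<le> l \<and> k < 2 ^ l}. ?b p)"
    using l by (intro SUP_upper) auto
  also have "\<dots> \<le> Max (?a ` {..<2 ^ J0}) + \<dots>"
    using add_right_mono[OF 0] by simp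
  also have "\<dots> \<le> ereal B" using B by (simp add: besov_norm_def)
  finally have "2 powr (real l * (s + 1/2)) * \<bar>l2_inner f (\<psi> l k)\<bar> \<le> B"
    by (simp add: l2_inner_commute)
  moreover have "x \<le> B * 2 powr (- e)" if "2 powr e * x \<le> B" for x e :: real
    using that by (simp add: powr_minus field_simps)
  ultimately show ?thesis unfolding mult_minus_left by blast
qed

lemma cn_band_iff:
  assumes w: "\<And>l. J0 - 1 \<le> l \<Longrightarrow> 0 < w l" and J0: "1 \<le> J0"
  shows "f \<in> cn_band J0 \<psi> w fhat R \<longleftrightarrow>
    f \<in> L2 \<and> (\<forall>(l, k)\<in>full_index J0. \<bar>l2_inner (\<lambda>x. f x - fhat x) (\<psi> l k)\<bar> \<le> R * w l)"
  unfolding cn_band_def using w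
  by (auto simp: SUP_le_iff full_index_eq[OF J0] pos_divide_le_eq)

text \<open>A geometric sum with ratio \<open>sqrt 2\<close>; the constant 3 works because \<open>3 + 1 \<le> 3 sqrt 2\<close>.\<close>

lemma sum_sqrt2_powers: "(\<Sum>l<J. 2 powr (real l / 2)) \<le> 3 * 2 powr (real J / 2)"
proof (induction J)
  case (Suc J)
  have "(4::real)/3 \<le> sqrt 2" by (rule real_le_rsqrt) (simp add: power2_eq_square)
  then have s: "(4::real)/3 \<le> 2 powr (1/2)" by (simp add: powr_half_sqrt)
  have "(\<Sum>l<Suc J. 2 powr (real l / 2)) \<le> 3 * (2 powr (real J / 2) * (4/3))"
    using Suc by simp
  also have "\<dots> \<le> 3 * (2 powr (real J / 2) * 2 powr (1/2))"
    using s by (intro mult_left_mono) auto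
  also have "\<dots> = 3 * 2 powr (real (Suc J) / 2)"
    by (simp add: powr_add[symmetric] add_divide_distrib add.commute)
  finally show ?case .
qed simp

text \<open>Below level \<open>J\<close> the coefficients of \<open>f - g\<close> are controlled by the band, which gives a
  geometric sum dominated by its last term; from level \<open>J\<close> on they are controlled by the Besov ball,
  which gives a geometric series dominated by its first term.\<close>

lemma band_diameter:
  assumes ob: "orthonormal_basis (full_index J0) \<psi>" and J0: "2 \<le> J0" "J0 \<le> J" and s: "0 < s"
    and C: "0 < C" and loc: "\<And>l x. J0 - 1 \<le> l \<Longrightarrow> x \<in> {0..1} \<Longrightarrow> (\<Sum>k<level_size J0 l. \<bar>\<psi> l k x\<bar>) \<le> C * 2 powr (real l / 2)"
    and w: "\<And>l. J0 - 1 \<le> l \<Longrightarrow> 0 < w l"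
    and fhat: "fhat \<in> L2" and R: "0 \<le> R" and B: "0 < B"
    and f: "f \<in> cn_band J0 \<psi> w fhat R" "besov_norm J0 \<psi> s f \<le> ereal B"
    and g: "g \<in> cn_band J0 \<psi> w fhat R" "besov_norm J0 \<psi> s g \<le> ereal B"
  shows "linf_norm (\<lambda>x. f x - g x) \<le>
    ereal (C * (6 * R * v_weight J0 w J * sqrt (2 ^ J * real J) + 2 * B * 2 powr (- real J * s) / (1 - 2 powr (- s))))"
proof -
  have J01: "1 \<le> J0" using J0 by simp
  define v where "v = v_weight J0 w J"
  have v: "w l \<le> v * sqrt (real l)" if "J0 - 1 \<le> l" "l < J" for l
  proof -
    have "w l / sqrt (real l) \<le> v"
      unfolding v_def v_weight_def using that by (intro Max_ge) auto
    then show ?thesis using that J0 by (simp add: pos_divide_le_eq)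
  qed
  have v0: "0 \<le> v"
  proof -
    have "0 < v * sqrt (real (J0 - 1))"
      using J0 by (intro less_le_trans[OF w v]) auto
    then show ?thesis using J0 by (simp add: zero_less_mult_iff)
  qed
  have iff: "F \<in> cn_band J0 \<psi> w fhat R \<longleftrightarrow>
      F \<in> L2 \<and> (\<forall>(l, k)\<in>full_index J0. \<bar>l2_inner (\<lambda>x. F x - fhat x) (\<psi> l k)\<bar> \<le> R * w l)" for F
    by (rule cn_band_iff[OF w J01])
  have L2: "f \<in> L2" "g \<in> L2" using f g by (auto simp: cn_band_def)
  define b where "b l = (if l < J then 2 * R * v * sqrt J else 2 * B * 2 powr (- real l * (s + 1/2)))" for l
  define a where "a l = C * 2 powr (real l / 2) * b l" for l
  have b0: "0 \<le> b l" for l using R B v0 by (simp add: b_def)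
  have bb: "\<bar>l2_inner (\<lambda>x. f x - g x) (\<psi> l k)\<bar> \<le> b l" if lk: "J0 - 1 \<le> l" "k < level_size J0 l" for l k
  proof -
    have lkf: "(l, k) \<in> full_index J0" using lk by (simp add: full_index_eq[OF J01])
    then have p: "\<psi> l k \<in> L2" using ob unfolding orthonormal_basis_def by blast
    show ?thesis
    proof (cases "l < J")
      case True
      have "\<bar>l2_inner (\<lambda>x. f x - fhat x) (\<psi> l k)\<bar> \<le> R * w l" "\<bar>l2_inner (\<lambda>x. g x - fhat x) (\<psi> l k)\<bar> \<le> R * w l"
        using f(1) g(1) lkf iff by auto
      then have "\<bar>l2_inner (\<lambda>x. f x - g x) (\<psi> l k)\<bar> \<le> 2 * R * w l"
        using L2 fhat p by (simp add: l2_inner_diff_left)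
      also have "\<dots> \<le> 2 * R * (v * sqrt J)"
        using R v0 v[OF lk(1) True] True
        by (intro mult_left_mono order_trans[OF v[OF lk(1) True]]) (auto intro!: mult_left_mono)
      finally show ?thesis using True by (simp add: b_def mult_ac)
    next
      case False
      then have l: "J0 \<le> l" "k < 2 ^ l" using lk J0 by (auto simp: level_size_def)
      show ?thesis
        using besov_norm_coef[OF f(2) l] besov_norm_coef[OF g(2) l] L2 p False
        by (simp add: l2_inner_diff_left b_def)
    qed
  qed
  define q where "q = 2 powr (- s)"
  have q: "0 < q" "q < 1" using s powr_less_mono[of "-s" 0 "2::real"] by (auto simp: q_def)
  have at: "a (l + J) = C * 2 * B * 2 powr (- real J * s) * q ^ l" for l
  proof -
    have "2 powr (real (l + J) / 2) * 2 powr (- real (l + J) * (s + 1/2)) = 2 powr (- real J * s) * q ^ l"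
      by (simp add: q_def powr_add[symmetric] powr_power algebra_simps add_divide_distrib)
    then show ?thesis by (simp add: a_def b_def)
  qed
  have "(\<lambda>l. q ^ l) sums (1 / (1 - q))" using q by (intro geometric_sums) auto
  then have sums: "(\<lambda>l. a (l + J)) sums (C * 2 * B * 2 powr (- real J * s) * (1 / (1 - q)))"
    unfolding at by (rule sums_mult)
  then have "summable a" using sums_summable summable_iff_shift by blast
  have "(\<Sum>l. a l) = (\<Sum>l. a (l + J)) + (\<Sum>l<J. a l)"
    by (rule suminf_split_initial_segment[OF \<open>summable a\<close>])
  also have "(\<Sum>l<J. a l) = C * (2 * R * v * sqrt J) * (\<Sum>l<J. 2 powr (real l / 2))"
    by (simp add: a_def b_def sum_distrib_left mult_ac)
  also have "\<dots> \<le> C * (2 * R * v * sqrt J) * (3 * 2 powr (real J / 2))"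
    using C R v0 by (intro mult_left_mono sum_sqrt2_powers) auto
  also have "2 powr (real J / 2) = sqrt (2 ^ J)"
    using powr_half_sqrt_powr[of 2 "real J"] by (simp add: powr_realpow)
  finally have "(\<Sum>l. a l) \<le> C * (6 * R * v * sqrt (2 ^ J * real J) + 2 * B * 2 powr (- real J * s) / (1 - q))"
    using sums_unique[OF sums] by (simp add: real_sqrt_mult algebra_simps)
  moreover have "linf_norm (\<lambda>x. f x - g x) \<le> ereal (\<Sum>l. a l)"
    unfolding a_def
    by (rule sup_norm_le_coefs[OF ob J01 loc L2_diff[OF L2] bb b0]) (use \<open>summable a\<close> in \<open>auto simp: a_def[abs_def]\<close>)
  ultimately show ?thesis unfolding v_def q_def
    by (meson ereal_less_eq(3) order_trans)
qed

section \<open>Isotropic Gaussian measures on coefficient vectors\<close>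

definition gauss_prod :: "'i set \<Rightarrow> real \<Rightarrow> ('i \<Rightarrow> real) \<Rightarrow> ('i \<Rightarrow> real) measure" where
  "gauss_prod I \<sigma> m = Pi\<^sub>M I (\<lambda>i. density lborel (normal_density (m i) \<sigma>))"

definition central_prob :: "real \<Rightarrow> real" where
  "central_prob x = measure (density lborel std_normal_density) {-x..x}"

lemma prob_space_gauss_prod: "0 < \<sigma> \<Longrightarrow> prob_space (gauss_prod I \<sigma> m)"
  unfolding gauss_prod_def by (intro prob_space_PiM prob_space_normal_density)

lemma sets_gauss_prod [measurable_cong]: "sets (gauss_prod I \<sigma> m) = sets (Pi\<^sub>M I (\<lambda>_. lborel))"
  unfolding gauss_prod_def by (intro sets_PiM_cong) auto

lemma space_gauss_prod: "space (gauss_prod I \<sigma> m) = space (Pi\<^sub>M I (\<lambda>_. lborel))"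
  by (rule sets_eq_imp_space_eq[OF sets_gauss_prod])

lemma prod_normal_density:
  assumes "finite I"
  shows "(\<Prod>i\<in>I. normal_density (m i) \<sigma> (x i)) =
    (1 / sqrt (2 * pi * \<sigma>\<^sup>2)) ^ card I * exp (- (\<Sum>i\<in>I. (x i - m i)\<^sup>2) / (2 * \<sigma>\<^sup>2))"
proof -
  have "(\<Prod>i\<in>I. normal_density (m i) \<sigma> (x i)) =
     (\<Prod>i\<in>I. 1 / sqrt (2 * pi * \<sigma>\<^sup>2)) * (\<Prod>i\<in>I. exp (- (x i - m i)\<^sup>2 / (2 * \<sigma>\<^sup>2)))"
    unfolding normal_density_def by (rule prod.distrib)
  also have "(\<Prod>i\<in>I. exp (- (x i - m i)\<^sup>2 / (2 * \<sigma>\<^sup>2))) = exp (- (\<Sum>i\<in>I. (x i - m i)\<^sup>2) / (2 * \<sigma>\<^sup>2))"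
    by (simp add: exp_sum[OF assms, symmetric] sum_negf sum_divide_distrib)
  finally show ?thesis by simp
qed

lemma gauss_prod_eq_density:
  assumes I: "finite I" and s: "0 < \<sigma>"
  shows "gauss_prod I \<sigma> m =
    density (Pi\<^sub>M I (\<lambda>_. lborel)) (\<lambda>x. ennreal (\<Prod>i\<in>I. normal_density (m i) \<sigma> (x i)))"
proof -
  interpret N: product_prob_space "\<lambda>i. density lborel (normal_density (m i) \<sigma>)"
    by standard (use prob_space_normal_density[OF s] in \<open>auto simp: prob_space_def finite_measure_def sigma_finite_measure_def prob_space_axioms_def intro!: prob_space_normal_density[OF s] prob_space.emeasure_space_1\<close>)
  interpret L: product_sigma_finite "\<lambda>_. lborel :: real measure" by standard
  show ?thesis
    unfolding gauss_prod_def
  proof (rule N.PiM_eqI[OF I, symmetric])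
    show "sets (density (Pi\<^sub>M I (\<lambda>_. lborel)) (\<lambda>x. ennreal (\<Prod>i\<in>I. normal_density (m i) \<sigma> (x i)))) =
        sets (Pi\<^sub>M I (\<lambda>i. density lborel (normal_density (m i) \<sigma>)))"
      by (simp, intro sets_PiM_cong) auto
    fix A assume A: "\<And>i. i \<in> I \<Longrightarrow> A i \<in> sets (density lborel (normal_density (m i) \<sigma>))"
    then have A': "\<And>i. i \<in> I \<Longrightarrow> A i \<in> sets borel" by simp
    have "emeasure (density (Pi\<^sub>M I (\<lambda>_. lborel)) (\<lambda>x. ennreal (\<Prod>i\<in>I. normal_density (m i) \<sigma> (x i)))) (Pi\<^sub>E I A)
      = (\<integral>\<^sup>+x. ennreal (\<Prod>i\<in>I. normal_density (m i) \<sigma> (x i)) * indicator (Pi\<^sub>E I A) x \<partial>Pi\<^sub>M I (\<lambda>_. lborel))"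
      using I A' by (intro emeasure_density) (auto intro!: sets_PiM_I_finite)
    also have "\<dots> = (\<integral>\<^sup>+x. (\<Prod>i\<in>I. ennreal (normal_density (m i) \<sigma> (x i)) * indicator (A i) (x i)) \<partial>Pi\<^sub>M I (\<lambda>_. lborel))"
    proof (intro nn_integral_cong)
      fix x :: "'a \<Rightarrow> real" assume x: "x \<in> space (Pi\<^sub>M I (\<lambda>_. lborel))"
      have "indicator (Pi\<^sub>E I A) x = (\<Prod>i\<in>I. indicator (A i) (x i) :: ennreal)"
        using x I by (auto simp: indicator_def space_PiM PiE_iff prod_zero_iff)
      then show "ennreal (\<Prod>i\<in>I. normal_density (m i) \<sigma> (x i)) * indicator (Pi\<^sub>E I A) x =
         (\<Prod>i\<in>I. ennreal (normal_density (m i) \<sigma> (x i)) * indicator (A i) (x i))"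
        by (simp add: prod.distrib prod_ennreal)
    qed
    also have "\<dots> = (\<Prod>i\<in>I. \<integral>\<^sup>+x. ennreal (normal_density (m i) \<sigma> x) * indicator (A i) x \<partial>lborel)"
      using A' by (intro L.product_nn_integral_prod[OF I]) auto
    also have "\<dots> = (\<Prod>i\<in>I. emeasure (density lborel (normal_density (m i) \<sigma>)) (A i))"
      using A' by (intro prod.cong refl emeasure_density[symmetric]) auto
    finally show "emeasure (density (Pi\<^sub>M I (\<lambda>_. lborel)) (\<lambda>x. ennreal (\<Prod>i\<in>I. normal_density (m i) \<sigma> (x i)))) (Pi\<^sub>E I A) =
      (\<Prod>i\<in>I. emeasure (density lborel (normal_density (m i) \<sigma>)) (A i))" .
  qed
qed

text \<open>Multiplying a normal density by \<open>exp ((x - m)\<^sup>2 / (4 \<sigma>\<^sup>2))\<close> gives a normal density of doubled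
  variance up to the factor \<open>sqrt 2\<close>: this is the exponential moment behind the Chernoff bound
  below.\<close>

lemma normal_density_tilt:
  assumes s: "0 < \<sigma>"
  shows "exp ((x - m)\<^sup>2 / (4 * \<sigma>\<^sup>2)) * normal_density m \<sigma> x = sqrt 2 * normal_density m (sqrt 2 * \<sigma>) x"
proof -
  have e: "exp ((x - m)\<^sup>2 / (4 * \<sigma>\<^sup>2)) * exp (- (x - m)\<^sup>2 / (2 * \<sigma>\<^sup>2)) = exp (- (x - m)\<^sup>2 / (2 * (sqrt 2 * \<sigma>)\<^sup>2))"
    using s by (simp add: exp_add[symmetric] field_simps)
  have "sqrt (2 * pi * (sqrt 2 * \<sigma>)\<^sup>2) = sqrt 2 * sqrt (2 * pi * \<sigma>\<^sup>2)"
    by (simp add: power_mult_distrib real_sqrt_mult)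
  then have "sqrt 2 * normal_density m (sqrt 2 * \<sigma>) x
     = 1 / sqrt (2 * pi * \<sigma>\<^sup>2) * (exp ((x - m)\<^sup>2 / (4 * \<sigma>\<^sup>2)) * exp (- (x - m)\<^sup>2 / (2 * \<sigma>\<^sup>2)))"
    unfolding normal_density_def e by simp
  then show ?thesis unfolding normal_density_def by simp
qed

lemma nn_integral_normal_density: "0 < \<sigma> \<Longrightarrow> (\<integral>\<^sup>+x. ennreal (normal_density m \<sigma> x) \<partial>lborel) = 1"
  by (simp add: nn_integral_eq_integral)

text \<open>Chernoff's bound for the squared norm. The exponential moment of each squared standardised coordinate at
  1/4 is \<open>sqrt 2\<close>, and the coordinates are independent.\<close>

lemma gauss_prod_norm_tail:
  assumes I: "finite I" and s: "0 < \<sigma>" and r: "0 \<le> \<rho>"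
  shows "measure (gauss_prod I \<sigma> m)
      {x \<in> space (Pi\<^sub>M I (\<lambda>_. lborel)). \<rho> * \<sigma> < L2_set (\<lambda>i. x i - m i) I}
    \<le> sqrt 2 ^ card I * exp (- \<rho>\<^sup>2 / 4)"
proof -
  interpret G: prob_space "gauss_prod I \<sigma> m" by (rule prob_space_gauss_prod[OF s])
  interpret L: product_sigma_finite "\<lambda>_. lborel :: real measure" by standard
  let ?P = "Pi\<^sub>M I (\<lambda>_. lborel) :: ('a \<Rightarrow> real) measure"
  let ?S = "{x \<in> space ?P. \<rho> * \<sigma> < L2_set (\<lambda>i. x i - m i) I}"
  have [measurable]: "?S \<in> sets ?P"
    unfolding L2_set_def by measurable
  have "emeasure (gauss_prod I \<sigma> m) ?S
      = (\<integral>\<^sup>+x. ennreal (\<Prod>i\<in>I. normal_density (m i) \<sigma> (x i)) * indicator ?S x \<partial>?P)"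
    unfolding gauss_prod_eq_density[OF I s] by (rule emeasure_density) auto
  also have "\<dots> \<le> (\<integral>\<^sup>+x. ennreal (exp (- \<rho>\<^sup>2 / 4)) * (\<Prod>i\<in>I. ennreal (sqrt 2 * normal_density (m i) (sqrt 2 * \<sigma>) (x i))) \<partial>?P)"
  proof (intro nn_integral_mono)
    fix x assume "x \<in> space ?P"
    let ?D = "\<Prod>i\<in>I. normal_density (m i) \<sigma> (x i)"
    have D0: "0 \<le> ?D" by (intro prod_nonneg) auto
    have "?D * indicator ?S x \<le> exp (- \<rho>\<^sup>2 / 4) * (exp ((\<Sum>i\<in>I. (x i - m i)\<^sup>2) / (4 * \<sigma>\<^sup>2)) * ?D)"
    proof (cases "x \<in> ?S")
      case True
      then have "(\<rho> * \<sigma>)\<^sup>2 \<le> (L2_set (\<lambda>i. x i - m i) I)\<^sup>2"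
        using r s by (intro power_mono) auto
      also have "\<dots> = (\<Sum>i\<in>I. (x i - m i)\<^sup>2)" by (simp add: L2_set_def sum_nonneg)
      finally have "\<rho>\<^sup>2 / 4 \<le> (\<Sum>i\<in>I. (x i - m i)\<^sup>2) / (4 * \<sigma>\<^sup>2)"
        using s by (simp add: field_simps power_mult_distrib)
      then have "1 \<le> exp (- \<rho>\<^sup>2 / 4 + (\<Sum>i\<in>I. (x i - m i)\<^sup>2) / (4 * \<sigma>\<^sup>2))"
        by simp
      then have "1 * ?D \<le> exp (- \<rho>\<^sup>2 / 4 + (\<Sum>i\<in>I. (x i - m i)\<^sup>2) / (4 * \<sigma>\<^sup>2)) * ?D"
        using D0 by (rule mult_right_mono)
      then show ?thesis using True by (simp only: exp_add) (simp add: mult_ac)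
    qed (use D0 in simp)
    also have "exp ((\<Sum>i\<in>I. (x i - m i)\<^sup>2) / (4 * \<sigma>\<^sup>2)) * ?D
        = (\<Prod>i\<in>I. sqrt 2 * normal_density (m i) (sqrt 2 * \<sigma>) (x i))"
      using I by (simp add: normal_density_tilt[OF s, symmetric] prod.distrib exp_sum sum_divide_distrib)
    finally show "ennreal ?D * indicator ?S x \<le>
       ennreal (exp (- \<rho>\<^sup>2 / 4)) * (\<Prod>i\<in>I. ennreal (sqrt 2 * normal_density (m i) (sqrt 2 * \<sigma>) (x i)))"
      by (subst prod_ennreal) (auto simp: ennreal_mult'[symmetric] ennreal_indicator[symmetric] D0 intro!: ennreal_leI)
  qed
  also have "\<dots> = ennreal (exp (- \<rho>\<^sup>2 / 4)) * (\<Prod>i\<in>I. \<integral>\<^sup>+x. ennreal (sqrt 2 * normal_density (m i) (sqrt 2 * \<sigma>) x) \<partial>lborel)"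
    using L.product_nn_integral_prod[OF I, of "\<lambda>i x. ennreal (sqrt 2 * normal_density (m i) (sqrt 2 * \<sigma>) x)"]
    by (subst nn_integral_cmult) auto
  also have "(\<Prod>i\<in>I. \<integral>\<^sup>+x. ennreal (sqrt 2 * normal_density (m i) (sqrt 2 * \<sigma>) x) \<partial>lborel) = (\<Prod>i\<in>I. ennreal (sqrt 2))"
    using s by (intro prod.cong refl) (simp add: ennreal_mult nn_integral_cmult nn_integral_normal_density)
  also have "ennreal (exp (- \<rho>\<^sup>2 / 4)) * (\<Prod>i\<in>I. ennreal (sqrt 2)) = ennreal (sqrt 2 ^ card I * exp (- \<rho>\<^sup>2 / 4))"
    by (simp add: ennreal_mult mult.commute ennreal_power)
  finally show ?thesis
    by (simp add: G.emeasure_eq_measure)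
qed

lemma measure_normal_central:
  assumes s: "0 < \<sigma>"
  shows "emeasure (density lborel (normal_density m \<sigma>)) {y. \<bar>y - m\<bar> \<le> x} = ennreal (central_prob (x / \<sigma>))"
proof -
  interpret N: prob_space "density lborel std_normal_density" by (rule prob_space_normal_density) simp
  have "emeasure (density lborel (normal_density m \<sigma>)) {y. \<bar>y - m\<bar> \<le> x}
    = (\<integral>\<^sup>+y. ennreal (normal_density m \<sigma> y) * indicator {y. \<bar>y - m\<bar> \<le> x} y \<partial>lborel)"
    by (rule emeasure_density) auto
  also have "\<dots> = \<bar>\<sigma>\<bar> * (\<integral>\<^sup>+y. ennreal (normal_density m \<sigma> (m + \<sigma> * y)) * indicator {y. \<bar>y - m\<bar> \<le> x} (m + \<sigma> * y) \<partial>lborel)"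
    using s by (intro nn_integral_real_affine) auto
  also have "\<dots> = (\<integral>\<^sup>+y. ennreal \<bar>\<sigma>\<bar> * (ennreal (normal_density m \<sigma> (m + \<sigma> * y)) * indicator {y. \<bar>y - m\<bar> \<le> x} (m + \<sigma> * y)) \<partial>lborel)"
    by (rule nn_integral_cmult[symmetric]) auto
  also have "\<dots> = (\<integral>\<^sup>+y. ennreal (std_normal_density y) * indicator {-(x/\<sigma>)..x/\<sigma>} y \<partial>lborel)"
  proof (intro nn_integral_cong)
    fix y
    have "(\<bar>(m + \<sigma> * y) - m\<bar> \<le> x) = (y \<in> {-(x/\<sigma>)..x/\<sigma>})"
      using s by (simp add: abs_le_iff field_simps) linarith
    then have i: "indicator {y. \<bar>y - m\<bar> \<le> x} (m + \<sigma> * y) = (indicator {-(x/\<sigma>)..x/\<sigma>} y :: ennreal)"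
      by (simp add: indicator_def)
    have "\<bar>\<sigma>\<bar> * normal_density m \<sigma> (m + \<sigma> * y) = std_normal_density y"
      using s by (simp add: normal_density_def real_sqrt_mult power_mult_distrib)
    then show "ennreal \<bar>\<sigma>\<bar> * (ennreal (normal_density m \<sigma> (m + \<sigma> * y)) * indicator {y. \<bar>y - m\<bar> \<le> x} (m + \<sigma> * y)) =
       ennreal (std_normal_density y) * indicator {-(x/\<sigma>)..x/\<sigma>} y"
      unfolding i by (simp add: mult.assoc[symmetric] ennreal_mult'[symmetric])
  qed
  also have "\<dots> = emeasure (density lborel std_normal_density) {-(x/\<sigma>)..x/\<sigma>}"
    by (rule emeasure_density[symmetric]) auto
  finally show ?thesis by (simp add: central_prob_def N.emeasure_eq_measure)
qed

text \<open>A weighted sup-norm ball is a box, so its Gaussian mass is an explicit product that does not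
  depend on the centre.\<close>

lemma gauss_prod_box:
  assumes I: "finite I" and s: "0 < \<sigma>"
  shows "measure (gauss_prod I \<sigma> m) {x \<in> space (Pi\<^sub>M I (\<lambda>_. lborel)). \<forall>i\<in>I. \<bar>x i - m i\<bar> \<le> r i}
    = (\<Prod>i\<in>I. central_prob (r i / \<sigma>))"
proof -
  interpret N: product_prob_space "\<lambda>i. density lborel (normal_density (m i) \<sigma>)"
    by (intro product_prob_space.intro product_prob_space_axioms.intro product_sigma_finite.intro)
       (use prob_space_normal_density[OF s] in \<open>auto simp: prob_space_def finite_measure_def\<close>)
  have "{x \<in> space (Pi\<^sub>M I (\<lambda>_. lborel)). \<forall>i\<in>I. \<bar>x i - m i\<bar> \<le> r i} = Pi\<^sub>E I (\<lambda>i. {y. \<bar>y - m i\<bar> \<le> r i})"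
    by (auto simp: space_PiM PiE_iff extensional_def)
  moreover have "emeasure (gauss_prod I \<sigma> m) (Pi\<^sub>E I (\<lambda>i. {y. \<bar>y - m i\<bar> \<le> r i})) = (\<Prod>i\<in>I. ennreal (central_prob (r i / \<sigma>)))"
    unfolding gauss_prod_def by (subst N.emeasure_PiM[OF I]) (auto simp: measure_normal_central[OF s])
  ultimately show ?thesis
    unfolding measure_def by (simp add: prod_ennreal central_prob_def prod_nonneg)
qed

lemma std_normal_real_distribution: "real_distribution (density lborel std_normal_density)"
  by (intro real_distribution.intro real_distribution_axioms.intro prob_space_normal_density) auto

lemma std_normal_interval_lower:
  assumes "0 \<le> x" "x \<le> y"
  shows "(y - x) * std_normal_density y \<le> measure (density lborel std_normal_density) {x<..y}"
proof -
  interpret N: prob_space "density lborel std_normal_density" by (rule prob_space_normal_density) simp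
  have "ennreal ((y - x) * std_normal_density y) = (\<integral>\<^sup>+z. ennreal (std_normal_density y) * indicator {x<..y} z \<partial>lborel)"
    using assms by (simp add: nn_integral_cmult ennreal_mult mult.commute)
  also have "\<dots> \<le> (\<integral>\<^sup>+z. ennreal (std_normal_density z) * indicator {x<..y} z \<partial>lborel)"
  proof (intro nn_integral_mono)
    fix z
    show "ennreal (std_normal_density y) * indicator {x<..y} z \<le> ennreal (std_normal_density z) * indicator {x<..y} z"
      using assms by (auto simp: indicator_def std_normal_density_def intro!: ennreal_leI divide_right_mono power_mono)
  qed
  also have "\<dots> = emeasure (density lborel std_normal_density) {x<..y}"
    by (rule emeasure_density[symmetric]) auto
  finally show ?thesis by (simp add: N.emeasure_eq_measure)
qed

lemma central_prob_nonneg: "0 \<le> central_prob x"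
  by (simp add: central_prob_def)

lemma central_prob_le_1: "central_prob x \<le> 1"
proof -
  interpret N: prob_space "density lborel std_normal_density" by (rule prob_space_normal_density) simp
  show ?thesis by (simp add: central_prob_def)
qed

text \<open>The increment is at least the mass of the right half of the added region, on which the density is
  smallest at the far end.\<close>

lemma central_prob_step:
  assumes "0 \<le> x" "x \<le> y"
  shows "central_prob x + (y - x) * std_normal_density y \<le> central_prob y"
proof -
  interpret N: prob_space "density lborel std_normal_density" by (rule prob_space_normal_density) simp
  have "central_prob x + (y - x) * std_normal_density y
      \<le> N.prob {-x..x} + N.prob {x<..y}"
    using std_normal_interval_lower[OF assms] by (simp add: central_prob_def)
  also have "\<dots> = N.prob ({-x..x} \<union> {x<..y})"
    by (rule N.finite_measure_Union[symmetric]) auto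
  also have "\<dots> \<le> central_prob y"
    unfolding central_prob_def using assms by (intro N.finite_measure_mono) auto
  finally show ?thesis .
qed

lemma central_prob_strict_mono:
  assumes "0 \<le> x" "x < y"
  shows "central_prob x < central_prob y"
proof -
  have "0 < (y - x) * std_normal_density y"
    using assms by (intro mult_pos_pos normal_density_pos) auto
  then show ?thesis using central_prob_step[of x y] assms by linarith
qed

lemma central_prob_mono: "0 \<le> x \<Longrightarrow> x \<le> y \<Longrightarrow> central_prob x \<le> central_prob y"
  using central_prob_strict_mono[of x y] by (cases "x = y") auto

lemma std_normal_singleton: "measure (density lborel std_normal_density) {x} = 0"
proof -
  have "emeasure (density lborel std_normal_density) {x} = (\<integral>\<^sup>+z. ennreal (std_normal_density z) * indicator {x} z \<partial>lborel)"
    by (rule emeasure_density) auto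
  also have "\<dots> = 0"
    by (subst nn_integral_0_iff_AE) (auto simp: indicator_def intro!: AE_I[where N="{x}"])
  finally show ?thesis by (simp add: measure_def)
qed

lemma central_prob_eq_cdf:
  assumes "0 \<le> x"
  shows "central_prob x = cdf (density lborel std_normal_density) x - cdf (density lborel std_normal_density) (- x)"
proof -
  interpret N: real_distribution "density lborel std_normal_density" by (rule std_normal_real_distribution)
  show ?thesis
  proof (cases "x = 0")
    case True then show ?thesis using std_normal_singleton[of 0] by (simp add: central_prob_def)
  next
    case False
    then have "cdf (density lborel std_normal_density) x - cdf (density lborel std_normal_density) (- x)
        = N.prob {-x<..x}"
      using assms by (intro N.cdf_diff_eq) auto
    also have "\<dots> = N.prob {-x} + N.prob {-x<..x}" by (simp add: std_normal_singleton)
    also have "\<dots> = N.prob ({-x} \<union> {-x<..x})"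
      by (rule N.finite_measure_Union[symmetric]) auto
    also have "{-x} \<union> {-x<..x} = {-x..x}" using assms by auto
    finally show ?thesis by (simp add: central_prob_def)
  qed
qed

lemma continuous_on_central_prob: "continuous_on {0..} central_prob"
proof -
  interpret N: real_distribution "density lborel std_normal_density" by (rule std_normal_real_distribution)
  have c: "continuous_on UNIV (cdf (density lborel std_normal_density))"
    by (simp add: continuous_on_eq_continuous_at N.isCont_cdf std_normal_singleton)
  have "continuous_on {0..} (\<lambda>x. cdf (density lborel std_normal_density) x - cdf (density lborel std_normal_density) (- x))"
    by (intro continuous_on_diff continuous_on_compose2[OF c] continuous_intros) auto
  then show ?thesis
    by (rule continuous_on_eq) (simp add: central_prob_eq_cdf)
qed

lemma central_prob_tendsto: "(central_prob \<longlongrightarrow> 1) at_top"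
proof -
  interpret N: real_distribution "density lborel std_normal_density" by (rule std_normal_real_distribution)
  have "((\<lambda>x. cdf (density lborel std_normal_density) x - cdf (density lborel std_normal_density) (- x)) \<longlongrightarrow> 1 - 0) at_top"
    by (intro tendsto_diff N.cdf_lim_at_top_prob filterlim_compose[OF N.cdf_lim_at_bot] filterlim_uminus_at_bot_at_top)
  moreover have "eventually (\<lambda>x. cdf (density lborel std_normal_density) x - cdf (density lborel std_normal_density) (- x) = central_prob x) at_top"
    using eventually_ge_at_top[of 0] by eventually_elim (simp add: central_prob_eq_cdf)
  ultimately show ?thesis by (simp add: tendsto_cong)
qed

lemma central_prob_0: "central_prob 0 = 0"
  using std_normal_singleton[of 0] by (simp add: central_prob_def)

text \<open>The one-dimensional case of the Chernoff bound, obtained from a product over a single index.\<close>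

lemma central_prob_tail:
  assumes "0 \<le> x"
  shows "1 - central_prob x \<le> sqrt 2 * exp (- x\<^sup>2 / 4)"
proof -
  interpret G: prob_space "gauss_prod {()} 1 (\<lambda>_. 0)" by (rule prob_space_gauss_prod) simp
  let ?P = "Pi\<^sub>M {()} (\<lambda>_. lborel) :: (unit \<Rightarrow> real) measure"
  have sp: "space (gauss_prod {()} 1 (\<lambda>_. 0)) = space ?P" by (rule space_gauss_prod)
  have box: "G.prob {z \<in> space ?P. \<forall>i\<in>{()}. \<bar>z i - 0\<bar> \<le> x} = central_prob x"
    using gauss_prod_box[of "{()}" 1 "\<lambda>_. 0" "\<lambda>_. x"] by simp
  have "1 - central_prob x = G.prob (space ?P - {z \<in> space ?P. \<forall>i\<in>{()}. \<bar>z i - 0\<bar> \<le> x})"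
    unfolding box[symmetric] sp[symmetric] by (rule G.prob_compl[symmetric]) (simp add: sp)
  also have "space ?P - {z \<in> space ?P. \<forall>i\<in>{()}. \<bar>z i - 0\<bar> \<le> x} = {z \<in> space ?P. x * 1 < L2_set (\<lambda>i. z i - 0) {()}}"
    by auto
  also have "G.prob \<dots> \<le> sqrt 2 ^ card {()} * exp (- x\<^sup>2 / 4)"
    using assms by (intro gauss_prod_norm_tail) auto
  finally show ?thesis by simp
qed

section \<open>Posteriors of locally flat priors\<close>

text \<open>Two values of the density on \<open>B\<close> have ratio at least \<open>1 - \<kappa>\<close>, so conditionally on \<open>B\<close> it dominates
  \<open>1 - \<kappa>\<close> times the reference measure; what happens off \<open>B\<close> costs the two escape
  probabilities. The coefficient of \<open>\<kappa>\<close> is exactly one.\<close>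

lemma density_lower_bound_of_flat:
  assumes G: "prob_space G" and P: "prob_space (density G (\<lambda>x. ennreal (r x)))"
    and r[measurable]: "r \<in> borel_measurable G" and r0: "\<And>x. x \<in> space G \<Longrightarrow> 0 \<le> r x"
    and \<kappa>: "0 \<le> \<kappa>" "\<kappa> \<le> 1" and B[measurable]: "B \<in> sets G" and S[measurable]: "S \<in> sets G"
    and flat: "\<And>x y. x \<in> B \<Longrightarrow> y \<in> B \<Longrightarrow> (1 - \<kappa>) * r x \<le> r y"
  shows "measure G S - (\<kappa> + measure (density G (\<lambda>x. ennreal (r x))) (space G - B) + measure G (space G - B))
    \<le> measure (density G (\<lambda>x. ennreal (r x))) S"
proof -
  interpret G: prob_space G by fact
  let ?P = "density G (\<lambda>x. ennreal (r x))"
  interpret P: prob_space ?P by fact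
  have BG: "x \<in> B \<Longrightarrow> x \<in> space G" for x using sets.sets_into_space[OF B] by auto
  \<comment> \<open>Average the flatness inequality over \<open>B\<close>.\<close>
  have step1: "(1 - \<kappa>) * P.prob B \<le> r x" if x: "x \<in> B" for x
  proof -
    have "ennreal ((1 - \<kappa>) * P.prob B) = ennreal (1 - \<kappa>) * emeasure ?P B"
      using \<kappa> by (simp add: P.emeasure_eq_measure ennreal_mult)
    also have "emeasure ?P B = (\<integral>\<^sup>+y. ennreal (r y) * indicator B y \<partial>G)"
      by (rule emeasure_density) auto
    also have "ennreal (1 - \<kappa>) * \<dots> = (\<integral>\<^sup>+y. ennreal (1 - \<kappa>) * (ennreal (r y) * indicator B y) \<partial>G)"
      by (rule nn_integral_cmult[symmetric]) auto
    also have "\<dots> \<le> (\<integral>\<^sup>+y. ennreal (r x) * indicator B y \<partial>G)"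
      using flat[OF _ x] \<kappa>
      by (intro nn_integral_mono) (auto simp: indicator_def ennreal_mult'[symmetric] intro!: ennreal_leI)
    also have "\<dots> = ennreal (r x) * ennreal (G.prob B)"
      by (simp add: nn_integral_cmult G.emeasure_eq_measure)
    also have "\<dots> = ennreal (r x * G.prob B)" using r0[OF BG[OF x]] by (simp add: ennreal_mult)
    also have "\<dots> \<le> ennreal (r x)" using r0[OF BG[OF x]] by (intro ennreal_leI mult_left_le) auto
    finally show ?thesis using r0[OF BG[OF x]] by simp
  qed
  let ?q = "(1 - \<kappa>) * P.prob B"
  have q0: "0 \<le> ?q" using \<kappa> by simp
  have "ennreal (?q * G.prob (S \<inter> B)) = (\<integral>\<^sup>+y. ennreal ?q * indicator (S \<inter> B) y \<partial>G)"
    using q0 by (simp add: nn_integral_cmult G.emeasure_eq_measure ennreal_mult)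
  also have "\<dots> \<le> (\<integral>\<^sup>+y. ennreal (r y) * indicator (S \<inter> B) y \<partial>G)"
    using step1 by (intro nn_integral_mono) (auto simp: indicator_def intro!: ennreal_leI)
  also have "\<dots> = emeasure ?P (S \<inter> B)"
    by (rule emeasure_density[symmetric]) auto
  also have "\<dots> \<le> emeasure ?P S" by (intro emeasure_mono) auto
  finally have 1: "?q * G.prob (S \<inter> B) \<le> P.prob S" by (simp add: P.emeasure_eq_measure)
  have 2: "P.prob B = 1 - P.prob (space G - B)" using P.prob_compl[of B] by simp
  have 3: "G.prob S \<le> G.prob (S \<inter> B) + G.prob (space G - B)"
  proof -
    have "G.prob S \<le> G.prob ((S \<inter> B) \<union> (space G - B))"
      using sets.sets_into_space[OF S] by (intro G.finite_measure_mono) auto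
    also have "\<dots> \<le> G.prob (S \<inter> B) + G.prob (space G - B)"
      by (rule measure_Un_le) auto
    finally show ?thesis .
  qed
  let ?a = "P.prob (space G - B)" and ?x = "G.prob (S \<inter> B)"
  have "?x - (\<kappa> + ?a) \<le> (1 - (\<kappa> + ?a)) * ?x"
    using mult_left_le[of ?x "\<kappa> + ?a"] \<kappa> by (simp add: left_diff_distrib)
  also have "\<dots> \<le> ?q * ?x"
    using \<kappa> by (intro mult_right_mono) (auto simp: 2 algebra_simps)
  finally show ?thesis using 1 3 by linarith
qed

text \<open>The one-sided bound, applied to a set and to its complement.\<close>

lemma total_variation_of_flat:
  assumes G: "prob_space G" and P: "prob_space (density G (\<lambda>x. ennreal (r x)))"
    and r: "r \<in> borel_measurable G" and r0: "\<And>x. x \<in> space G \<Longrightarrow> 0 \<le> r x"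
    and \<kappa>: "0 \<le> \<kappa>" "\<kappa> \<le> 1" and B: "B \<in> sets G" and S: "S \<in> sets G"
    and flat: "\<And>x y. x \<in> B \<Longrightarrow> y \<in> B \<Longrightarrow> (1 - \<kappa>) * r x \<le> r y"
  shows "\<bar>measure (density G (\<lambda>x. ennreal (r x))) S - measure G S\<bar>
    \<le> \<kappa> + measure (density G (\<lambda>x. ennreal (r x))) (space G - B) + measure G (space G - B)"
proof -
  interpret G: prob_space G by fact
  let ?P = "density G (\<lambda>x. ennreal (r x))"
  interpret P: prob_space ?P by fact
  have l: "G.prob X - (\<kappa> + P.prob (space G - B) + G.prob (space G - B)) \<le> P.prob X" if "X \<in> sets G" for X
    using that by (intro density_lower_bound_of_flat[OF G P r _ \<kappa> B] r0 flat)
  have "G.prob (space G - S) = 1 - G.prob S" "P.prob (space G - S) = 1 - P.prob S"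
    using G.prob_compl[OF S] P.prob_compl[of S] S by auto
  then show ?thesis using l[OF S] l[OF sets.compl_sets[OF S]] by (simp add: abs_le_iff)
qed

lemma coef_ball_iff:
  "\<beta> \<in> coef_ball I \<beta>0 n R \<longleftrightarrow> \<beta> \<in> space (coef_space I) \<and> L2_set (\<lambda>i. \<beta> i - \<beta>0 i) I \<le> R / sqrt (real n)"
  by (simp add: coef_ball_def)

lemma coef_ball_sets [measurable]: "coef_ball I \<beta>0 n R \<in> sets (coef_space I)"
  unfolding coef_ball_def L2_set_def by measurable

lemma center_in_coef_ball: "\<beta>0 \<in> space (coef_space I) \<Longrightarrow> 0 \<le> R \<Longrightarrow> \<beta>0 \<in> coef_ball I \<beta>0 n R"
  by (simp add: coef_ball_iff L2_set_def)

text \<open>The defining infimum in multiplied-out form, which stays meaningful where the density vanishes.\<close>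

lemma flatness_ratio:
  assumes p: "\<And>\<beta>. \<beta> \<in> space (coef_space I) \<Longrightarrow> 0 \<le> p \<beta>"
    and b: "\<beta> \<in> coef_ball I \<beta>0 n R" "\<beta>' \<in> coef_ball I \<beta>0 n R"
  shows "(1 - lack_of_flatness I \<beta>0 n p R) * p \<beta> \<le> p \<beta>'"
proof -
  have "0 \<le> p \<beta>" "0 \<le> p \<beta>'" using p b by (auto simp: coef_ball_iff)
  have "(INF (\<beta>, \<beta>')\<in>coef_ball I \<beta>0 n R \<times> coef_ball I \<beta>0 n R. p \<beta>' / p \<beta>) \<le> (case (\<beta>, \<beta>') of (\<beta>, \<beta>') \<Rightarrow> p \<beta>' / p \<beta>)"
    using b p by (intro cINF_lower bdd_belowI[where m=0]) (auto simp: coef_ball_iff)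
  then have "1 - lack_of_flatness I \<beta>0 n p R \<le> p \<beta>' / p \<beta>" by (simp add: lack_of_flatness_def)
  then show ?thesis using \<open>0 \<le> p \<beta>\<close> \<open>0 \<le> p \<beta>'\<close>
    by (cases "p \<beta> = 0") (auto simp: pos_le_divide_eq)
qed

lemma flatness_bounds:
  assumes p: "\<And>\<beta>. \<beta> \<in> space (coef_space I) \<Longrightarrow> 0 \<le> p \<beta>" and p0: "0 < p \<beta>0"
    and b: "\<beta>0 \<in> space (coef_space I)" and R: "0 \<le> R"
  shows "0 \<le> lack_of_flatness I \<beta>0 n p R" "lack_of_flatness I \<beta>0 n p R \<le> 1"
proof -
  note c = center_in_coef_ball[OF b R, of n]
  show "0 \<le> lack_of_flatness I \<beta>0 n p R"
  proof (rule ccontr)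
    assume "\<not> ?thesis"
    then have "1 * p \<beta>0 < (1 - lack_of_flatness I \<beta>0 n p R) * p \<beta>0" using p0 by (intro mult_strict_right_mono) auto
    then show False using flatness_ratio[of I p \<beta>0 \<beta>0 n R \<beta>0] p c by auto
  qed
  have "0 \<le> (INF (\<beta>, \<beta>')\<in>coef_ball I \<beta>0 n R \<times> coef_ball I \<beta>0 n R. p \<beta>' / p \<beta>)"
  proof (rule cINF_greatest)
    show "coef_ball I \<beta>0 n R \<times> coef_ball I \<beta>0 n R \<noteq> {}" using c by blast
  qed (use p in \<open>auto simp: coef_ball_iff\<close>)
  then show "lack_of_flatness I \<beta>0 n p R \<le> 1" by (simp add: lack_of_flatness_def)
qed

lemma L2_set_triangle_diff:
  "L2_set (\<lambda>i. x i - z i) I \<le> L2_set (\<lambda>i. x i - y i) I + L2_set (\<lambda>i. y i - z i) I"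
  using L2_set_triangle_ineq[of "\<lambda>i. x i - y i" "\<lambda>i. y i - z i" I] by simp

lemma L2_set_power2: "(L2_set f I)\<^sup>2 = (\<Sum>i\<in>I. (f i)\<^sup>2)"
  by (simp add: L2_set_def sum_nonneg)

text \<open>The constant 3 makes the Chernoff exponent \<open>9/4\<close>, which leaves more than one power of \<open>n\<close> per
  coordinate after paying \<open>sqrt 2 \<le> sqrt n\<close> for each of them.\<close>

lemma gauss_prod_norm_tail_log:
  assumes I: "finite I" and s: "0 < \<sigma>" and n: "2 \<le> (n::nat)"
  shows "measure (gauss_prod I \<sigma> m)
      {x \<in> space (Pi\<^sub>M I (\<lambda>_. lborel)). 3 * sqrt (card I * ln n) * \<sigma> < L2_set (\<lambda>i. x i - m i) I}
    \<le> real n powr (- real (card I))"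
proof -
  let ?d = "real (card I)"
  have ln0: "0 \<le> ln (real n)" using n by simp
  have "measure (gauss_prod I \<sigma> m)
      {x \<in> space (Pi\<^sub>M I (\<lambda>_. lborel)). 3 * sqrt (?d * ln n) * \<sigma> < L2_set (\<lambda>i. x i - m i) I}
    \<le> sqrt 2 ^ card I * exp (- (3 * sqrt (?d * ln n))\<^sup>2 / 4)"
    using ln0 by (intro gauss_prod_norm_tail I s) auto
  also have "sqrt 2 ^ card I = 2 powr (?d / 2)"
    by (simp add: powr_half_sqrt[symmetric] powr_power)
  also have "\<dots> \<le> real n powr (?d / 2)" using n by (intro powr_mono2) auto
  also have "exp (- (3 * sqrt (?d * ln n))\<^sup>2 / 4) = real n powr (- (9/4) * ?d)"
    using ln0 n by (simp add: powr_def power_mult_distrib)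
  also have "real n powr (?d / 2) * \<dots> = real n powr (?d / 2 - (9/4) * ?d)"
    by (simp add: powr_add[symmetric])
  also have "\<dots> \<le> real n powr (- ?d)"
    using n by (intro powr_mono) auto
  finally show ?thesis by simp
qed

lemma prior_integrable:
  assumes "prior_density I p"
  shows "integrable (coef_space I) p"
  using assms unfolding prior_density_def
  by (intro integrableI_nonneg) (auto intro!: AE_I2)

lemma integrable_unnormalized_posterior:
  assumes "prior_density I p"
  shows "integrable (coef_space I) (unnormalized_posterior I p n y)"
proof (rule Bochner_Integration.integrable_bound[OF prior_integrable[OF assms]])
  have [measurable]: "p \<in> borel_measurable (coef_space I)" using assms by (simp add: prior_density_def)
  show "unnormalized_posterior I p n y \<in> borel_measurable (coef_space I)"
    unfolding unnormalized_posterior_def[abs_def] by measurable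
  have "\<bar>exp (- (real n / 2) * (\<Sum>i\<in>I. (y i - \<beta> i)\<^sup>2))\<bar> \<le> 1" for \<beta>
    by (simp add: sum_nonneg mult_nonneg_nonneg)
  then show "AE \<beta> in coef_space I. norm (unnormalized_posterior I p n y \<beta>) \<le> norm (p \<beta>)"
    by (intro AE_I2) (auto simp: unnormalized_posterior_def abs_mult intro!: mult_left_le)
qed

text \<open>The normalising constant of the posterior is at least the contribution of a cube of side
  \<open>2 / (n sqrt d)\<close> around the true coefficients. On it the prior is at least half its central value,
  and the likelihood is at least \<open>n\<close> to the power \<open>-9 d\<close>, up to a constant, by the assumption on the data. Each factor is
  a power of \<open>n\<close> with exponent of order \<open>d\<close>.\<close>

lemma evidence_lower_bound:
  fixes C1 :: real
  assumes I: "finite I" and d: "3 \<le> card I" "card I \<le> n" and n: "2 \<le> n"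
    and p: "prior_density I p" and \<beta>0: "\<beta>0 \<in> space (coef_space I)"
    and p0: "p \<beta>0 \<ge> real n powr (card I / 2) * real n powr (- C1 * card I)"
    and flat: "lack_of_flatness I \<beta>0 n p (1 / sqrt (real n)) \<le> 1/2"
    and y: "L2_set (\<lambda>i. y i - \<beta>0 i) I \<le> 3 * sqrt (card I * ln n) / sqrt n"
  shows "real n powr (- (C1 + 10) * card I) \<le> (LINT b|coef_space I. unnormalized_posterior I p n y b)"
proof -
  interpret L: product_sigma_finite "\<lambda>_. lborel :: real measure" by standard
  let ?d = "real (card I)"
  let ?q = "unnormalized_posterior I p n y"
  have n0: "0 < real n" and ln0: "0 \<le> ln (real n)" and d0: "0 < ?d" using n d by auto
  have pn: "\<And>\<beta>. \<beta> \<in> space (coef_space I) \<Longrightarrow> 0 \<le> p \<beta>" using p by (simp add: prior_density_def)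
  define h where "h = 1 / (n * sqrt ?d)"
  have h0: "0 < h" using n0 d0 by (simp add: h_def)
  define Q where "Q = Pi\<^sub>E I (\<lambda>i. {\<beta>0 i - h..\<beta>0 i + h})"
  have Qs[measurable]: "Q \<in> sets (coef_space I)" unfolding Q_def using I by (intro sets_PiM_I_finite) auto
  have volQ: "emeasure (coef_space I) Q = ennreal ((2 * h) ^ card I)"
    unfolding Q_def using I h0 by (subst L.emeasure_PiM) (auto simp: ennreal_power)
  define m where "m = p \<beta>0 / 2 * exp (- 9 * ?d * ln n - 1)"
  have p0': "0 < p \<beta>0" using p0 n0 by (intro less_le_trans[OF _ p0]) simp
  have m0: "0 < m" using p0' by (simp add: m_def)
  have qQ: "m \<le> ?q \<beta>" if b: "\<beta> \<in> Q" for \<beta>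
  proof -
    have bs: "\<beta> \<in> space (coef_space I)" using sets.sets_into_space[OF Qs] b by auto
    have "(\<beta> i - \<beta>0 i)\<^sup>2 \<le> h\<^sup>2" if "i \<in> I" for i
    proof -
      have "\<bar>\<beta> i - \<beta>0 i\<bar> \<le> h" using b that by (auto simp: Q_def PiE_iff abs_le_iff)
      then show ?thesis using h0 by (simp add: abs_le_square_iff[symmetric])
    qed
    then have "(\<Sum>i\<in>I. (\<beta> i - \<beta>0 i)\<^sup>2) \<le> ?d * h\<^sup>2"
      using sum_bounded_above[of I "\<lambda>i. (\<beta> i - \<beta>0 i)\<^sup>2" "h\<^sup>2"] by simp
    also have "?d * h\<^sup>2 = (1 / real n)\<^sup>2"
      using d0 by (simp add: h_def power_divide power_mult_distrib)
    finally have 1: "(\<Sum>i\<in>I. (\<beta> i - \<beta>0 i)\<^sup>2) \<le> (1 / real n)\<^sup>2" .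
    then have "L2_set (\<lambda>i. \<beta> i - \<beta>0 i) I \<le> 1 / real n"
      unfolding L2_set_def by (rule real_le_lsqrt[OF _ _, rotated -1]) (auto simp: sum_nonneg)
    then have bb: "\<beta> \<in> coef_ball I \<beta>0 n (1 / sqrt (real n))" using bs by (simp add: coef_ball_iff)
    have c: "\<beta>0 \<in> coef_ball I \<beta>0 n (1 / sqrt (real n))" by (rule center_in_coef_ball[OF \<beta>0]) simp
    have "1/2 * p \<beta>0 \<le> (1 - lack_of_flatness I \<beta>0 n p (1 / sqrt (real n))) * p \<beta>0"
      using flat p0' by (intro mult_right_mono) auto
    also have "\<dots> \<le> p \<beta>" by (rule flatness_ratio[OF pn c bb])
    finally have pb: "p \<beta>0 / 2 \<le> p \<beta>" by simp
    have "(y i - \<beta> i)\<^sup>2 \<le> 2 * (y i - \<beta>0 i)\<^sup>2 + 2 * (\<beta> i - \<beta>0 i)\<^sup>2" for i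
      using zero_le_power2[of "(y i - \<beta>0 i) + (\<beta> i - \<beta>0 i)"] by (simp add: power2_eq_square algebra_simps)
    then have "(\<Sum>i\<in>I. (y i - \<beta> i)\<^sup>2) \<le> 2 * (\<Sum>i\<in>I. (y i - \<beta>0 i)\<^sup>2) + 2 * (\<Sum>i\<in>I. (\<beta> i - \<beta>0 i)\<^sup>2)"
      by (simp add: sum_distrib_left sum.distrib[symmetric] sum_mono)
    also have "(\<Sum>i\<in>I. (y i - \<beta>0 i)\<^sup>2) \<le> (3 * sqrt (?d * ln n) / sqrt n)\<^sup>2"
      unfolding L2_set_power2[symmetric] by (intro power_mono y) simp
    also have "\<dots> = 9 * ?d * ln n / n" using ln0 n0 by (simp add: power_divide power_mult_distrib)
    finally have "(\<Sum>i\<in>I. (y i - \<beta> i)\<^sup>2) \<le> 2 * (9 * ?d * ln n / n) + 2 * (1 / real n)\<^sup>2" using 1 by simp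
    then have "(real n / 2) * (\<Sum>i\<in>I. (y i - \<beta> i)\<^sup>2) \<le> (real n / 2) * (2 * (9 * ?d * ln n / n) + 2 * (1 / real n)\<^sup>2)"
      by (intro mult_left_mono) auto
    also have "\<dots> = 9 * ?d * ln n + 1 / real n" using n0 by (simp add: field_simps power2_eq_square)
    also have "\<dots> \<le> 9 * ?d * ln n + 1" using n by simp
    finally have "exp (- 9 * ?d * ln n - 1) \<le> exp (- (real n / 2) * (\<Sum>i\<in>I. (y i - \<beta> i)\<^sup>2))" by simp
    then show ?thesis unfolding m_def unnormalized_posterior_def using pb p0'
      by (intro mult_mono) auto
  qed
  have "ennreal (m * (2 * h) ^ card I) = (\<integral>\<^sup>+\<beta>. ennreal m * indicator Q \<beta> \<partial>coef_space I)"
    using m0 h0 by (simp add: nn_integral_cmult volQ ennreal_mult)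
  also have "\<dots> \<le> (\<integral>\<^sup>+\<beta>. ennreal (?q \<beta>) \<partial>coef_space I)"
    using qQ by (intro nn_integral_mono) (auto simp: indicator_def intro!: ennreal_leI)
  also have "\<dots> = ennreal (LINT b|coef_space I. ?q b)"
    using pn by (intro nn_integral_eq_integral integrable_unnormalized_posterior[OF p] AE_I2)
      (auto simp: unnormalized_posterior_def)
  finally have D: "m * (2 * h) ^ card I \<le> (LINT b|coef_space I. ?q b)"
    using mult_pos_pos[OF m0 zero_less_power[of "2 * h" "card I"]] h0 by (subst (asm) ennreal_le_iff2) auto
  \<comment> \<open>Powers of \<open>n\<close>: the prior, the likelihood, and the volume of the cube, for which \<open>sqrt d \<le> sqrt n\<close>.\<close>
  have "real n powr (- (C1 + 10) * ?d)
     = (real n powr (?d / 2) * real n powr (- C1 * ?d)) * real n powr (- 9 * ?d) * real n powr (- (3/2) * ?d)"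
  proof -
    have e: "- (C1 + 10) * ?d = ?d / 2 + - C1 * ?d + - 9 * ?d + - (3/2) * ?d" by (simp add: algebra_simps)
    show ?thesis unfolding e powr_add ..
  qed
  also have "\<dots> \<le> p \<beta>0 * real n powr (- 9 * ?d) * (h ^ card I)"
  proof (intro mult_mono)
    have "real n powr (- (3/2) * ?d) = (real n powr (- (3/2))) ^ card I" using n0 by (simp add: powr_power mult.commute)
    also have "real n powr (- (3/2)) = 1 / (real n * sqrt (real n))"
    proof -
      have "real n powr (3/2) = real n powr (1 + 1/2)" by simp
      also have "\<dots> = real n * sqrt (real n)" using n0 by (subst powr_add) (simp add: powr_half_sqrt)
      finally show ?thesis using n0 by (simp only: powr_minus_divide)
    qed
    also have "(1 / (real n * sqrt (real n))) ^ card I \<le> h ^ card I"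
      unfolding h_def using d n0 d0 by (intro power_mono divide_left_mono mult_left_mono mult_pos_pos) auto
    finally show "real n powr (- (3/2) * ?d) \<le> h ^ card I" .
  qed (use p0 p0' in auto)
  also have "\<dots> \<le> m * (2 * h) ^ card I"
  proof -
    \<comment> \<open>The volume factor \<open>2 ^ d\<close> absorbs the constants, which is why at least three coordinates are needed.\<close>
    have "exp 1 * 2 \<le> (2::real) ^ 3" using exp_le by simp
    also have "\<dots> \<le> 2 ^ card I" using d by (intro power_increasing) auto
    finally have e: "1 \<le> 2 ^ card I / (2 * exp (1::real))" by (simp add: field_simps)
    have "real n powr (- 9 * ?d) = exp (- 9 * ?d * ln n)" using n0 by (simp add: powr_def)
    then have "m * (2 * h) ^ card I = (p \<beta>0 * real n powr (- 9 * ?d) * (h ^ card I)) * (2 ^ card I / (2 * exp 1))"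
      by (simp add: m_def exp_diff power_mult_distrib)
    moreover have "0 \<le> p \<beta>0 * real n powr (- 9 * ?d) * (h ^ card I)" using p0' h0 by simp
    ultimately show ?thesis using mult_left_mono[OF e] by fastforce
  qed
  also note D
  finally show ?thesis .
qed

text \<open>The likelihood is proportional to the density of the Gaussian measure centred at the data, so
  relative to that measure the posterior density is a multiple of the prior density.\<close>

lemma posterior_eq_density_gauss:
  assumes I: "finite I" and n: "0 < n" and p: "prior_density I p"
    and D: "0 < (LINT b|coef_space I. unnormalized_posterior I p n y b)"
  shows "\<exists>K>0. posterior I p n y = density (gauss_prod I (1 / sqrt n) y) (\<lambda>\<beta>. ennreal (p \<beta> / K))"
proof -
  let ?D = "LINT b|coef_space I. unnormalized_posterior I p n y b"
  let ?s = "1 / sqrt (real n)"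
  define c where "c = (1 / sqrt (2 * pi * ?s\<^sup>2)) ^ card I"
  have c0: "0 < c" using n by (simp add: c_def)
  have pn: "\<And>\<beta>. \<beta> \<in> space (coef_space I) \<Longrightarrow> 0 \<le> p \<beta>" using p by (simp add: prior_density_def)
  have [measurable]: "p \<in> borel_measurable (coef_space I)" using p by (simp add: prior_density_def)
  have "density (gauss_prod I ?s y) (\<lambda>\<beta>. ennreal (p \<beta> / (c * ?D)))
    = density (coef_space I) (\<lambda>\<beta>. ennreal (\<Prod>i\<in>I. normal_density (y i) ?s (\<beta> i)) * ennreal (p \<beta> / (c * ?D)))"
    using I n by (subst gauss_prod_eq_density) (auto intro!: density_density_eq)
  also have "\<dots> = posterior I p n y"
    unfolding posterior_def
  proof (rule density_cong)
    show "AE \<beta> in coef_space I. ennreal (\<Prod>i\<in>I. normal_density (y i) ?s (\<beta> i)) * ennreal (p \<beta> / (c * ?D))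
        = ennreal (unnormalized_posterior I p n y \<beta> / ?D)"
    proof (rule AE_I2)
      fix \<beta> assume b: "\<beta> \<in> space (coef_space I)"
      have "(\<Prod>i\<in>I. normal_density (y i) ?s (\<beta> i)) * (p \<beta> / (c * ?D)) = unnormalized_posterior I p n y \<beta> / ?D"
        using n c0 unfolding prod_normal_density[OF I] c_def[symmetric] unnormalized_posterior_def
        by (simp add: power_divide power2_commute mult.commute)
      then show "ennreal (\<Prod>i\<in>I. normal_density (y i) ?s (\<beta> i)) * ennreal (p \<beta> / (c * ?D))
        = ennreal (unnormalized_posterior I p n y \<beta> / ?D)"
        using pn[OF b] c0 D by (subst ennreal_mult''[symmetric]) auto
    qed
  qed (simp_all add: unnormalized_posterior_def)
  finally show ?thesis using c0 D by (intro exI[of _ "c * ?D"]) auto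
qed

text \<open>A finite-sample Bernstein--von Mises theorem. Relative to the Gaussian measure around the data the
  posterior has density proportional to the prior, which is nearly constant on a ball of radius
  \<open>(C1 + 10) sqrt (d ln n / n)\<close>. Outside that ball the Gaussian mass is small by concentration,
  and the posterior mass is small because the likelihood has fallen below the normalising
  constant.\<close>

lemma posterior_near_gauss:
  fixes C1 :: real
  assumes I: "finite I" and d: "3 \<le> card I" "card I \<le> n" and n: "2 \<le> n"
    and p: "prior_density I p" and \<beta>0: "\<beta>0 \<in> space (coef_space I)" and C1: "0 < C1"
    and p0: "p \<beta>0 \<ge> real n powr (card I / 2) * real n powr (- C1 * card I)"
    and flat: "lack_of_flatness I \<beta>0 n p (1 / sqrt (real n)) \<le> 1/2"
    and y: "L2_set (\<lambda>i. y i - \<beta>0 i) I \<le> 3 * sqrt (card I * ln n) / sqrt n"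
    and S: "S \<in> sets (coef_space I)"
  shows "\<bar>measure (posterior I p n y) S - measure (gauss_prod I (1 / sqrt n) y) S\<bar>
    \<le> lack_of_flatness I \<beta>0 n p ((C1 + 10) * sqrt (card I * ln n)) + 2 * real n powr (- real (card I))"
proof -
  let ?d = "real (card I)" and ?q = "unnormalized_posterior I p n y" and ?L = "sqrt (card I * ln n)"
  define D where "D = (LINT b|coef_space I. ?q b)"
  let ?s = "1 / sqrt (real n)"
  let ?P = "posterior I p n y" and ?G = "gauss_prod I ?s y"
  have n0: "0 < real n" and ln0: "0 \<le> ln (real n)" and d0: "0 < ?d" using n d by auto
  have L0: "0 \<le> ?L" using ln0 by simp
  have pn: "\<And>\<beta>. \<beta> \<in> space (coef_space I) \<Longrightarrow> 0 \<le> p \<beta>" using p by (simp add: prior_density_def)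
  have [measurable]: "p \<in> borel_measurable (coef_space I)" using p by (simp add: prior_density_def)
  have p0': "0 < p \<beta>0" using p0 n0 by (intro less_le_trans[OF _ p0]) simp
  have Dl: "real n powr (- (C1 + 10) * ?d) \<le> D"
    unfolding D_def by (rule evidence_lower_bound[OF I d n p \<beta>0 p0 flat y])
  have D0: "0 < D" using n0 by (intro less_le_trans[OF _ Dl]) simp
  obtain K where K: "0 < K" "?P = density ?G (\<lambda>\<beta>. ennreal (p \<beta> / K))"
    using posterior_eq_density_gauss[OF I _ p D0[unfolded D_def]] n by auto
  have qm[measurable]: "?q \<in> borel_measurable (coef_space I)"
    using integrable_unnormalized_posterior[OF p] by auto
  have q0: "0 \<le> ?q \<beta>" if "\<beta> \<in> space (coef_space I)" for \<beta> using pn[OF that] by (simp add: unnormalized_posterior_def)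
  have Ps: "sets ?P = sets (coef_space I)" "space ?P = space (coef_space I)" by (auto simp: posterior_def)
  have eP: "emeasure ?P X = (\<integral>\<^sup>+\<beta>. ennreal (?q \<beta> / D) * indicator X \<beta> \<partial>coef_space I)" if "X \<in> sets (coef_space I)" for X
    unfolding posterior_def D_def[symmetric] using that by (intro emeasure_density) auto
  have "prob_space ?P"
  proof
    have "emeasure ?P (space ?P) = (\<integral>\<^sup>+\<beta>. ennreal (?q \<beta> / D) \<partial>coef_space I)"
      by (subst eP) (auto simp: Ps intro!: nn_integral_cong)
    also have "\<dots> = ennreal (\<integral>\<beta>. ?q \<beta> / D \<partial>coef_space I)"
      using q0 D0 by (intro nn_integral_eq_integral integrable_divide integrable_unnormalized_posterior[OF p] AE_I2) auto
    also have "(\<integral>\<beta>. ?q \<beta> / D \<partial>coef_space I) = 1"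
      using D0 by (simp add: D_def)
    finally show "emeasure ?P (space ?P) = 1" by simp
  qed
  then interpret P: prob_space ?P .
  have s0: "0 < ?s" using n0 by simp
  interpret G: prob_space ?G by (rule prob_space_gauss_prod[OF s0])
  define c1 where "c1 = C1 + 10"
  let ?B = "coef_ball I \<beta>0 n (c1 * ?L)"
  \<comment> \<open>The data are within \<open>3\<close> units of the truth, so outside the ball they are \<open>c1 - 3\<close> units away.\<close>
  have far: "(c1 - 3) * ?L * ?s < L2_set (\<lambda>i. \<beta> i - y i) I" if "\<beta> \<in> space (coef_space I) - ?B" for \<beta>
  proof -
    have "c1 * ?L / sqrt n < L2_set (\<lambda>i. \<beta> i - \<beta>0 i) I" using that by (auto simp: coef_ball_iff)
    also have "\<dots> \<le> L2_set (\<lambda>i. \<beta> i - y i) I + L2_set (\<lambda>i. y i - \<beta>0 i) I" by (rule L2_set_triangle_diff)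
    finally show ?thesis using y by (simp add: algebra_simps diff_divide_distrib)
  qed
  have GB: "G.prob (space (coef_space I) - ?B) \<le> real n powr (- ?d)"
  proof -
    have "G.prob (space (coef_space I) - ?B) \<le>
      G.prob {x \<in> space (coef_space I). 3 * ?L * ?s < L2_set (\<lambda>i. x i - y i) I}"
    proof (intro G.finite_measure_mono subsetI)
      fix \<beta> assume b: "\<beta> \<in> space (coef_space I) - ?B"
      have "3 * ?L * ?s \<le> (c1 - 3) * ?L * ?s" using L0 s0 C1 by (intro mult_right_mono) (auto simp: c1_def)
      then show "\<beta> \<in> {x \<in> space (coef_space I). 3 * ?L * ?s < L2_set (\<lambda>i. x i - y i) I}"
        using far[OF b] b by auto
    next
      show "{x \<in> space (coef_space I). 3 * ?L * ?s < L2_set (\<lambda>i. x i - y i) I} \<in> sets ?G"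
        unfolding sets_gauss_prod L2_set_def by measurable
    qed
    also have "\<dots> \<le> real n powr (- ?d)" by (rule gauss_prod_norm_tail_log[OF I s0 n])
    finally show ?thesis .
  qed
  have PB: "P.prob (space (coef_space I) - ?B) \<le> real n powr (- ?d)"
  proof -
    let ?X = "space (coef_space I) - ?B"
    let ?e = "real n powr (- ((c1 - 3)\<^sup>2 / 2) * ?d)"
    have "emeasure ?P ?X = (\<integral>\<^sup>+\<beta>. ennreal (?q \<beta> / D) * indicator ?X \<beta> \<partial>coef_space I)"
      by (rule eP) auto
    also have "\<dots> \<le> (\<integral>\<^sup>+\<beta>. ennreal (?e / D) * ennreal (p \<beta>) \<partial>coef_space I)"
    proof (rule nn_integral_mono)
      fix \<beta> assume b: "\<beta> \<in> space (coef_space I)"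
      have "?q \<beta> \<le> ?e * p \<beta>" if bX: "\<beta> \<in> ?X"
      proof -
        have "(c1 - 3)\<^sup>2 / 2 * ?d * ln n = n / 2 * ((c1 - 3) * ?L * ?s)\<^sup>2"
          using ln0 n0 by (simp add: power_mult_distrib power_divide)
        also have "\<dots> \<le> n / 2 * (L2_set (\<lambda>i. \<beta> i - y i) I)\<^sup>2"
          using far[OF bX] L0 s0 C1 by (intro mult_left_mono power_mono) (auto simp: c1_def)
        also have "(L2_set (\<lambda>i. \<beta> i - y i) I)\<^sup>2 = (\<Sum>i\<in>I. (y i - \<beta> i)\<^sup>2)"
          by (simp add: L2_set_power2 power2_commute)
        finally have "exp (- (real n / 2) * (\<Sum>i\<in>I. (y i - \<beta> i)\<^sup>2)) \<le> exp (- ((c1 - 3)\<^sup>2 / 2) * ?d * ln n)" by simp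
        also have "\<dots> = ?e" using n0 by (simp add: powr_def)
        finally show ?thesis unfolding unnormalized_posterior_def using pn[OF b]
          by (simp add: mult_left_mono mult.commute)
      qed
      then have "?q \<beta> / D * indicator ?X \<beta> \<le> ?e / D * p \<beta>"
        using D0 pn[OF b] by (auto simp: indicator_def divide_right_mono)
      then show "ennreal (?q \<beta> / D) * indicator ?X \<beta> \<le> ennreal (?e / D) * ennreal (p \<beta>)"
        using D0 pn[OF b] q0[OF b] by (auto simp: ennreal_mult'[symmetric] ennreal_indicator[symmetric] intro!: ennreal_leI)
    qed
    also have "\<dots> = ennreal (?e / D)"
      using p by (subst nn_integral_cmult) (auto simp: prior_density_def)
    finally have "P.prob ?X \<le> ?e / D" using D0 by (simp add: P.emeasure_eq_measure)
    also have "\<dots> \<le> ?e / real n powr (- (C1 + 10) * ?d)"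
      using Dl n0 D0 by (intro divide_left_mono mult_pos_pos) auto
    also have "\<dots> = real n powr ((- ((c1 - 3)\<^sup>2 / 2) + (C1 + 10)) * ?d)"
      by (simp add: powr_diff[symmetric] algebra_simps)
    also have "\<dots> \<le> real n powr (- 1 * ?d)"
    proof (intro powr_mono mult_right_mono)
      \<comment> \<open>The constant \<open>c1\<close> is chosen so that \<open>(c1 - 3)\<^sup>2 / 2 \<ge> C1 + 11\<close>.\<close>
      show "- ((c1 - 3)\<^sup>2 / 2) + (C1 + 10) \<le> - 1"
        using C1 zero_le_power2[of C1] by (simp add: c1_def power2_eq_square algebra_simps)
    qed (use n in auto)
    finally show ?thesis by simp
  qed
  let ?\<kappa> = "lack_of_flatness I \<beta>0 n p (c1 * ?L)"
  have R0: "0 \<le> c1 * ?L" using C1 L0 by (simp add: c1_def)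
  have "\<bar>P.prob S - G.prob S\<bar> \<le> ?\<kappa> + P.prob (space ?G - ?B) + G.prob (space ?G - ?B)"
    unfolding K(2)
  proof (rule total_variation_of_flat)
    show "prob_space ?G" by (rule G.prob_space_axioms)
    show "prob_space (density ?G (\<lambda>\<beta>. ennreal (p \<beta> / K)))" unfolding K(2)[symmetric] by (rule P.prob_space_axioms)
    show "(\<lambda>\<beta>. p \<beta> / K) \<in> borel_measurable ?G" by measurable
    show "0 \<le> p \<beta> / K" if "\<beta> \<in> space ?G" for \<beta> using that pn K(1) by (simp add: space_gauss_prod)
    show "0 \<le> ?\<kappa>" "?\<kappa> \<le> 1" by (rule flatness_bounds[of I p \<beta>0, OF pn p0' \<beta>0 R0]; simp)+
    show "?B \<in> sets ?G" "S \<in> sets ?G" using S by (auto simp: sets_gauss_prod)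
    show "(1 - ?\<kappa>) * (p \<beta> / K) \<le> p \<beta>' / K" if "\<beta> \<in> ?B" "\<beta>' \<in> ?B" for \<beta> \<beta>'
      using divide_right_mono[OF flatness_ratio[of I p, OF pn that], of K] K(1) by simp
  qed
  then show ?thesis using PB GB by (simp add: c1_def space_gauss_prod)
qed

section \<open>Law of the data and quantiles of the band radius\<close>

text \<open>White noise maps the wavelets to independent standard normal variables. Independence is given for
  the family indexed by the wavelets as functions and has to be transported along the injective
  map from indices to wavelets.\<close>

lemma data_law:
  assumes wn: "white_noise M W" and I: "finite I" "I \<noteq> {}" and n: "0 < n"
    and L2: "\<And>l k. (l, k) \<in> I \<Longrightarrow> \<psi> l k \<in> L2"
    and on: "\<And>l k l' k'. (l, k) \<in> I \<Longrightarrow> (l', k') \<in> I \<Longrightarrow>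
        l2_inner (\<psi> l k) (\<psi> l' k') = (if (l, k) = (l', k') then 1 else 0)"
  shows "distr M (coef_space I) (data I \<psi> f0 n W) = gauss_prod I (1 / sqrt n) (coefs I \<psi> f0)"
    and "data I \<psi> f0 n W \<in> measurable M (coef_space I)"
proof -
  interpret M: prob_space M using wn by (simp add: white_noise_def)
  let ?f = "\<lambda>(l, k). \<psi> l k"
  let ?E = "?f ` I"
  have E: "?E \<subseteq> L2" using L2 by auto
  have inj: "inj_on ?f I"
  proof (rule inj_onI)
    fix a b assume ab: "a \<in> I" "b \<in> I" "?f a = ?f b"
    then have "l2_inner (?f a) (?f b) = l2_inner (?f a) (?f a)" by simp
    then show "a = b" using ab(1,2) on[of "fst a" "snd a" "fst b" "snd b"] on[of "fst a" "snd a" "fst a" "snd a"]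
      by (simp add: case_prod_beta split: if_splits)
  qed
  have Eon: "l2_inner e e' = (if e = e' then 1 else 0)" if "e \<in> ?E" "e' \<in> ?E" for e e'
  proof -
    obtain i j where ij: "i \<in> I" "j \<in> I" "e = ?f i" "e' = ?f j" using \<open>e \<in> ?E\<close> \<open>e' \<in> ?E\<close> by blast
    have "l2_inner (?f i) (?f j) = (if i = j then 1 else 0)"
      using on[of "fst i" "snd i" "fst j" "snd j"] ij by (simp add: case_prod_beta)
    then show ?thesis using inj_on_eq_iff[OF inj ij(1,2)] ij(3,4) by simp
  qed
  have ind: "M.indep_vars (\<lambda>_. borel) W ?E" and dist: "\<And>e. e \<in> ?E \<Longrightarrow> distributed M lborel (W e) std_normal_density"
  proof -
    have "\<forall>E\<subseteq>L2. (\<forall>e\<in>E. \<forall>e'\<in>E. l2_inner e e' = (if e = e' then 1 else 0)) \<longrightarrow>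
        M.indep_vars (\<lambda>_. borel) W E \<and> (\<forall>e\<in>E. distributed M lborel (W e) std_normal_density)"
      using wn unfolding white_noise_def by (elim conjE)
    then have "M.indep_vars (\<lambda>_. borel) W ?E \<and> (\<forall>e\<in>?E. distributed M lborel (W e) std_normal_density)"
      using E Eon by (metis (no_types, lifting))
    then show "M.indep_vars (\<lambda>_. borel) W ?E" "\<And>e. e \<in> ?E \<Longrightarrow> distributed M lborel (W e) std_normal_density"
      by (rule conjunct1, rule bspec[OF conjunct2])
  qed
  have "\<forall>g\<in>L2. W g \<in> borel_measurable M" using wn unfolding white_noise_def by (elim conjE)
  then have Wm: "W e \<in> borel_measurable M" if "e \<in> ?E" for e using E that by blast
  have Ene: "?E \<noteq> {}" using I by simp
  have 1: "distr M (Pi\<^sub>M ?E (\<lambda>_. borel)) (\<lambda>\<omega>. \<lambda>e\<in>?E. W e \<omega>) = Pi\<^sub>M ?E (\<lambda>e. distr M borel (W e))"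
    using M.indep_vars_iff_distr_eq_PiM'[where M'="\<lambda>_. borel" and X=W, OF Ene] ind Wm by simp
  have mE: "(\<lambda>\<omega>. \<lambda>e\<in>?E. W e \<omega>) \<in> measurable M (Pi\<^sub>M ?E (\<lambda>_. borel))"
    by (intro measurable_restrict Wm)
  have mR: "(\<lambda>z. \<lambda>i\<in>I. z (?f i)) \<in> measurable (Pi\<^sub>M ?E (\<lambda>_. borel)) (Pi\<^sub>M I (\<lambda>_. borel :: real measure))"
    by (intro measurable_restrict measurable_component_singleton) auto
  have "distr M (Pi\<^sub>M I (\<lambda>_. borel)) (\<lambda>\<omega>. \<lambda>i\<in>I. W (?f i) \<omega>)
     = distr (distr M (Pi\<^sub>M ?E (\<lambda>_. borel)) (\<lambda>\<omega>. \<lambda>e\<in>?E. W e \<omega>)) (Pi\<^sub>M I (\<lambda>_. borel)) (\<lambda>z. \<lambda>i\<in>I. z (?f i))"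
    unfolding distr_distr[OF mR mE] by (intro distr_cong refl) (auto simp: fun_eq_iff)
  also have "\<dots> = distr (Pi\<^sub>M ?E (\<lambda>e. distr M borel (W e))) (Pi\<^sub>M I (\<lambda>i. distr M borel (W (?f i)))) (\<lambda>z. \<lambda>i\<in>I. z (?f i))"
    unfolding 1 by (intro distr_cong sets_PiM_cong refl) auto
  also have "\<dots> = Pi\<^sub>M I (\<lambda>i. distr M borel (W (?f i)))"
    using Wm by (intro distr_PiM_reindex inj M.prob_space_distr) auto
  finally have "M.indep_vars (\<lambda>_. borel) (\<lambda>i. W (?f i)) I"
    using M.indep_vars_iff_distr_eq_PiM'[where M'="\<lambda>_. borel" and X="\<lambda>i. W (?f i)", OF I(2)] Wm by simp
  then have "M.indep_vars (\<lambda>_. lborel) (\<lambda>i \<omega>. l2_inner f0 (?f i) + W (?f i) \<omega> / sqrt n) I"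
    by (rule M.indep_vars_compose2[where Y="\<lambda>i x. l2_inner f0 (?f i) + x / sqrt n"]) auto
  then have "distr M (coef_space I) (\<lambda>\<omega>. \<lambda>i\<in>I. l2_inner f0 (?f i) + W (?f i) \<omega> / sqrt n)
     = Pi\<^sub>M I (\<lambda>i. distr M lborel (\<lambda>\<omega>. l2_inner f0 (?f i) + W (?f i) \<omega> / sqrt n))"
    using M.indep_vars_iff_distr_eq_PiM'[where M'="\<lambda>_. lborel" and X="\<lambda>i \<omega>. l2_inner f0 (?f i) + W (?f i) \<omega> / sqrt n", OF I(2)] Wm by auto
  also have "\<dots> = gauss_prod I (1 / sqrt n) (coefs I \<psi> f0)"
    unfolding gauss_prod_def
  proof (intro PiM_cong refl)
    fix i assume i: "i \<in> I"
    have "distributed M lborel (\<lambda>\<omega>. l2_inner f0 (?f i) + (1 / sqrt n) * W (?f i) \<omega>)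
       (normal_density (l2_inner f0 (?f i) + (1 / sqrt n) * 0) (\<bar>1 / sqrt n\<bar> * 1))"
      using n i by (intro M.normal_density_affine dist) auto
    then show "distr M lborel (\<lambda>\<omega>. l2_inner f0 (?f i) + W (?f i) \<omega> / sqrt n) =
        density lborel (normal_density (coefs I \<psi> f0 i) (1 / sqrt n))"
      using i by (auto simp: distributed_def coefs_def split: prod.splits)
  qed
  also have "(\<lambda>\<omega>. \<lambda>i\<in>I. l2_inner f0 (?f i) + W (?f i) \<omega> / sqrt n) = data I \<psi> f0 n W"
    by (auto simp: data_def observation_def fun_eq_iff restrict_def)
  finally show "distr M (coef_space I) (data I \<psi> f0 n W) = gauss_prod I (1 / sqrt n) (coefs I \<psi> f0)" .
  have "(\<lambda>\<omega>. \<lambda>i\<in>I. l2_inner f0 (?f i) + W (?f i) \<omega> / sqrt n) \<in> measurable M (coef_space I)"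
    using Wm by (intro measurable_restrict) auto
  also have "(\<lambda>\<omega>. \<lambda>i\<in>I. l2_inner f0 (?f i) + W (?f i) \<omega> / sqrt n) = data I \<psi> f0 n W"
    by (auto simp: data_def observation_def fun_eq_iff restrict_def)
  finally show "data I \<psi> f0 n W \<in> measurable M (coef_space I)" .
qed

text \<open>The Gaussian mass of the weighted sup-norm ball of radius \<open>t\<close>, see \<open>gauss_prod_box\<close>.\<close>

definition band_prob :: "'i set \<Rightarrow> ('i \<Rightarrow> real) \<Rightarrow> real \<Rightarrow> real \<Rightarrow> real" where
  "band_prob I v \<sigma> t = (\<Prod>i\<in>I. central_prob (t * v i / \<sigma>))"

text \<open>Strict monotonicity and the next lemma make \<open>band_prob\<close> a continuous distribution function whose
  quantiles are exact and unique.\<close>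

lemma band_prob_strict_mono:
  assumes I: "finite I" "I \<noteq> {}" and s: "0 < \<sigma>" and v: "\<And>i. i \<in> I \<Longrightarrow> 0 < v i"
    and st: "0 \<le> r" "r < t"
  shows "band_prob I v \<sigma> r < band_prob I v \<sigma> t"
proof -
  have lt: "central_prob (r * v i / \<sigma>) < central_prob (t * v i / \<sigma>)" if i: "i \<in> I" for i
    using s v[OF i] st by (intro central_prob_strict_mono divide_strict_right_mono mult_strict_right_mono) auto
  obtain j where j: "j \<in> I" using I by blast
  show ?thesis
    unfolding band_prob_def
    using I(1) j lt central_prob_nonneg
    by (intro prod_mono_strict[of j]) (auto intro: less_imp_le le_less_trans)
qed

lemma band_prob_surj:
  assumes I: "finite I" "I \<noteq> {}" and s: "0 < \<sigma>" and v: "\<And>i. i \<in> I \<Longrightarrow> 0 < v i"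
    and q: "0 < q" "q < 1"
  shows "\<exists>t\<ge>0. band_prob I v \<sigma> t = q"
proof -
  have "((\<lambda>t. band_prob I v \<sigma> t) \<longlongrightarrow> (\<Prod>i\<in>I. 1)) at_top"
    unfolding band_prob_def
  proof (rule tendsto_prod)
    fix i assume "i \<in> I"
    then have "filterlim (\<lambda>t. v i / \<sigma> * t) at_top at_top"
      using s v by (intro filterlim_tendsto_pos_mult_at_top[OF tendsto_const _ filterlim_ident]) auto
    then have "filterlim (\<lambda>t. t * v i / \<sigma>) at_top at_top" by (simp add: mult.commute)
    then show "((\<lambda>t. central_prob (t * v i / \<sigma>)) \<longlongrightarrow> 1) at_top"
      by (rule filterlim_compose[OF central_prob_tendsto])
  qed
  then have "eventually (\<lambda>t. q < band_prob I v \<sigma> t) at_top" using q by (auto dest: order_tendstoD)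
  then have "\<exists>N. \<forall>t\<ge>N. q < band_prob I v \<sigma> t" unfolding eventually_at_top_linorder .
  then obtain N where N: "\<forall>t\<ge>N. q < band_prob I v \<sigma> t" ..
  define T where "T = max N 0"
  have T: "0 \<le> T" "q < band_prob I v \<sigma> T" using N by (simp_all add: T_def)
  have "continuous_on {0..T} (\<lambda>t. central_prob (t * v i / \<sigma>))" if i: "i \<in> I" for i
  proof (rule continuous_on_compose2[OF continuous_on_central_prob])
    show "continuous_on {0..T} (\<lambda>t. t * v i / \<sigma>)" using s by (intro continuous_intros) auto
    show "(\<lambda>t. t * v i / \<sigma>) ` {0..T} \<subseteq> {0..}" using s v[OF i] by auto
  qed
  then have "continuous_on {0..T} (band_prob I v \<sigma>)"
    unfolding band_prob_def by (intro continuous_on_prod)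
  moreover have "band_prob I v \<sigma> 0 = 0" using I by (auto simp: band_prob_def central_prob_0 prod_zero_iff)
  ultimately have "\<exists>t. 0 \<le> t \<and> t \<le> T \<and> band_prob I v \<sigma> t = q"
    using T q by (intro IVT') auto
  then show ?thesis by blast
qed

text \<open>If \<open>F (R \<omega>)\<close> is within \<open>\<delta>\<close> of \<open>c\<close>, then \<open>R \<omega>\<close> lies between the quantiles of order
  \<open>c - \<delta>\<close> and \<open>c + \<delta>\<close>. On \<open>A\<close> the event with the random radius is thus squeezed between two events
  with deterministic radii, whatever the dependence between the radius and the event.\<close>

lemma coverage_of_random_radius:
  fixes R :: "'a \<Rightarrow> real" and F :: "real \<Rightarrow> real"
  assumes M: "prob_space M"
    and mono: "\<And>\<omega> s t. Q \<omega> s \<Longrightarrow> s \<le> t \<Longrightarrow> Q \<omega> t"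
    and Qm: "\<And>t. {\<omega> \<in> space M. Q \<omega> t} \<in> sets M" and QR: "{\<omega> \<in> space M. Q \<omega> (R \<omega>)} \<in> sets M"
    and F: "\<And>t. measure M {\<omega> \<in> space M. Q \<omega> t} = F t"
    and inc: "\<And>r t. 0 \<le> r \<Longrightarrow> r < t \<Longrightarrow> F r < F t"
    and surj: "\<And>q. 0 < q \<Longrightarrow> q < 1 \<Longrightarrow> \<exists>t\<ge>0. F t = q"
    and A: "A \<in> sets M" "\<And>\<omega>. \<omega> \<in> A \<Longrightarrow> 0 \<le> R \<omega> \<and> \<bar>F (R \<omega>) - c\<bar> \<le> \<delta>"
    and c: "0 < c" "c < 1" and \<delta>: "0 \<le> \<delta>"
  shows "\<bar>measure M {\<omega> \<in> space M. Q \<omega> (R \<omega>)} - c\<bar> \<le> \<delta> + measure M (space M - A)"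
proof -
  interpret prob_space M by fact
  let ?E = "{\<omega> \<in> space M. Q \<omega> (R \<omega>)}"
  have "prob ?E \<le> c + \<delta> + prob (space M - A)"
  proof (cases "c + \<delta> < 1")
    case True
    obtain t where t: "0 \<le> t" "F t = c + \<delta>" using surj[of "c + \<delta>"] c \<delta> True by auto
    have "?E \<subseteq> {\<omega> \<in> space M. Q \<omega> t} \<union> (space M - A)"
    proof
      fix \<omega> assume w: "\<omega> \<in> ?E"
      show "\<omega> \<in> {\<omega> \<in> space M. Q \<omega> t} \<union> (space M - A)"
      proof (cases "\<omega> \<in> A")
        case True
        then have "\<not> F t < F (R \<omega>)" using A(2)[of \<omega>] t by auto
        then have "R \<omega> \<le> t" using inc[of t "R \<omega>"] t(1) by (meson not_le)
        then show ?thesis using w mono by blast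
      qed (use w in auto)
    qed
    then have "prob ?E \<le> prob ({\<omega> \<in> space M. Q \<omega> t} \<union> (space M - A))"
      using Qm A by (intro finite_measure_mono) auto
    also have "\<dots> \<le> prob {\<omega> \<in> space M. Q \<omega> t} + prob (space M - A)"
      using Qm A by (intro measure_Un_le) auto
    finally show ?thesis using F t by simp
  next
    case False
    then show ?thesis using prob_le_1[of ?E] measure_nonneg[of M "space M - A"] by linarith
  qed
  moreover have "c - \<delta> \<le> prob ?E + prob (space M - A)"
  proof (cases "0 < c - \<delta>")
    case True
    obtain t where t: "0 \<le> t" "F t = c - \<delta>" using surj[of "c - \<delta>"] c \<delta> True by auto
    have "{\<omega> \<in> space M. Q \<omega> t} \<subseteq> ?E \<union> (space M - A)"
    proof
      fix \<omega> assume w: "\<omega> \<in> {\<omega> \<in> space M. Q \<omega> t}"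
      show "\<omega> \<in> ?E \<union> (space M - A)"
      proof (cases "\<omega> \<in> A")
        case True
        then have "0 \<le> R \<omega>" "\<not> F (R \<omega>) < F t" using A(2)[of \<omega>] t by auto
        then have "t \<le> R \<omega>" using inc[of "R \<omega>" t] by (meson not_le)
        then show ?thesis using w mono by blast
      qed (use w in auto)
    qed
    then have "prob {\<omega> \<in> space M. Q \<omega> t} \<le> prob (?E \<union> (space M - A))"
      using QR A by (intro finite_measure_mono) auto
    also have "\<dots> \<le> prob ?E + prob (space M - A)"
      using QR A by (intro measure_Un_le) auto
    finally show ?thesis using F t by simp
  next
    case False
    then show ?thesis using measure_nonneg[of M ?E] measure_nonneg[of M "space M - A"] by linarith
  qed
  ultimately show ?thesis by (simp add: abs_le_iff)
qed

lemma one_minus_sum_le_prod: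
  fixes a :: "'a \<Rightarrow> real"
  assumes "\<And>i. i \<in> A \<Longrightarrow> 0 \<le> a i \<and> a i \<le> 1"
  shows "1 - (\<Sum>i\<in>A. 1 - a i) \<le> (\<Prod>i\<in>A. a i)"
  using assms
proof (induction A rule: infinite_finite_induct)
  case (insert x A)
  let ?S = "\<Sum>i\<in>A. 1 - a i"
  have "0 \<le> (1 - a x) * ?S" using insert.prems by (intro mult_nonneg_nonneg sum_nonneg) auto
  then have "1 - ((1 - a x) + ?S) \<le> a x * (1 - ?S)" by (simp add: algebra_simps)
  also have "\<dots> \<le> a x * (\<Prod>i\<in>A. a i)" using insert by (intro mult_left_mono) auto
  finally show ?case using insert by simp
qed auto

text \<open>Since \<open>w l \<ge> sqrt l\<close>, the probability that some weighted coordinate is large is at most the sum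
  over levels of \<open>2 ^ l\<close> times a tail that decays geometrically in \<open>l\<close>. The constant \<open>4 ln (24 / \<alpha>)\<close>
  makes the ratio of that geometric series \<open>\<alpha> / 12\<close>, hence its sum at most \<open>\<alpha> / 2\<close>.\<close>

lemma band_prob_lower:
  assumes \<alpha>: "0 < \<alpha>" "\<alpha> < 1" and J: "2 \<le> J0" "J0 \<le> J"
    and w: "\<And>l. J0 - 1 \<le> l \<Longrightarrow> sqrt (real l) \<le> w l" and s: "0 < \<sigma>"
  shows "1 - \<alpha> / 2 \<le> band_prob (sieve_index J0 J) (\<lambda>i. w (fst i)) \<sigma> (sqrt (4 * ln (24 / \<alpha>)) * \<sigma>)"
proof -
  let ?I = "sieve_index J0 J" and ?C = "sqrt (4 * ln (24 / \<alpha>))"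
  have J01: "1 \<le> J0" using J by simp
  have ln0: "0 \<le> ln (24 / \<alpha>)" using \<alpha> by (intro ln_ge_zero) (simp add: field_simps)
  have C2: "?C\<^sup>2 / 4 = ln (24 / \<alpha>)" using ln0 by simp
  define \<rho> where "\<rho> = \<alpha> / 12"
  have \<rho>: "0 < \<rho>" "\<rho> < 1/12" using \<alpha> by (auto simp: \<rho>_def)
  let ?a = "\<lambda>i. 1 - central_prob (?C * \<sigma> * w (fst i) / \<sigma>)"
  have a: "?a (l, k) \<le> sqrt 2 * (\<alpha> / 24) ^ l" if l: "J0 - 1 \<le> l" for l k
  proof -
    have "?a (l, k) = 1 - central_prob (?C * w l)" using s by simp
    also have "\<dots> \<le> sqrt 2 * exp (- (?C * w l)\<^sup>2 / 4)"
      using ln0 w[OF l] by (intro central_prob_tail mult_nonneg_nonneg) (auto intro: order_trans[OF _ w[OF l]])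
    also have "- (?C * w l)\<^sup>2 / 4 = - ((?C\<^sup>2 / 4) * (w l)\<^sup>2)" by (simp add: power_mult_distrib)
    also have "\<dots> \<le> - ((?C\<^sup>2 / 4) * real l)"
    proof -
      have "real l \<le> (w l)\<^sup>2" using w[OF l] by (simp add: sqrt_le_D)
      then show ?thesis by (intro le_imp_neg_le mult_left_mono) auto
    qed
    also have "exp (- ((?C\<^sup>2 / 4) * real l)) = exp (- ln (24 / \<alpha>)) ^ l"
      unfolding C2 by (simp add: exp_of_nat_mult[symmetric] mult.commute)
    also have "exp (- ln (24 / \<alpha>)) = \<alpha> / 24" using \<alpha> by (simp add: exp_minus)
    finally show ?thesis by simp
  qed
  have "(\<Sum>i\<in>?I. ?a i) = (\<Sum>l\<in>{J0 - 1..<J}. \<Sum>k<level_size J0 l. ?a (l, k))"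
    unfolding sieve_index_eq[OF J01 J(2)] by (subst sum.Sigma) (auto simp: case_prod_beta)
  also have "\<dots> \<le> (\<Sum>l\<in>{J0 - 1..<J}. \<Sum>k<level_size J0 l. sqrt 2 * (\<alpha> / 24) ^ l)"
    using a by (intro sum_mono) auto
  also have "\<dots> \<le> (\<Sum>l\<in>{J0 - 1..<J}. 3 * \<rho> ^ l)"
  proof (intro sum_mono)
    fix l assume "l \<in> {J0 - 1..<J}"
    then have ls: "level_size J0 l \<le> 2 * 2 ^ l"
      by (cases "J0 = Suc l") (auto simp: level_size_def)
    have "(\<Sum>k<level_size J0 l. sqrt 2 * (\<alpha> / 24) ^ l) = real (level_size J0 l) * (sqrt 2 * (\<alpha> / 24) ^ l)" by simp
    also have "\<dots> \<le> (2 * 2 ^ l) * ((3/2) * (\<alpha> / 24) ^ l)"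
    proof (intro mult_mono)
      show "real (level_size J0 l) \<le> 2 * 2 ^ l" using ls by (simp flip: of_nat_le_iff[where 'a=real])
      show "sqrt 2 \<le> 3/2" by (rule real_le_lsqrt) (auto simp: power2_eq_square)
    qed (use \<alpha> in auto)
    also have "\<dots> = 3 * (2 * (\<alpha> / 24)) ^ l" by (simp only: power_mult_distrib)
    finally show "(\<Sum>k<level_size J0 l. sqrt 2 * (\<alpha> / 24) ^ l) \<le> 3 * \<rho> ^ l" by (simp add: \<rho>_def)
  qed
  also have "\<dots> \<le> (\<Sum>l\<in>{Suc 0..<J}. 3 * \<rho> ^ l)"
    using J \<rho> by (intro sum_mono2) auto
  also have "\<dots> = 3 * (\<Sum>l<J - 1. \<rho> * \<rho> ^ l)"
  proof -
    obtain J' where "J = Suc J'" using J by (cases J) auto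
    then show ?thesis
      by (simp only: sum.shift_bounds_Suc_ivl diff_Suc_1 lessThan_atLeast0 sum_distrib_left power_Suc)
  qed
  also have "\<dots> \<le> 3 * (\<rho> * 2)"
  proof -
    have "(\<Sum>l<J - 1. \<rho> ^ l) = (1 - \<rho> ^ (J - 1)) / (1 - \<rho>)" using \<rho> by (simp add: sum_gp_strict)
    also have "\<dots> \<le> 1 / (1 - \<rho>)" using \<rho> by (intro divide_right_mono) auto
    also have "\<dots> \<le> 2" using \<rho> by (simp add: field_simps)
    finally show ?thesis using \<rho> by (simp add: sum_distrib_left[symmetric])
  qed
  also have "\<dots> = \<alpha> / 2" by (simp add: \<rho>_def)
  finally have S: "(\<Sum>i\<in>?I. ?a i) \<le> \<alpha> / 2" .
  have "1 - (\<Sum>i\<in>?I. ?a i) \<le> (\<Prod>i\<in>?I. central_prob (?C * \<sigma> * w (fst i) / \<sigma>))"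
    by (rule one_minus_sum_le_prod) (auto simp: central_prob_nonneg central_prob_le_1)
  then show ?thesis using S by (simp add: band_prob_def)
qed

text \<open>The maximum of \<open>2 ^ J\<close> independent standard normal variables exceeds \<open>sqrt J / 2\<close> with probability tending
  to one: the tail of one variable beyond that point is at least of order \<open>exp (- J / 4)\<close>, which \<open>2 ^ J\<close> outweighs.\<close>

lemma central_prob_power_small:
  assumes "0 < \<gamma>"
  shows "eventually (\<lambda>J. central_prob (sqrt (real J) / 2) ^ (2 ^ J) \<le> \<gamma>) sequentially"
proof -
  obtain N where N: "- ln \<gamma> * (3 * exp 1) < (3/2::real) ^ N" using real_arch_pow[of "3/2"] by auto
  have "- ln \<gamma> * (3 * exp 1) \<le> (3/2::real) ^ J" if "N \<le> J" for J
    using N power_increasing[OF that, of "3/2::real"] by linarith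
  then have "eventually (\<lambda>J. - ln \<gamma> * (3 * exp 1) \<le> (3/2::real) ^ J) sequentially"
    by (rule eventually_sequentiallyI)
  then show ?thesis
  proof eventually_elim
    case (elim J)
    let ?x = "sqrt (real J) / 2"
    let ?p = "std_normal_density (?x + 1)"
    have x0: "0 \<le> ?x" by simp
    have c1: "central_prob ?x \<le> 1 - ?p"
      using central_prob_step[OF x0, of "?x + 1"] central_prob_le_1[of "?x + 1"] by simp
    have "exp (- real J / 4 - 1) / 3 \<le> ?p"
    proof -
      have "sqrt (2 * pi) \<le> 3" using pi_less_4 pi_approx by (intro real_le_lsqrt) auto
      then have "1 / 3 \<le> 1 / sqrt (2 * pi)" by (intro divide_left_mono) auto
      moreover have "(?x + 1)\<^sup>2 / 2 \<le> real J / 4 + 1"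
        using zero_le_power2[of "?x - 1"] by (simp add: power2_sum power2_diff power_divide)
      then have "exp (- real J / 4 - 1) \<le> exp (- (?x + 1)\<^sup>2 / 2)" by simp
      ultimately have "1/3 * exp (- real J / 4 - 1) \<le> 1 / sqrt (2 * pi) * exp (- (?x + 1)\<^sup>2 / 2)"
        by (intro mult_mono) auto
      then show ?thesis by (simp add: std_normal_density_def)
    qed
    moreover have "(3/2) ^ J / (3 * exp 1) \<le> 2 ^ J * (exp (- real J / 4 - 1) / 3)"
    proof -
      have "(3/4::real) \<le> exp (-1/4)" using exp_ge_add_one_self[of "-1/4"] by simp
      then have "(3/4::real) ^ J \<le> exp (-1/4) ^ J" by (intro power_mono) auto
      also have "\<dots> = exp (- real J / 4)" by (simp add: exp_of_nat_mult[symmetric])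
      finally have "2 ^ J * (3/4::real) ^ J \<le> 2 ^ J * exp (- real J / 4)" by simp
      then have "(3/2::real) ^ J \<le> 2 ^ J * exp (- real J / 4)" by (simp add: power_mult_distrib[symmetric])
      then have "(3/2) ^ J / (3 * exp 1) \<le> 2 ^ J * exp (- real J / 4) / (3 * exp 1)"
        by (intro divide_right_mono) auto
      then show ?thesis by (simp add: exp_diff mult.commute)
    qed
    ultimately have Np: "- ln \<gamma> \<le> 2 ^ J * ?p"
    proof -
      assume a: "exp (- real J / 4 - 1) / 3 \<le> ?p" "(3/2) ^ J / (3 * exp 1) \<le> 2 ^ J * (exp (- real J / 4 - 1) / 3)"
      have "- ln \<gamma> \<le> (3/2) ^ J / (3 * exp 1)" using elim by (simp add: pos_le_divide_eq)
      also note a(2)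
      also have "2 ^ J * (exp (- real J / 4 - 1) / 3) \<le> 2 ^ J * ?p" using a(1) by (intro mult_left_mono) auto
      finally show ?thesis .
    qed
    have "central_prob ?x \<le> exp (- ?p)" using c1 exp_ge_add_one_self[of "- ?p"] by simp
    then have "central_prob ?x ^ (2 ^ J) \<le> exp (- ?p) ^ (2 ^ J)" by (intro power_mono central_prob_nonneg)
    also have "\<dots> = exp (- (2 ^ J * ?p))" by (simp add: exp_of_nat_mult[symmetric])
    also have "\<dots> \<le> exp (ln \<gamma>)" using Np by simp
    also have "\<dots> = \<gamma>" using assms by simp
    finally show ?case .
  qed
qed

text \<open>Enlarging every weight to \<open>V\<close> enlarges the box.\<close>

lemma band_prob_upper:
  assumes I: "finite I" and s: "0 < \<sigma>" and v: "\<And>i. i \<in> I \<Longrightarrow> 0 < v i \<and> v i \<le> V" and x: "0 \<le> x" and V: "0 < V"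
  shows "band_prob I v \<sigma> (x * \<sigma> / V) \<le> central_prob x ^ card I"
proof -
  have "band_prob I v \<sigma> (x * \<sigma> / V) \<le> (\<Prod>i\<in>I. central_prob x)"
    unfolding band_prob_def
  proof (intro prod_mono conjI central_prob_nonneg)
    fix i assume i: "i \<in> I"
    have "x * \<sigma> / V * v i / \<sigma> = x * (v i / V)" using s by simp
    also have "\<dots> \<le> x * 1" using x v[OF i] V by (intro mult_left_mono) auto
    finally show "central_prob (x * \<sigma> / V * v i / \<sigma>) \<le> central_prob x"
      using x s v[OF i] V by (intro central_prob_mono) auto
  qed
  then show ?thesis by simp
qed

lemma
  assumes ob: "orthonormal_basis (full_index J0) \<psi>" and J: "1 \<le> J0" "J0 \<le> J"
  shows sieve_fun_L2: "sieve_fun (sieve_index J0 J) \<psi> y \<in> L2"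
    and sieve_fun_coef: "(l, k) \<in> full_index J0 \<Longrightarrow>
       l2_inner (sieve_fun (sieve_index J0 J) \<psi> y) (\<psi> l k) = (if (l, k) \<in> sieve_index J0 J then y (l, k) else 0)"
proof -
  let ?I = "sieve_index J0 J"
  have fin: "finite ?I" by (rule finite_sieve_index[OF J])
  have L2: "\<psi> l k \<in> L2" if "(l, k) \<in> full_index J0" for l k using ob that unfolding orthonormal_basis_def by blast
  have L2I: "(case i of (l, k) \<Rightarrow> \<psi> l k) \<in> L2" if "i \<in> ?I" for i
    using subsetD[OF sieve_index_subset_full that] L2 by (cases i) auto
  have on: "l2_inner (\<psi> l k) (\<psi> l' k') = (if (l, k) = (l', k') then 1 else 0)"
    if "(l, k) \<in> full_index J0" "(l', k') \<in> full_index J0" for l k l' k'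
    using ob that unfolding orthonormal_basis_def by fast
  have sf: "sieve_fun ?I \<psi> y = (\<lambda>x. \<Sum>i\<in>?I. y i * (case i of (l, k) \<Rightarrow> \<psi> l k) x)"
    by (auto simp: sieve_fun_def fun_eq_iff intro!: sum.cong split: prod.splits)
  show "sieve_fun ?I \<psi> y \<in> L2" unfolding sf by (rule L2_sum[OF fin L2I])
  assume lk: "(l, k) \<in> full_index J0"
  have "l2_inner (sieve_fun ?I \<psi> y) (\<psi> l k) = (\<Sum>i\<in>?I. y i * l2_inner (case i of (l, k) \<Rightarrow> \<psi> l k) (\<psi> l k))"
    unfolding sf by (rule l2_inner_sum_left[OF fin L2I L2[OF lk]])
  also have "\<dots> = (\<Sum>i\<in>?I. if i = (l, k) then y (l, k) else 0)"
    using on[OF subsetD[OF sieve_index_subset_full] lk] by (intro sum.cong) (auto split: prod.splits)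
  finally show "l2_inner (sieve_fun ?I \<psi> y) (\<psi> l k) = (if (l, k) \<in> ?I then y (l, k) else 0)"
    using fin by (simp add: sum.delta)
qed

text \<open>The centre has no coefficients beyond level \<open>J\<close>. Membership in the band therefore
  splits into a condition on the noise and a condition on the bias, the latter being the event
  \<open>H2_event\<close>.\<close>

lemma band_around_sieve_fun_iff:
  assumes ob: "orthonormal_basis (full_index J0) \<psi>" and J: "1 \<le> J0" "J0 \<le> J"
    and w: "\<And>l. J0 - 1 \<le> l \<Longrightarrow> 0 < w l" and f: "f \<in> L2"
  shows "f \<in> cn_band J0 \<psi> w (sieve_fun (sieve_index J0 J) \<psi> y) R \<longleftrightarrow>
     (\<forall>(l, k)\<in>sieve_index J0 J. \<bar>l2_inner f (\<psi> l k) - y (l, k)\<bar> \<le> R * w l) \<and>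
     (\<forall>l\<ge>J. \<forall>k<2 ^ l. \<bar>l2_inner f (\<psi> l k)\<bar> \<le> R * w l)"
    (is "?L \<longleftrightarrow> ?R1 \<and> ?R2")
proof -
  let ?I = "sieve_index J0 J"
  have L2: "\<psi> l k \<in> L2" if "(l, k) \<in> full_index J0" for l k using ob that unfolding orthonormal_basis_def by blast
  have d: "l2_inner (\<lambda>x. f x - sieve_fun ?I \<psi> y x) (\<psi> l k) =
      l2_inner f (\<psi> l k) - (if (l, k) \<in> ?I then y (l, k) else 0)" if lk: "(l, k) \<in> full_index J0" for l k
    using f sieve_fun_L2[OF ob J] L2[OF lk] sieve_fun_coef[OF ob J lk] by (simp add: l2_inner_diff_left)
  have split: "full_index J0 = ?I \<union> {(l, k). J \<le> l \<and> k < 2 ^ l}"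
    using full_minus_sieve[OF J] sieve_index_subset_full[of J0 J] by blast
  have disj: "(l, k) \<notin> ?I" if "J \<le> l" for l k
    using that by (auto simp: sieve_index_eq[OF J])
  have "?L \<longleftrightarrow> (\<forall>(l, k)\<in>full_index J0. \<bar>l2_inner f (\<psi> l k) - (if (l, k) \<in> ?I then y (l, k) else 0)\<bar> \<le> R * w l)"
    using f d by (subst cn_band_iff[OF w J(1)]) auto
  also have "\<dots> \<longleftrightarrow> ?R1 \<and> ?R2"
    unfolding split ball_Un using disj by auto
  finally show "?L \<longleftrightarrow> ?R1 \<and> ?R2" .
qed

lemma H2_event_iff:
  assumes w: "\<And>l. J \<le> l \<Longrightarrow> 0 < w l"
  shows "\<omega> \<in> H2_event \<psi> w J f0 M Rhat \<longleftrightarrow>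
    \<omega> \<in> space M \<and> (\<forall>l\<ge>J. \<forall>k<2 ^ l. \<bar>l2_inner f0 (\<psi> l k)\<bar> \<le> Rhat \<omega> * w l)"
  unfolding H2_event_def using w by (auto simp: SUP_le_iff pos_divide_le_eq)

section \<open>The Castillo--Nickl band in the white noise model\<close>

lemma cdv_basis_coarsest_level:
  assumes "cdv_basis S J0 \<psi>" "1 \<le> S"
  shows "2 \<le> J0"
proof (rule ccontr)
  assume "\<not> 2 \<le> J0"
  then have "(2::nat) ^ J0 \<le> 2 ^ 1" by (intro power_increasing) auto
  moreover from assms(1) obtain N where "S < N" "2 * N \<le> 2 ^ J0" unfolding cdv_basis_def by (elim exE conjE)
  ultimately show False using assms(2) by simp
qed

text \<open>The setting of a single experiment. Sample size, truth, prior, weights and radius are fixed, and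
  the constants of the theorem appear explicitly in the bounds.\<close>

locale sieve_band =
  fixes \<psi> :: "nat \<Rightarrow> nat \<Rightarrow> real \<Rightarrow> real" and J0 J n :: nat and f0 :: "real \<Rightarrow> real"
    and p :: "(nat \<times> nat \<Rightarrow> real) \<Rightarrow> real" and w :: "nat \<Rightarrow> real"
    and M :: "'a measure" and W :: "(real \<Rightarrow> real) \<Rightarrow> 'a \<Rightarrow> real" and Rhat :: "'a \<Rightarrow> real"
    and \<alpha> C1 :: real
  assumes basis: "orthonormal_basis (full_index J0) \<psi>" and J0: "2 \<le> J0" "J0 \<le> J"
    and n: "2 \<le> n" "2 ^ J \<le> n" and \<alpha>: "0 < \<alpha>" "\<alpha> < 1" and C1: "0 < C1"
    and f0: "f0 \<in> L2" and noise: "white_noise M W"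
    and prior: "prior_density (sieve_index J0 J) p"
    and weight_ge: "\<And>l. J0 - 1 \<le> l \<Longrightarrow> sqrt (real l) \<le> w l"
    and radius: "credible_radius J0 \<psi> w \<alpha> n J f0 p M W Rhat"
    and prior_mass: "real n powr (2 ^ J / 2) * real n powr (- C1 * 2 ^ J) \<le> p (coefs (sieve_index J0 J) \<psi> f0)"
    and prior_flat: "lack_of_flatness (sieve_index J0 J) (coefs (sieve_index J0 J) \<psi> f0) n p (1 / sqrt (real n)) \<le> 1 / 2"
begin

abbreviation "I \<equiv> sieve_index J0 J"
abbreviation "\<beta>0 \<equiv> coefs I \<psi> f0"
abbreviation "y \<equiv> data I \<psi> f0 n W"
abbreviation "\<epsilon> \<equiv> real n powr (- (2 ^ J))"

text \<open>\<open>\<kappa>\<close> is the prior's lack of flatness on a ball outside which both the posterior and the Gaussian mass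
  are negligible, \<open>good\<close> is the event that the data are within the usual distance of the truth, and
  \<open>max_cdf\<close> is the distribution function of the weighted maximal error
  of the data.\<close>

definition "\<kappa> = lack_of_flatness I \<beta>0 n p ((C1 + 10) * sqrt (2 ^ J * ln (real n)))"
definition "good = {\<omega> \<in> space M. L2_set (\<lambda>i. y \<omega> i - \<beta>0 i) I \<le> 3 * sqrt (2 ^ J * ln (real n)) / sqrt (real n)}"
definition "max_cdf t = band_prob I (\<lambda>i. w (fst i)) (1 / sqrt (real n)) t"

lemma J01: "1 \<le> J0" using J0 by simp

lemma fin: "finite I" by (rule finite_sieve_index[OF J01 J0(2)])

lemma card_I: "card I = 2 ^ J" by (rule card_sieve_index[OF J01 J0(2)])

lemma I_nonempty: "I \<noteq> {}" using card_I by auto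

lemma J_pos: "1 \<le> J" using J0 by simp

lemma n_pos: "0 < real n" using n by simp

lemma \<sigma>_pos: "0 < 1 / sqrt (real n)" using n_pos by simp

lemma level_I: "(l, k) \<in> I \<Longrightarrow> J0 - 1 \<le> l \<and> l < J"
  by (simp add: sieve_index_eq[OF J01 J0(2)])

lemma w_pos: "J0 - 1 \<le> l \<Longrightarrow> 0 < w l"
  using J0 by (intro less_le_trans[OF _ weight_ge]) auto

lemma w_pos_I: "i \<in> I \<Longrightarrow> 0 < w (fst i)"
  using level_I w_pos by (cases i) auto

sublocale M: prob_space M using noise by (simp add: white_noise_def)

lemma \<beta>0_space: "\<beta>0 \<in> space (coef_space I)"
  by (auto simp: coefs_def space_PiM split: prod.splits)

lemma wavelet_L2: "(l, k) \<in> full_index J0 \<Longrightarrow> \<psi> l k \<in> L2"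
  using basis unfolding orthonormal_basis_def by blast

lemma law: "distr M (coef_space I) y = gauss_prod I (1 / sqrt n) \<beta>0"
  and y_measurable [measurable]: "y \<in> measurable M (coef_space I)"
proof -
  have L2: "\<psi> l k \<in> L2" if "(l, k) \<in> I" for l k
    by (rule wavelet_L2[OF subsetD[OF sieve_index_subset_full that]])
  have on: "l2_inner (\<psi> l k) (\<psi> l' k') = (if (l, k) = (l', k') then 1 else 0)"
    if "(l, k) \<in> I" "(l', k') \<in> I" for l k l' k'
    using basis subsetD[OF sieve_index_subset_full that(1)] subsetD[OF sieve_index_subset_full that(2)]
    unfolding orthonormal_basis_def by fast
  have "0 < n" using n by simp
  show "distr M (coef_space I) y = gauss_prod I (1 / sqrt n) \<beta>0" "y \<in> measurable M (coef_space I)"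
    by (rule data_law[OF noise fin I_nonempty \<open>0 < n\<close> L2 on]; assumption)+
qed

lemma y_component [measurable]: "i \<in> I \<Longrightarrow> (\<lambda>\<omega>. y \<omega> i) \<in> borel_measurable M"
  using measurable_compose[OF y_measurable measurable_component_singleton[of i I "\<lambda>_. lborel"]] by simp

lemma Rhat_measurable [measurable]: "Rhat \<in> borel_measurable M"
  using radius by (simp add: credible_radius_def)

lemma good_sets [measurable]: "good \<in> sets M"
  unfolding good_def L2_set_def using fin by measurable

lemma prob_not_good: "M.prob (space M - good) \<le> \<epsilon>"
proof -
  let ?X = "{x \<in> space (coef_space I). 3 * sqrt (card I * ln n) * (1 / sqrt n) < L2_set (\<lambda>i. x i - \<beta>0 i) I}"
  have X[measurable]: "?X \<in> sets (coef_space I)" unfolding L2_set_def by measurable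
  have "space M - good = y -` ?X \<inter> space M"
    using measurable_space[OF y_measurable] by (auto simp: good_def card_I)
  then have "M.prob (space M - good) = measure (distr M (coef_space I) y) ?X"
    unfolding measure_distr[OF y_measurable X] by (simp only:)
  also have "\<dots> \<le> real n powr (- real (card I))"
    unfolding law by (rule gauss_prod_norm_tail_log[OF fin \<sigma>_pos n(1)])
  finally show ?thesis by (simp add: card_I)
qed

lemma band_iff:
  assumes "f \<in> L2"
  shows "f \<in> cn_band J0 \<psi> w (sieve_fun I \<psi> z) R \<longleftrightarrow>
     (\<forall>(l, k)\<in>I. \<bar>l2_inner f (\<psi> l k) - z (l, k)\<bar> \<le> R * w l) \<and>
     (\<forall>l\<ge>J. \<forall>k<2 ^ l. \<bar>l2_inner f (\<psi> l k)\<bar> \<le> R * w l)"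
  by (rule band_around_sieve_fun_iff[OF basis J01 J0(2) w_pos assms])

text \<open>Both the centre and the sampled functions lie in the sieve, so only the coefficients below level \<open>J\<close> matter:
  the credible set is a weighted sup-norm ball.\<close>

lemma credible_set_eq:
  "{\<beta> \<in> space (coef_space I). sieve_fun I \<psi> \<beta> \<in> cn_band J0 \<psi> w (center I \<psi> f0 n W \<omega>) R}
    = {\<beta> \<in> space (coef_space I). \<forall>i\<in>I. \<bar>\<beta> i - y \<omega> i\<bar> \<le> R * w (fst i)}"
proof (intro Collect_cong conj_cong refl)
  fix \<beta>
  have tail: "l2_inner (sieve_fun I \<psi> \<beta>) (\<psi> l k) = 0" if "J \<le> l" "k < 2 ^ l" for l k
  proof -
    have "(l, k) \<in> full_index J0 - I" using that unfolding full_minus_sieve[OF J01 J0(2)] by simp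
    then show ?thesis using sieve_fun_coef[OF basis J01 J0(2), of l k \<beta>] by simp
  qed
  have coef: "l2_inner (sieve_fun I \<psi> \<beta>) (\<psi> l k) = \<beta> (l, k)" if "(l, k) \<in> I" for l k
    using sieve_fun_coef[OF basis J01 J0(2), of l k \<beta>] subsetD[OF sieve_index_subset_full that] that by simp
  have R0: "0 \<le> R * w l" if Q: "\<forall>i\<in>I. \<bar>\<beta> i - y \<omega> i\<bar> \<le> R * w (fst i)" and l: "J \<le> l" for l
  proof -
    obtain i where i: "i \<in> I" using I_nonempty by blast
    have "0 \<le> R * w (fst i)" using Q i by (meson abs_ge_zero order_trans)
    then have "0 \<le> R" using w_pos_I[OF i] by (simp add: zero_le_mult_iff)
    moreover have "0 < w l" using l J0 by (intro w_pos) simp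
    ultimately show ?thesis by simp
  qed
  have "sieve_fun I \<psi> \<beta> \<in> cn_band J0 \<psi> w (center I \<psi> f0 n W \<omega>) R \<longleftrightarrow>
      (\<forall>(l, k)\<in>I. \<bar>l2_inner (sieve_fun I \<psi> \<beta>) (\<psi> l k) - y \<omega> (l, k)\<bar> \<le> R * w l) \<and>
      (\<forall>l\<ge>J. \<forall>k<2 ^ l. \<bar>l2_inner (sieve_fun I \<psi> \<beta>) (\<psi> l k)\<bar> \<le> R * w l)"
    unfolding center_def by (rule band_iff[OF sieve_fun_L2[OF basis J01 J0(2)]])
  also have "\<dots> \<longleftrightarrow> (\<forall>i\<in>I. \<bar>\<beta> i - y \<omega> i\<bar> \<le> R * w (fst i)) \<and> (\<forall>l\<ge>J. 0 \<le> R * w l)"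
  proof (intro conj_cong)
    show "(\<forall>(l, k)\<in>I. \<bar>l2_inner (sieve_fun I \<psi> \<beta>) (\<psi> l k) - y \<omega> (l, k)\<bar> \<le> R * w l) =
        (\<forall>i\<in>I. \<bar>\<beta> i - y \<omega> i\<bar> \<le> R * w (fst i))"
      using coef by (auto simp: case_prod_beta)
    have "(\<exists>k::nat. k < 2 ^ l)" for l by (rule exI[of _ 0]) simp
    then show "(\<forall>l\<ge>J. \<forall>k<2 ^ l. \<bar>l2_inner (sieve_fun I \<psi> \<beta>) (\<psi> l k)\<bar> \<le> R * w l) = (\<forall>l\<ge>J. 0 \<le> R * w l)"
      using tail by fastforce
  qed
  also have "\<dots> \<longleftrightarrow> (\<forall>i\<in>I. \<bar>\<beta> i - y \<omega> i\<bar> \<le> R * w (fst i))" using R0 by blast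
  finally show "sieve_fun I \<psi> \<beta> \<in> cn_band J0 \<psi> w (center I \<psi> f0 n W \<omega>) R \<longleftrightarrow>
      (\<forall>i\<in>I. \<bar>\<beta> i - y \<omega> i\<bar> \<le> R * w (fst i))" .
qed

text \<open>The credible set has posterior mass \<open>1 - \<alpha>\<close> and Gaussian mass \<open>max_cdf (Rhat \<omega>)\<close>, and the two
  measures are close on the event \<open>good\<close>.\<close>

lemma radius_nearly_quantile:
  assumes \<omega>: "\<omega> \<in> good"
  shows "0 \<le> Rhat \<omega>" "\<bar>max_cdf (Rhat \<omega>) - (1 - \<alpha>)\<bar> \<le> \<kappa> + 2 * \<epsilon>"
proof -
  let ?S = "{\<beta> \<in> space (coef_space I). \<forall>i\<in>I. \<bar>\<beta> i - y \<omega> i\<bar> \<le> Rhat \<omega> * w (fst i)}"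
  have m: "measure (posterior I p n (y \<omega>)) ?S = 1 - \<alpha>"
    using radius \<omega> unfolding credible_radius_def credible_set_eq good_def by blast
  then have "?S \<noteq> {}" using \<alpha> by (intro notI) simp
  then obtain \<beta> where b: "\<forall>i\<in>I. \<bar>\<beta> i - y \<omega> i\<bar> \<le> Rhat \<omega> * w (fst i)" by blast
  obtain i where i: "i \<in> I" using I_nonempty by blast
  have "0 \<le> Rhat \<omega> * w (fst i)" using b i by (meson abs_ge_zero order_trans)
  then show "0 \<le> Rhat \<omega>" using w_pos_I[OF i] by (simp add: zero_le_mult_iff)
  have S: "?S \<in> sets (coef_space I)" using fin by measurable
  have g: "measure (gauss_prod I (1 / sqrt n) (y \<omega>)) ?S = max_cdf (Rhat \<omega>)"
    unfolding max_cdf_def band_prob_def by (rule gauss_prod_box[OF fin \<sigma>_pos])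
  have "(4::nat) \<le> 2 ^ J" using power_increasing[of 2 J "2::nat"] J0 by simp
  then have d: "3 \<le> card I" "card I \<le> n" using n(2) by (auto simp: card_I)
  have "\<bar>measure (posterior I p n (y \<omega>)) ?S - measure (gauss_prod I (1 / sqrt n) (y \<omega>)) ?S\<bar>
      \<le> lack_of_flatness I \<beta>0 n p ((C1 + 10) * sqrt (card I * ln n)) + 2 * real n powr (- real (card I))"
    by (rule posterior_near_gauss[OF fin d n(1) prior \<beta>0_space C1 _ prior_flat _ S])
       (use prior_mass \<omega> in \<open>auto simp: card_I good_def\<close>)
  then show "\<bar>max_cdf (Rhat \<omega>) - (1 - \<alpha>)\<bar> \<le> \<kappa> + 2 * \<epsilon>"
    unfolding m g by (simp add: \<kappa>_def card_I abs_minus_commute)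
qed

lemma \<kappa>_nonneg: "0 \<le> \<kappa>"
  unfolding \<kappa>_def
proof (rule flatness_bounds(1)[of I p \<beta>0, OF _ _ \<beta>0_space])
  show "0 < p \<beta>0" using n_pos by (intro less_le_trans[OF _ prior_mass]) simp
  show "0 \<le> (C1 + 10) * sqrt (2 ^ J * ln (real n))" using C1 n by simp
qed (use prior in \<open>simp add: prior_density_def\<close>)

lemma max_cdf_strict_mono: "0 \<le> r \<Longrightarrow> r < t \<Longrightarrow> max_cdf r < max_cdf t"
  unfolding max_cdf_def by (rule band_prob_strict_mono[OF fin I_nonempty \<sigma>_pos w_pos_I])

lemma max_cdf_less_imp_less: "0 \<le> t \<Longrightarrow> max_cdf r < max_cdf t \<Longrightarrow> r < t"
  by (rule ccontr) (use max_cdf_strict_mono[of t r] in \<open>cases "r = t"; fastforce simp: not_less\<close>)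

text \<open>The centre of the Gaussian measure does not affect the mass of a ball around it; hence the
  frequentist law of the estimation error and the Gaussian approximation of the posterior share
  the same distribution function.\<close>

lemma prob_centred_max: "M.prob {\<omega> \<in> space M. \<forall>i\<in>I. \<bar>y \<omega> i - \<beta>0 i\<bar> \<le> t * w (fst i)} = max_cdf t"
proof -
  let ?X = "{x \<in> space (coef_space I). \<forall>i\<in>I. \<bar>x i - \<beta>0 i\<bar> \<le> t * w (fst i)}"
  have X[measurable]: "?X \<in> sets (coef_space I)" using fin by measurable
  have "{\<omega> \<in> space M. \<forall>i\<in>I. \<bar>y \<omega> i - \<beta>0 i\<bar> \<le> t * w (fst i)} = y -` ?X \<inter> space M"
    using measurable_space[OF y_measurable] by auto
  then have "M.prob {\<omega> \<in> space M. \<forall>i\<in>I. \<bar>y \<omega> i - \<beta>0 i\<bar> \<le> t * w (fst i)} = measure (distr M (coef_space I) y) ?X"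
    unfolding measure_distr[OF y_measurable X] by (simp only:)
  also have "\<dots> = max_cdf t"
    unfolding law max_cdf_def band_prob_def by (rule gauss_prod_box[OF fin \<sigma>_pos])
  finally show ?thesis .
qed

lemma H2_event_iff': "\<omega> \<in> H2_event \<psi> w J f0 M Rhat \<longleftrightarrow>
    \<omega> \<in> space M \<and> (\<forall>l\<ge>J. \<forall>k<2 ^ l. \<bar>l2_inner f0 (\<psi> l k)\<bar> \<le> Rhat \<omega> * w l)"
  using J0 by (intro H2_event_iff w_pos) simp

lemma coverage:
  "\<bar>M.prob {\<omega> \<in> space M. f0 \<in> cn_band J0 \<psi> w (center I \<psi> f0 n W \<omega>) (Rhat \<omega>)} - (1 - \<alpha>)\<bar>
    \<le> \<kappa> + 3 * \<epsilon> + M.prob (space M - H2_event \<psi> w J f0 M Rhat)"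
proof -
  define Q where "Q \<omega> t \<longleftrightarrow> (\<forall>i\<in>I. \<bar>y \<omega> i - \<beta>0 i\<bar> \<le> t * w (fst i))" for \<omega> t
  let ?H = "H2_event \<psi> w J f0 M Rhat"
  let ?E = "{\<omega> \<in> space M. Q \<omega> (Rhat \<omega>)}"
  let ?B = "{\<omega> \<in> space M. f0 \<in> cn_band J0 \<psi> w (center I \<psi> f0 n W \<omega>) (Rhat \<omega>)}"
  have Hs[measurable]: "?H \<in> sets M"
  proof -
    have "?H = {\<omega> \<in> space M. \<forall>l\<in>{J..}. \<forall>k\<in>{..<2 ^ l}. \<bar>l2_inner f0 (\<psi> l k)\<bar> \<le> Rhat \<omega> * w l}"
      using H2_event_iff' by auto
    also have "\<dots> \<in> sets M" by measurable
    finally show ?thesis .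
  qed
  have Es[measurable]: "?E \<in> sets M" unfolding Q_def using fin by measurable
  have Q_mono: "Q \<omega> t" if "Q \<omega> r" "r \<le> t" for \<omega> r t
    unfolding Q_def
  proof
    fix i assume i: "i \<in> I"
    have "\<bar>y \<omega> i - \<beta>0 i\<bar> \<le> r * w (fst i)" using that i by (auto simp: Q_def)
    also have "\<dots> \<le> t * w (fst i)" using that w_pos_I[OF i] by (intro mult_right_mono) auto
    finally show "\<bar>y \<omega> i - \<beta>0 i\<bar> \<le> t * w (fst i)" .
  qed
  have "\<bar>M.prob ?E - (1 - \<alpha>)\<bar> \<le> (\<kappa> + 2 * \<epsilon>) + M.prob (space M - good)"
  proof (rule coverage_of_random_radius[where F=max_cdf, OF M.prob_space_axioms Q_mono])
    show "{\<omega> \<in> space M. Q \<omega> t} \<in> sets M" for t unfolding Q_def using fin by measurable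
    show "M.prob {\<omega> \<in> space M. Q \<omega> t} = max_cdf t" for t unfolding Q_def by (rule prob_centred_max)
    show "\<exists>t\<ge>0. max_cdf t = q" if "0 < q" "q < 1" for q
      unfolding max_cdf_def by (rule band_prob_surj[OF fin I_nonempty \<sigma>_pos w_pos_I that])
    show "0 \<le> Rhat \<omega> \<and> \<bar>max_cdf (Rhat \<omega>) - (1 - \<alpha>)\<bar> \<le> \<kappa> + 2 * \<epsilon>" if "\<omega> \<in> good" for \<omega>
      using radius_nearly_quantile[OF that] by simp
  qed (use \<alpha> \<kappa>_nonneg max_cdf_strict_mono in auto)
  then have 1: "\<bar>M.prob ?E - (1 - \<alpha>)\<bar> \<le> \<kappa> + 3 * \<epsilon>" using prob_not_good by linarith
  have "?B = ?E \<inter> ?H"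
  proof -
    have "f0 \<in> cn_band J0 \<psi> w (center I \<psi> f0 n W \<omega>) (Rhat \<omega>) \<longleftrightarrow> \<omega> \<in> ?E \<inter> ?H" if "\<omega> \<in> space M" for \<omega>
      unfolding center_def band_iff[OF f0]
      using that by (auto simp: H2_event_iff' Q_def coefs_def abs_minus_commute)
    then show ?thesis using H2_event_iff' by auto
  qed
  then have B: "M.prob ?B \<le> M.prob ?E" by (auto intro!: M.finite_measure_mono)
  have "M.prob ?E \<le> M.prob (?B \<union> (space M - ?H))"
    unfolding \<open>?B = ?E \<inter> ?H\<close> by (intro M.finite_measure_mono) auto
  also have "\<dots> \<le> M.prob ?B + M.prob (space M - ?H)"
    unfolding \<open>?B = ?E \<inter> ?H\<close> by (intro measure_Un_le) auto
  finally show ?thesis using B 1 by linarith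
qed

text \<open>The radius is below a fixed multiple of \<open>n\<close> to the power \<open>-1/2\<close>, because that multiple is already beyond the quantile
  of order \<open>1 - \<alpha> / 2\<close>.\<close>

lemma radius_upper:
  assumes small: "\<kappa> + 2 * \<epsilon> < \<alpha> / 2" and \<omega>: "\<omega> \<in> good"
  shows "Rhat \<omega> \<le> sqrt (4 * ln (24 / \<alpha>)) / sqrt (real n)"
proof -
  let ?t = "sqrt (4 * ln (24 / \<alpha>)) * (1 / sqrt (real n))"
  have "0 \<le> ln (24 / \<alpha>)" using \<alpha> by (intro ln_ge_zero) (simp add: field_simps)
  then have t0: "0 \<le> ?t" by simp
  have "1 - \<alpha> / 2 \<le> max_cdf ?t" unfolding max_cdf_def
    by (rule band_prob_lower[OF \<alpha> J0 weight_ge \<sigma>_pos])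
  moreover have "max_cdf (Rhat \<omega>) < 1 - \<alpha> / 2"
    using radius_nearly_quantile(2)[OF \<omega>] small by linarith
  ultimately have "max_cdf (Rhat \<omega>) < max_cdf ?t" by linarith
  then have "Rhat \<omega> < ?t" by (rule max_cdf_less_imp_less[OF t0])
  then show ?thesis by simp
qed

text \<open>The maximum over the \<open>2 ^ J\<close> coordinates exceeds a multiple of \<open>sqrt J\<close>, divided by the largest weight, with probability close
  to one, so even a low quantile is at least of that order.\<close>

lemma radius_lower:
  assumes small: "\<kappa> + 2 * \<epsilon> < (1 - \<alpha>) / 2" and \<omega>: "\<omega> \<in> good"
    and J: "central_prob (sqrt (real J) / 2) ^ (2 ^ J) \<le> (1 - \<alpha>) / 2"
  shows "sqrt (real J) / (2 * sqrt (real n) * w_max J0 w J) \<le> Rhat \<omega>"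
proof -
  let ?V = "w_max J0 w J"
  have V: "w l \<le> ?V" if "J0 - 1 \<le> l" "l < J" for l
    unfolding w_max_def using that by (intro Max_ge) auto
  have V0: "0 < ?V" using J0 by (intro less_le_trans[OF w_pos V, of "J0 - 1"]) auto
  let ?t = "sqrt (real J) / 2 * (1 / sqrt (real n)) / ?V"
  have "max_cdf ?t \<le> central_prob (sqrt (real J) / 2) ^ card I"
    unfolding max_cdf_def
  proof (rule band_prob_upper[OF fin \<sigma>_pos _ _ V0])
    show "0 < w (fst i) \<and> w (fst i) \<le> ?V" if "i \<in> I" for i
      using that V level_I w_pos by (cases i) auto
  qed simp
  also have "\<dots> \<le> (1 - \<alpha>) / 2" using J by (simp add: card_I)
  also have "\<dots> < max_cdf (Rhat \<omega>)"
    using radius_nearly_quantile(2)[OF \<omega>] small by (simp add: abs_le_iff field_simps)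
  finally have "?t < Rhat \<omega>" by (rule max_cdf_less_imp_less[OF radius_nearly_quantile(1)[OF \<omega>]])
  then show ?thesis by (simp add: mult_ac)
qed

text \<open>The Besov ball bounds the coefficients of the truth beyond level \<open>J\<close>, and the lower bound on
  the radius exceeds them as soon as the given ratio is at most \<open>1/2\<close>, because
  \<open>w l \<ge> u_weight w J * sqrt J\<close> there.\<close>

lemma good_subset_H2:
  assumes small: "\<kappa> + 2 * \<epsilon> < (1 - \<alpha>) / 2" and s: "0 < s" and B: "0 < B" "besov_norm J0 \<psi> s f0 \<le> ereal B"
    and J: "central_prob (sqrt (real J) / 2) ^ (2 ^ J) \<le> (1 - \<alpha>) / 2"
    and bias: "sqrt (real n) * w_max J0 w J * B / (u_weight w J * real J * 2 powr (real J * (s + 1/2))) \<le> 1 / 2"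
  shows "good \<subseteq> H2_event \<psi> w J f0 M Rhat"
proof
  fix \<omega> assume \<omega>: "\<omega> \<in> good"
  let ?V = "w_max J0 w J" and ?u = "u_weight w J" and ?e = "2 powr (real J * (s + 1/2))"
  have V0: "0 < ?V"
  proof -
    have "w (J0 - 1) \<le> ?V" unfolding w_max_def using J0 by (intro Max_ge) auto
    then show ?thesis using w_pos[of "J0 - 1"] by simp
  qed
  have ratio: "1 \<le> w l / sqrt (real l)" if "J \<le> l" for l
    using that J0 weight_ge[of l] by simp
  have u1: "1 \<le> ?u"
    unfolding u_weight_def by (rule cINF_greatest) (use ratio in auto)
  have u: "?u * sqrt (real l) \<le> w l" if l: "J \<le> l" for l
  proof -
    have "?u \<le> w l / sqrt (real l)"
      unfolding u_weight_def using l ratio by (intro cINF_lower bdd_belowI[where m=1]) auto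
    then show ?thesis using l J0 by (simp add: pos_le_divide_eq)
  qed
  have R0: "0 \<le> Rhat \<omega>" by (rule radius_nearly_quantile(1)[OF \<omega>])
  have "\<bar>l2_inner f0 (\<psi> l k)\<bar> \<le> Rhat \<omega> * w l" if l: "J \<le> l" "k < 2 ^ l" for l k
  proof -
    have "\<bar>l2_inner f0 (\<psi> l k)\<bar> \<le> B * 2 powr (- real l * (s + 1/2))"
      using l J0 by (intro besov_norm_coef[OF B(2)]) auto
    also have "\<dots> \<le> B * 2 powr (- real J * (s + 1/2))"
      using B s l by (intro mult_left_mono powr_mono) (auto intro: mult_right_mono)
    also have "\<dots> = B / ?e" by (simp add: powr_minus_divide)
    also have "\<dots> \<le> sqrt (real J) / (2 * sqrt (real n) * ?V) * (?u * sqrt (real J))"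
    proof -
      have pos: "0 < ?u * real J * ?e" "0 < sqrt (real n) * ?V" using u1 J_pos n_pos V0 by (auto intro!: mult_pos_pos)
      have "sqrt (real n) * ?V * B \<le> 1/2 * (?u * real J * ?e)"
        using bias pos(1) by (simp only: pos_divide_le_eq)
      then have "B / ?e \<le> (?u * real J) / (2 * (sqrt (real n) * ?V))"
        using pos by (simp add: field_simps)
      also have "real J = sqrt (real J) * sqrt (real J)" by simp
      finally show ?thesis by (simp add: mult_ac)
    qed
    also have "\<dots> \<le> Rhat \<omega> * (?u * sqrt (real l))"
      using radius_lower[OF small \<omega> J] R0 l u1 by (intro mult_mono) auto
    also have "\<dots> \<le> Rhat \<omega> * w l" using u[OF l(1)] R0 by (intro mult_left_mono) auto
    finally show ?thesis .
  qed
  then show "\<omega> \<in> H2_event \<psi> w J f0 M Rhat" using \<omega> by (auto simp: H2_event_iff' good_def)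
qed

lemma diameter:
  assumes small: "\<kappa> + 2 * \<epsilon> < \<alpha> / 2" and s: "0 < s" and B: "0 < B"
    and C: "0 < C" and loc: "\<And>l x. J0 - 1 \<le> l \<Longrightarrow> x \<in> {0..1} \<Longrightarrow> (\<Sum>k<level_size J0 l. \<bar>\<psi> l k x\<bar>) \<le> C * 2 powr (real l / 2)"
    and \<omega>: "\<omega> \<in> good"
    and f: "f \<in> cn_band J0 \<psi> w (center I \<psi> f0 n W \<omega>) (Rhat \<omega>)" "besov_norm J0 \<psi> s f \<le> ereal B"
    and g: "g \<in> cn_band J0 \<psi> w (center I \<psi> f0 n W \<omega>) (Rhat \<omega>)" "besov_norm J0 \<psi> s g \<le> ereal B"
  shows "linf_norm (\<lambda>x. f x - g x) \<le>
    ereal (C * (6 * sqrt (4 * ln (24 / \<alpha>)) + 2 / (1 - 2 powr (- s))) *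
      (v_weight J0 w J * sqrt (2 ^ J * real J / real n) + 2 powr (- real J * s) * B))"
proof -
  let ?v = "v_weight J0 w J" and ?K = "sqrt (4 * ln (24 / \<alpha>))" and ?q = "2 / (1 - 2 powr (- s))"
  let ?b = "2 powr (- real J * s) * B" and ?a = "?v * sqrt (2 ^ J * real J / real n)"
  have R: "0 \<le> Rhat \<omega>" "Rhat \<omega> \<le> ?K / sqrt n"
    using radius_nearly_quantile(1)[OF \<omega>] radius_upper[OF small \<omega>] by auto
  have v0: "0 \<le> ?v"
  proof -
    have v_ge: "w l / sqrt (real l) \<le> ?v" if "J0 - 1 \<le> l" "l < J" for l
      unfolding v_weight_def using that by (intro Max_ge) auto
    have "w (J0 - 1) / sqrt (real (J0 - 1)) \<le> ?v" by (rule v_ge) (use J0 in auto)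
    moreover have "0 \<le> w (J0 - 1) / sqrt (real (J0 - 1))" using w_pos[of "J0 - 1"] by (intro divide_nonneg_nonneg) auto
    ultimately show ?thesis by linarith
  qed
  have q0: "0 \<le> ?q" using s powr_less_mono[of "-s" 0 "2::real"] by simp
  have K0: "0 \<le> ?K" using \<alpha> by (auto intro!: ln_ge_zero simp: field_simps)
  have a0: "0 \<le> ?a" "0 \<le> ?b" using v0 B by auto
  have fh: "center I \<psi> f0 n W \<omega> \<in> L2"
    unfolding center_def by (rule sieve_fun_L2[OF basis J01 J0(2)])
  have "linf_norm (\<lambda>x. f x - g x) \<le>
    ereal (C * (6 * Rhat \<omega> * ?v * sqrt (2 ^ J * real J) + 2 * B * 2 powr (- real J * s) / (1 - 2 powr (- s))))"
    by (rule band_diameter[OF basis J0 s C loc w_pos fh R(1) B f g])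
  also have "\<dots> \<le> ereal (C * (6 * ?K + ?q) * (?a + ?b))"
  proof -
    have "6 * Rhat \<omega> * ?v * sqrt (2 ^ J * real J) \<le> 6 * (?K / sqrt n) * ?v * sqrt (2 ^ J * real J)"
      using R v0 by (intro mult_right_mono mult_left_mono) auto
    also have "\<dots> = 6 * ?K * ?a" by (simp add: real_sqrt_divide)
    finally have "6 * Rhat \<omega> * ?v * sqrt (2 ^ J * real J) + 2 * B * 2 powr (- real J * s) / (1 - 2 powr (- s))
       \<le> 6 * ?K * ?a + ?q * ?b" by (simp add: mult_ac)
    also have "\<dots> \<le> (6 * ?K + ?q) * (?a + ?b)"
    proof -
      have "0 \<le> 6 * ?K * ?b" "0 \<le> ?q * ?a" using K0 q0 a0 by (auto intro!: mult_nonneg_nonneg)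
      then show ?thesis by (simp add: algebra_simps)
    qed
    finally show ?thesis using C by (simp add: mult.assoc mult_left_mono)
  qed
  finally show ?thesis .
qed

end

theorem proposition3p2:
  fixes s \<alpha> :: real and S J0 :: nat and \<psi> :: "nat \<Rightarrow> nat \<Rightarrow> real \<Rightarrow> real"
  assumes "0 < s" and "s < real S" and "cdv_basis S J0 \<psi>" and "0 < \<alpha>" and "\<alpha> < 1"
  shows "\<exists>J1 :: (nat \<Rightarrow> real) \<Rightarrow> real \<Rightarrow> (nat \<Rightarrow> nat) \<Rightarrow> nat.
    \<forall>C1>0. \<exists>c1>0. \<exists>c2>0. \<exists>c3>0.
    \<forall>(n::nat) J f0 p w (M :: 'a measure) W Rhat I \<beta>0 flat fhat \<epsilon>.
      2 \<le> n \<longrightarrow> J0 \<le> J \<longrightarrow> 2 ^ J \<le> n \<longrightarrow>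
      f0 \<in> besov_space J0 \<psi> s \<longrightarrow>
      white_noise M W \<longrightarrow>
      I = sieve_index J0 J \<longrightarrow>
      \<beta>0 = coefs I \<psi> f0 \<longrightarrow>
      prior_density I p \<longrightarrow>
      admissible_weights w \<longrightarrow> (\<forall>l\<ge>J0 - 1. sqrt (real l) \<le> w l) \<longrightarrow>
      credible_radius J0 \<psi> w \<alpha> n J f0 p M W Rhat \<longrightarrow>
      flat = lack_of_flatness I \<beta>0 n p \<longrightarrow>
      fhat = center I \<psi> f0 n W \<longrightarrow>
      \<epsilon> = c1 * real n powr (- c2 * 2 ^ J) \<longrightarrow>
      p \<beta>0 \<ge> real n powr (2 ^ J / 2) * real n powr (- C1 * 2 ^ J) \<longrightarrow>
      flat (1 / sqrt (real n)) \<le> 1 / 2 \<longrightarrow>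
      (\<forall>B>0. besov_norm J0 \<psi> s f0 \<le> ereal B \<longrightarrow>
        \<bar>measure M {\<omega> \<in> space M. f0 \<in> cn_band J0 \<psi> w (fhat \<omega>) (Rhat \<omega>)} - (1 - \<alpha>)\<bar>
          \<le> flat (c1 * sqrt (2 ^ J * ln (real n))) + \<epsilon>
              + measure M (space M - H2_event \<psi> w J f0 M Rhat) \<and>
        (flat (c1 * sqrt (2 ^ J * ln (real n))) + \<epsilon> < min (\<alpha> / 2) ((1 - \<alpha>) / 2) \<longrightarrow>
          (\<exists>A\<in>sets M. measure M A \<ge> 1 - \<epsilon> \<and>
            (\<forall>\<omega>\<in>A.
              (SUP (f, g)\<in>
                  (cn_band J0 \<psi> w (fhat \<omega>) (Rhat \<omega>) \<inter> {f \<in> L2. besov_norm J0 \<psi> s f \<le> ereal B})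
                \<times> (cn_band J0 \<psi> w (fhat \<omega>) (Rhat \<omega>) \<inter> {f \<in> L2. besov_norm J0 \<psi> s f \<le> ereal B}).
                linf_norm (\<lambda>x. f x - g x))
              \<le> ereal (c3 * (v_weight J0 w J * sqrt (2 ^ J * real J / real n)
                              + 2 powr (- real J * s) * B)))) \<and>
          (\<forall>nseq :: nat \<Rightarrow> nat.
            (\<lambda>j. sqrt (real (nseq j)) * w_max J0 w j * B
                  / (u_weight w j * real j * 2 powr (real j * (s + 1/2)))) \<longlonglongrightarrow> 0 \<longrightarrow>
            nseq J = n \<longrightarrow> J1 w B nseq \<le> J \<longrightarrow>
            measure M (space M - H2_event \<psi> w J f0 M Rhat) \<le> \<epsilon>)))"
proof -
  have "1 \<le> S" using assms(1,2) by (cases S) auto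
  then have J0: "2 \<le> J0" by (rule cdv_basis_coarsest_level[OF assms(3)])
  have basis: "orthonormal_basis (full_index J0) \<psi>"
    using assms(3) unfolding cdv_basis_def by (elim exE conjE)
  obtain C where C: "0 < C" and loc: "\<And>l x. J0 - 1 \<le> l \<Longrightarrow> x \<in> {0..1} \<Longrightarrow>
      (\<Sum>k<level_size J0 l. \<bar>\<psi> l k x\<bar>) \<le> C * 2 powr (real l / 2)"
    using cdv_basis_localised[OF assms(3)] by auto
  define bias where "bias w B nseq j = sqrt (real (nseq j)) * w_max J0 w j * B
                  / (u_weight w j * real j * 2 powr (real j * (s + 1/2)))" for w B and nseq :: "nat \<Rightarrow> nat" and j
  \<comment> \<open>Both thresholds concern the weights and the sample sizes only, so \<open>J1\<close> can be fixed before \<open>C1\<close>.\<close>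
  have "\<exists>J1. \<forall>J\<ge>J1. bias w B nseq \<longlonglongrightarrow> 0 \<longrightarrow>
      bias w B nseq J \<le> 1 / 2 \<and> central_prob (sqrt (real J) / 2) ^ (2 ^ J) \<le> (1 - \<alpha>) / 2" for w B nseq
  proof (cases "bias w B nseq \<longlonglongrightarrow> 0")
    case True
    then have "eventually (\<lambda>j. bias w B nseq j < 1/2) sequentially" by (rule order_tendstoD) simp
    moreover have "eventually (\<lambda>J. central_prob (sqrt (real J) / 2) ^ (2 ^ J) \<le> (1 - \<alpha>) / 2) sequentially"
      using assms(5) by (intro central_prob_power_small) simp
    ultimately have "eventually (\<lambda>J. bias w B nseq J \<le> 1 / 2 \<and> central_prob (sqrt (real J) / 2) ^ (2 ^ J) \<le> (1 - \<alpha>) / 2) sequentially"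
      by eventually_elim simp
    then show ?thesis unfolding eventually_sequentially by blast
  qed simp
  then obtain J1 where J1: "\<And>w B nseq J. J1 w B nseq \<le> J \<Longrightarrow> bias w B nseq \<longlonglongrightarrow> 0 \<Longrightarrow>
      bias w B nseq J \<le> 1 / 2 \<and> central_prob (sqrt (real J) / 2) ^ (2 ^ J) \<le> (1 - \<alpha>) / 2"
    by metis
  define c3 where "c3 = C * (6 * sqrt (4 * ln (24 / \<alpha>)) + 2 / (1 - 2 powr (- s)))"
  have c3: "0 < c3"
  proof -
    have "0 \<le> ln (24 / \<alpha>)" using assms(4,5) by (intro ln_ge_zero) (simp add: field_simps)
    moreover have "2 powr (- s) < 1" using assms(1) powr_less_mono[of "-s" 0 "2::real"] by simp
    ultimately show ?thesis unfolding c3_def using C by (intro mult_pos_pos add_nonneg_pos) auto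
  qed
  show ?thesis
  proof (rule exI[of _ J1], intro allI impI, goal_cases)
    case C1: (1 C1)
    show ?case
    proof (rule exI[of _ "C1 + 10"], rule conjI[rotated], rule exI[of _ 1], rule conjI[rotated],
        rule exI[of _ c3], rule conjI[rotated], intro allI impI, goal_cases)
      case prems: (1 n J f0 p w M W Rhat I \<beta>0 flat fhat \<epsilon> B)
      note eqs = prems(6,7,12,13)
      interpret L: sieve_band \<psi> J0 J n f0 p w M W Rhat \<alpha> C1
        using prems(1-5,8,10,11,15,16) basis J0 assms(4,5) C1
        by unfold_locales (auto simp: eqs besov_space_def)
      let ?H = "H2_event \<psi> w J f0 M Rhat"
      have e: "\<epsilon> = (C1 + 10) * real n powr (- (2 ^ J))" using prems(14) by simp
      have e0: "0 \<le> real n powr (- (2 ^ J))" by simp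
      \<comment> \<open>Room for the three exceptional probabilities in the coverage bound.\<close>
      have e3: "3 * real n powr (- (2 ^ J)) \<le> \<epsilon>"
        unfolding e using C1 by (intro mult_right_mono) auto
      have fl: "flat ((C1 + 10) * sqrt (2 ^ J * ln (real n))) = L.\<kappa>"
        by (simp add: eqs L.\<kappa>_def)
      have good: "1 - \<epsilon> \<le> measure M L.good"
        using L.prob_not_good L.M.prob_compl[OF L.good_sets] e3 e0 by linarith
      show ?case
      proof (intro conjI impI)
        show "\<bar>measure M {\<omega> \<in> space M. f0 \<in> cn_band J0 \<psi> w (fhat \<omega>) (Rhat \<omega>)} - (1 - \<alpha>)\<bar>
          \<le> flat ((C1 + 10) * sqrt (2 ^ J * ln (real n))) + \<epsilon> + measure M (space M - ?H)"
          using L.coverage e3 unfolding fl unfolding eqs by linarith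
      next
        assume "flat ((C1 + 10) * sqrt (2 ^ J * ln (real n))) + \<epsilon> < min (\<alpha> / 2) ((1 - \<alpha>) / 2)"
        then have small: "L.\<kappa> + 2 * real n powr (- (2 ^ J)) < \<alpha> / 2" "L.\<kappa> + 2 * real n powr (- (2 ^ J)) < (1 - \<alpha>) / 2"
          using e3 e0 unfolding fl by linarith+
        show "\<exists>A\<in>sets M. measure M A \<ge> 1 - \<epsilon> \<and>
            (\<forall>\<omega>\<in>A.
              (SUP (f, g)\<in>
                  (cn_band J0 \<psi> w (fhat \<omega>) (Rhat \<omega>) \<inter> {f \<in> L2. besov_norm J0 \<psi> s f \<le> ereal B})
                \<times> (cn_band J0 \<psi> w (fhat \<omega>) (Rhat \<omega>) \<inter> {f \<in> L2. besov_norm J0 \<psi> s f \<le> ereal B}).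
                linf_norm (\<lambda>x. f x - g x))
              \<le> ereal (c3 * (v_weight J0 w J * sqrt (2 ^ J * real J / real n)
                              + 2 powr (- real J * s) * B)))"
        proof (intro bexI[of _ L.good] conjI ballI good L.good_sets SUP_least)
          fix \<omega> fg
          assume \<omega>: "\<omega> \<in> L.good" and fg: "fg \<in>
                  (cn_band J0 \<psi> w (fhat \<omega>) (Rhat \<omega>) \<inter> {f \<in> L2. besov_norm J0 \<psi> s f \<le> ereal B})
                \<times> (cn_band J0 \<psi> w (fhat \<omega>) (Rhat \<omega>) \<inter> {f \<in> L2. besov_norm J0 \<psi> s f \<le> ereal B})"
          obtain f g where "fg = (f, g)" by (cases fg)
          then show "(case fg of (f, g) \<Rightarrow> linf_norm (\<lambda>x. f x - g x)) \<le>
              ereal (c3 * (v_weight J0 w J * sqrt (2 ^ J * real J / real n) + 2 powr (- real J * s) * B))"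
            using fg L.diameter[OF small(1) assms(1) prems(17) C loc \<omega>, of f g] unfolding c3_def eqs by simp
        qed
      next
        assume "flat ((C1 + 10) * sqrt (2 ^ J * ln (real n))) + \<epsilon> < min (\<alpha> / 2) ((1 - \<alpha>) / 2)"
        then have small: "L.\<kappa> + 2 * real n powr (- (2 ^ J)) < (1 - \<alpha>) / 2"
          using e3 e0 unfolding fl by linarith
        show "\<forall>nseq :: nat \<Rightarrow> nat.
            (\<lambda>j. sqrt (real (nseq j)) * w_max J0 w j * B
                  / (u_weight w j * real j * 2 powr (real j * (s + 1/2)))) \<longlonglongrightarrow> 0 \<longrightarrow>
            nseq J = n \<longrightarrow> J1 w B nseq \<le> J \<longrightarrow>
            measure M (space M - ?H) \<le> \<epsilon>"
        proof (intro allI impI)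
          fix nseq :: "nat \<Rightarrow> nat"
          assume lim: "(\<lambda>j. sqrt (real (nseq j)) * w_max J0 w j * B
                  / (u_weight w j * real j * 2 powr (real j * (s + 1/2)))) \<longlonglongrightarrow> 0"
            and nJ: "nseq J = n" "J1 w B nseq \<le> J"
          have large: "bias w B nseq J \<le> 1 / 2" "central_prob (sqrt (real J) / 2) ^ (2 ^ J) \<le> (1 - \<alpha>) / 2"
            using J1[OF nJ(2)] lim by (auto simp: bias_def[abs_def])
          have "L.good \<subseteq> ?H"
            by (rule L.good_subset_H2[OF small assms(1) prems(17,18) large(2)])
               (use large(1) nJ(1) in \<open>simp add: bias_def\<close>)
          then have "measure M (space M - ?H) \<le> measure M (space M - L.good)"
            by (intro L.M.finite_measure_mono) auto
          then show "measure M (space M - ?H) \<le> \<epsilon>" using L.prob_not_good e3 e0 by linarith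
        qed
      qed
    qed (use c3 C1 in auto)
  qed
qed

end
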